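(* (i) Let $K$ be a proper cone of $\mathbb{R}^n$ with the property that the dual cone of each of its faces is a facially exposed cone, and let $A\in\pi(K)$. Then for any nonzero $A$-invariant face $F$ of $K$, $F$ is semi-distinguished $A$-invariant if and only if $\operatorname{sp}_A(G)\prec\operatorname{sp}_A(F)$ for all $A$-invariant faces $G$ properly included in $F$. Consequently, for all distinguished eigenvalues $\lambda$ of $A$ for $K$, the following equivalent conditions are satisfied: (1) for each nonzero $A$-invariant face $F$ of $K$ associated with $\lambda$, there exists a semi-distinguished $A$-invariant face $G\subseteq F$ such that $\operatorname{sp}_A(G)=\operatorname{sp}_A(F)$; (2) for each nonzero $A$-invariant face $F$ of $K$ associated with $\lambda$, there exists in $F$ a generalized eigenvector of $A$ corresponding to $\lambda$ of order $\nu_\lambda(A|_{\operatorname{span}F})$; (3) for each nonzero $A$-invariant face $F$ of $K$ associated with $\lambda$, $F$ is a semi-distinguished $A$-invariant face if $\operatorname{sp}_A(G)\prec\operatorname{sp}_A(F)$ for all $A$-invariant faces $G$ properly included in $F$; and hence also the condition (4) for any $A$-invariant face $F$ of $K$ which contains in its relative interior a generalized eigenvector of $A$ corresponding to $\lambda$, there exists a semi-distinguished $A$-invariant face $G$ included in $F$ such that $\operatorname{sp}_A(G)=\operatorname{sp}_A(F)$. (ii) A proper cone $K$ has the property that the dual cone of each of its faces is a facially exposed cone if it fulfills one of the following conditions: (a) $K^*$ is a facially exposed cone and all nontrivial faces of $K$ are polyhedral (which is the case if $K$ is polyhedral, or is a strictly convex smooth cone); (b) $K$ is a perfect cone; (c)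 $K$ equals $P(n)$ for some nonnegative integer $n$.
   Context: A proper cone of $\mathbb{R}^n$ (or of a finite-dimensional real vector space) is a closed convex cone that is pointed ($K\cap(-K)=\{0\}$) and has nonempty interior; it is polyhedral if it has finitely many extreme rays. $\pi(K)$ is the set of real matrices $A$ with $AK\subseteq K$. A face of $K$ is a convex subcone $F\subseteq K$ such that $x,y\in K$, $x+y\in F$ imply $x,y\in F$; nontrivial faces are those other than $\{0\}$ and $K$. A face $F$ is $A$-invariant if $AF\subseteq F$; then $\rho_F$ is the spectral radius of $A|_{\operatorname{span}F}$, and $F$ is associated with $\rho_F$. $\Phi(S)$ is the smallest face of $K$ including $S$; $F\vee G=\Phi(F\cup G)$. Each face $F$ is a proper cone in $\operatorname{span}F$, and notions such as the dual cone of $F$ or polyhedrality of $F$ are understood in $\operatorname{span}F$. The dual cone is $K^*=\{z:\langle z,x\rangle\ge0\ \forall x\in K\}$; for a face $F$ of $K$, $d_K(F)=(\operatorname{span}F)^\perp\cap K^*$. A face $F$ of $K$ is exposed if $F=d_{K^*}(G)$ for some face $G$ of $K^*$; $K$ is facially exposed if all its faces are exposed. $K$ is strictly convex if each nontrivial face is one-dimensional, and smooth if $\dim d_K(\Phi(x))=1$ for each nonzero boundary vector $x$ of $K$. $K$ is perfect if each of its faces is self-dual in its own linear span. $P(n)$ is the cone of all real polynomials of degree not exceeding $n$ that are nonnegative on $[0,1]$. A generalized eigenvector of $A$ corresponding to $\lambda\in\mathbb{C}$ is a nonzero vector $x$ with $(\lambda I-A)^kx=0$ for some positive integer $k$; the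 least such $k$ is its order. $\nu_\lambda(B)$ is the index of the eigenvalue $\lambda$ of $B$ (size of the largest Jordan block for $\lambda$). A distinguished eigenvalue of $A$ for $K$ is an eigenvalue having an eigenvector in $K$. An $A$-invariant face is $A$-invariant join-irreducible if it is not the join of two $A$-invariant faces properly included in it. A semi-distinguished $A$-invariant face is an $A$-invariant join-irreducible face containing in its relative interior a generalized eigenvector of $A$. Spectral pairs: a nonzero vector $x$ is written uniquely as $x=x_1+\dots+x_m$ with $x_i$ generalized eigenvectors of $A$ (over $\mathbb{C}$) corresponding to distinct eigenvalues $\lambda_1,\dots,\lambda_m$. Then $\rho_x(A)=\max_i|\lambda_i|$, $\operatorname{ord}_A(x)$ is the maximum of the orders of those $x_i$ with $|\lambda_i|=\rho_x(A)$, and $\operatorname{sp}_A(x)=(\rho_x(A),\operatorname{ord}_A(x))$; $\operatorname{sp}_A(0)=(0,0)$. For a face $F$, $\operatorname{sp}_A(x)$ has the same value for all $x\in\operatorname{relint}F$, denoted $\operatorname{sp}_A(F)$. $(\xi_1,\xi_2)\preceq(\eta_1,\eta_2)$ means $\xi_1<\eta_1$, or $\xi_1=\eta_1$ and $\xi_2\le\eta_2$; $\prec$ means $\preceq$ and not equal. *)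

theory Defs
  imports "HOL-Analysis.Analysis" "Jordan_Normal_Form.Spectral_Radius"
begin

no_notation Matrix.vec_index (infixl \<open>$\<close> 100)
no_notation Matrix.scalar_prod (infix \<open>\<bullet>\<close> 70)

section \<open>Cones and faces\<close>

definition proper_cone :: "'a::euclidean_space set \<Rightarrow> bool" where
  "proper_cone K \<longleftrightarrow>
     convex_cone K \<and> closed K \<and> K \<inter> uminus ` K = {0} \<and> interior K \<noteq> {}"

text \<open>Faces are nonempty, since \<^const>\<open>convex_cone\<close> requires it; so they contain 0.\<close>

definition cone_face :: "'a::euclidean_space set \<Rightarrow> 'a set \<Rightarrow> bool" where
  "cone_face F K \<longleftrightarrow>
     convex_cone F \<and> F \<subseteq> K \<and> (\<forall>x\<in>K. \<forall>y\<in>K. x + y \<in> F \<longrightarrow> x \<in> F \<and> y \<in> F)"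

definition nontrivial_face :: "'a::euclidean_space set \<Rightarrow> 'a set \<Rightarrow> bool" where
  "nontrivial_face F K \<longleftrightarrow> cone_face F K \<and> F \<noteq> {0} \<and> F \<noteq> K"

definition face_gen :: "'a::euclidean_space set \<Rightarrow> 'a set \<Rightarrow> 'a set" where
  "face_gen K S = \<Inter>{F. cone_face F K \<and> S \<subseteq> F}"

definition face_join :: "'a::euclidean_space set \<Rightarrow> 'a set \<Rightarrow> 'a set \<Rightarrow> 'a set" where
  "face_join K F G = face_gen K (F \<union> G)"

definition extreme_ray :: "'a::euclidean_space set \<Rightarrow> 'a set \<Rightarrow> bool" where
  "extreme_ray R K \<longleftrightarrow> cone_face R K \<and> (\<exists>x. x \<noteq> 0 \<and> R = {c *\<^sub>R x | c. 0 \<le> c})"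

definition polyhedral_cone :: "'a::euclidean_space set \<Rightarrow> bool" where
  "polyhedral_cone K \<longleftrightarrow> finite {R. extreme_ray R K}"

section \<open>Duality\<close>

text \<open>The dual is taken inside the linear span of the cone, which is the convention for faces.
  For a proper cone the span is the whole space, and this is the usual dual cone.\<close>

definition dual_cone :: "'a::euclidean_space set \<Rightarrow> 'a set" where
  "dual_cone C = {z \<in> span C. \<forall>x\<in>C. 0 \<le> z \<bullet> x}"

definition dual_face :: "'a::euclidean_space set \<Rightarrow> 'a set \<Rightarrow> 'a set" where
  "dual_face C F = orthogonal_comp (span F) \<inter> dual_cone C"

definition exposed_face :: "'a::euclidean_space set \<Rightarrow> 'a set \<Rightarrow> bool" where
  "exposed_face F C \<longleftrightarrow> (\<exists>G. cone_face G (dual_cone C) \<and> F = dual_face (dual_cone C) G)"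

definition facially_exposed :: "'a::euclidean_space set \<Rightarrow> bool" where
  "facially_exposed C \<longleftrightarrow> (\<forall>F. cone_face F C \<longrightarrow> exposed_face F C)"

definition dual_faces_exposed :: "'a::euclidean_space set \<Rightarrow> bool" where
  "dual_faces_exposed K \<longleftrightarrow> (\<forall>F. cone_face F K \<longrightarrow> facially_exposed (dual_cone F))"

definition strictly_convex_cone :: "'a::euclidean_space set \<Rightarrow> bool" where
  "strictly_convex_cone K \<longleftrightarrow> (\<forall>F. nontrivial_face F K \<longrightarrow> dim F = 1)"

definition smooth_cone :: "'a::euclidean_space set \<Rightarrow> bool" where
  "smooth_cone K \<longleftrightarrow> (\<forall>x\<in>frontier K. x \<noteq> 0 \<longrightarrow> dim (dual_face K (face_gen K {x})) = 1)"

definition perfect_cone :: "'a::euclidean_space set \<Rightarrow> bool" where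
  "perfect_cone K \<longleftrightarrow> (\<forall>F. cone_face F K \<longrightarrow> dual_cone F = F)"

definition poly_cone :: "nat \<Rightarrow> real poly set" where
  "poly_cone n = {p. degree p \<le> n \<and> (\<forall>t\<in>{0..1}. 0 \<le> poly p t)}"

text \<open>The polynomials of degree at most \<open>n\<close> carry no preferred inner product, so they may be
  identified with the ambient Euclidean space by any linear isomorphism.\<close>

definition is_poly_cone :: "nat \<Rightarrow> 'a::euclidean_space set \<Rightarrow> bool" where
  "is_poly_cone n K \<longleftrightarrow>
     (\<exists>\<phi>. Vector_Spaces.linear Polynomial.smult (*\<^sub>R) \<phi> \<and>
          bij_betw \<phi> {p. degree p \<le> n} UNIV \<and> K = \<phi> ` poly_cone n)"

section \<open>Generalized eigenvectors and spectral pairs\<close>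

definition cvec :: "real^'n \<Rightarrow> complex^'n" where
  "cvec x = (\<chi> i. complex_of_real (x $ i))"

definition shift_map :: "real^'n^'n \<Rightarrow> complex \<Rightarrow> complex^'n \<Rightarrow> complex^'n" where
  "shift_map A \<mu> v = \<mu> *s v - map_matrix complex_of_real A *v v"

definition gen_eigvec :: "real^'n^'n \<Rightarrow> complex \<Rightarrow> complex^'n \<Rightarrow> bool" where
  "gen_eigvec A \<mu> v \<longleftrightarrow> v \<noteq> 0 \<and> (\<exists>k>0. (shift_map A \<mu> ^^ k) v = 0)"

definition eigvec_order :: "real^'n^'n \<Rightarrow> complex \<Rightarrow> complex^'n \<Rightarrow> nat" where
  "eigvec_order A \<mu> v = (LEAST k. 0 < k \<and> (shift_map A \<mu> ^^ k) v = 0)"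

text \<open>The decomposition of \<open>x\<close> into generalized eigenvectors for distinct eigenvalues,
  as the map sending an eigenvalue to the corresponding component, and everything else to 0.\<close>

definition spec_decomp :: "real^'n^'n \<Rightarrow> real^'n \<Rightarrow> complex \<Rightarrow> complex^'n" where
  "spec_decomp A x = (THE c. finite {\<mu>. c \<mu> \<noteq> 0} \<and>
     (\<forall>\<mu>. c \<mu> \<noteq> 0 \<longrightarrow> gen_eigvec A \<mu> (c \<mu>)) \<and> (\<Sum>\<mu> | c \<mu> \<noteq> 0. c \<mu>) = cvec x)"

definition local_radius :: "real^'n^'n \<Rightarrow> real^'n \<Rightarrow> real" where
  "local_radius A x = Max {cmod \<mu> | \<mu>. spec_decomp A x \<mu> \<noteq> 0}"

definition local_order :: "real^'n^'n \<Rightarrow> real^'n \<Rightarrow> nat" where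
  "local_order A x = Max {eigvec_order A \<mu> (spec_decomp A x \<mu>) | \<mu>.
     spec_decomp A x \<mu> \<noteq> 0 \<and> cmod \<mu> = local_radius A x}"

definition spec_pair :: "real^'n^'n \<Rightarrow> real^'n \<Rightarrow> real \<times> nat" where
  "spec_pair A x = (if x = 0 then (0, 0) else (local_radius A x, local_order A x))"

definition face_spec_pair :: "real^'n^'n \<Rightarrow> (real^'n) set \<Rightarrow> real \<times> nat" where
  "face_spec_pair A F = (THE s. \<forall>x\<in>rel_interior F. spec_pair A x = s)"

definition pair_le :: "real \<times> nat \<Rightarrow> real \<times> nat \<Rightarrow> bool" where
  "pair_le \<xi> \<eta> \<longleftrightarrow> fst \<xi> < fst \<eta> \<or> fst \<xi> = fst \<eta> \<and> snd \<xi> \<le> snd \<eta>"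

definition pair_less :: "real \<times> nat \<Rightarrow> real \<times> nat \<Rightarrow> bool" where
  "pair_less \<xi> \<eta> \<longleftrightarrow> pair_le \<xi> \<eta> \<and> \<xi> \<noteq> \<eta>"

section \<open>Restriction to an invariant subspace\<close>

definition ordered_basis :: "(real^'n) list \<Rightarrow> (real^'n) set \<Rightarrow> bool" where
  "ordered_basis bs V \<longleftrightarrow> distinct bs \<and> independent (set bs) \<and> span (set bs) = V"

text \<open>The matrix, in some basis, of the restriction of \<open>A\<close> to an \<open>A\<close>-invariant subspace \<open>V\<close>.
  The spectral radius and the Jordan blocks do not depend on the basis chosen.\<close>

definition restr_mat :: "real^'n^'n \<Rightarrow> (real^'n) set \<Rightarrow> complex mat" where
  "restr_mat A V = (let bs = (SOME bs. ordered_basis bs V) in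
     Matrix.mat (length bs) (length bs)
       (\<lambda>(i, j). complex_of_real (representation (set bs) (A *v (bs ! j)) (bs ! i))))"

definition restr_radius :: "real^'n^'n \<Rightarrow> (real^'n) set \<Rightarrow> real" where
  "restr_radius A V = spectral_radius (restr_mat A V)"

text \<open>\<^const>\<open>jordan_nf\<close> lists the Jordan blocks as pairs of size and eigenvalue.
  If \<open>\<mu>\<close> is not an eigenvalue of the restriction, the value is the unspecified \<open>Max {}\<close>.\<close>

definition restr_index :: "real^'n^'n \<Rightarrow> (real^'n) set \<Rightarrow> complex \<Rightarrow> nat" where
  "restr_index A V \<mu> = Max {k. \<exists>n_as. jordan_nf (restr_mat A V) n_as \<and> (k, \<mu>) \<in> set n_as}"

section \<open>Cone-preserving matrices and invariant faces\<close>

definition cone_preserving :: "(real^'n) set \<Rightarrow> (real^'n^'n) set" where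
  "cone_preserving K = {A. (\<lambda>x. A *v x) ` K \<subseteq> K}"

text \<open>An eigenvalue with an eigenvector in \<open>K\<close> is real.\<close>

definition distinguished_eigenvalue :: "real^'n^'n \<Rightarrow> (real^'n) set \<Rightarrow> real \<Rightarrow> bool" where
  "distinguished_eigenvalue A K \<mu> \<longleftrightarrow> (\<exists>x\<in>K. x \<noteq> 0 \<and> A *v x = \<mu> *\<^sub>R x)"

definition invariant_face :: "real^'n^'n \<Rightarrow> (real^'n) set \<Rightarrow> (real^'n) set \<Rightarrow> bool" where
  "invariant_face A K F \<longleftrightarrow> cone_face F K \<and> (\<lambda>x. A *v x) ` F \<subseteq> F"

definition associated_face ::
  "real^'n^'n \<Rightarrow> (real^'n) set \<Rightarrow> real \<Rightarrow> (real^'n) set \<Rightarrow> bool" where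
  "associated_face A K \<mu> F \<longleftrightarrow>
     invariant_face A K F \<and> F \<noteq> {0} \<and> restr_radius A (span F) = \<mu>"

definition join_irreducible_face :: "real^'n^'n \<Rightarrow> (real^'n) set \<Rightarrow> (real^'n) set \<Rightarrow> bool" where
  "join_irreducible_face A K F \<longleftrightarrow> invariant_face A K F \<and>
     \<not> (\<exists>G H. invariant_face A K G \<and> G \<subset> F \<and> invariant_face A K H \<and> H \<subset> F \<and>
            F = face_join K G H)"

definition semi_distinguished :: "real^'n^'n \<Rightarrow> (real^'n) set \<Rightarrow> (real^'n) set \<Rightarrow> bool" where
  "semi_distinguished A K F \<longleftrightarrow>
     join_irreducible_face A K F \<and> (\<exists>x\<in>rel_interior F. \<exists>\<mu>. gen_eigvec A \<mu> (cvec x))"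

definition dominates_subfaces :: "real^'n^'n \<Rightarrow> (real^'n) set \<Rightarrow> (real^'n) set \<Rightarrow> bool" where
  "dominates_subfaces A K F \<longleftrightarrow> (\<forall>G. invariant_face A K G \<and> G \<subset> F \<longrightarrow>
     pair_less (face_spec_pair A G) (face_spec_pair A F))"

section \<open>Conditions on a distinguished eigenvalue\<close>

definition has_semi_distinguished_subface ::
  "real^'n^'n \<Rightarrow> (real^'n) set \<Rightarrow> (real^'n) set \<Rightarrow> bool" where
  "has_semi_distinguished_subface A K F \<longleftrightarrow>
     (\<exists>G\<subseteq>F. semi_distinguished A K G \<and> face_spec_pair A G = face_spec_pair A F)"

definition cond_subface :: "real^'n^'n \<Rightarrow> (real^'n) set \<Rightarrow> real \<Rightarrow> bool" where
  "cond_subface A K \<mu> \<longleftrightarrow>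
     (\<forall>F. associated_face A K \<mu> F \<longrightarrow> has_semi_distinguished_subface A K F)"

definition cond_index :: "real^'n^'n \<Rightarrow> (real^'n) set \<Rightarrow> real \<Rightarrow> bool" where
  "cond_index A K \<mu> \<longleftrightarrow> (\<forall>F. associated_face A K \<mu> F \<longrightarrow>
     (\<exists>x\<in>F. gen_eigvec A (complex_of_real \<mu>) (cvec x) \<and>
        eigvec_order A (complex_of_real \<mu>) (cvec x)
          = restr_index A (span F) (complex_of_real \<mu>)))"

definition cond_dominating :: "real^'n^'n \<Rightarrow> (real^'n) set \<Rightarrow> real \<Rightarrow> bool" where
  "cond_dominating A K \<mu> \<longleftrightarrow> (\<forall>F. associated_face A K \<mu> F \<longrightarrow>
     dominates_subfaces A K F \<longrightarrow> semi_distinguished A K F)"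

definition cond_relint :: "real^'n^'n \<Rightarrow> (real^'n) set \<Rightarrow> real \<Rightarrow> bool" where
  "cond_relint A K \<mu> \<longleftrightarrow> (\<forall>F. invariant_face A K F \<and>
     (\<exists>x\<in>rel_interior F. gen_eigvec A (complex_of_real \<mu>) (cvec x)) \<longrightarrow>
     has_semi_distinguished_subface A K F)"

end

(*
  Let F* be the dual of F in its span. F* is facially exposed iff, for v, z in F*, z vanishing on
  F \<inter> v^\<bottom> forces v - \<epsilon> z \<in> F* for some \<epsilon> > 0. For part (i) compare A on F with its adjoint B on F*.
  Suppose sp(G) < sp(F) = (\<lambda>, m) for all proper invariant G. If no generalized eigenvector lies in
  relint F, separation gives a nonzero w \<in> F* without \<lambda>-component; the face H of the vectors of F*
  of local radius < \<lambda> is exposed by h \<in> relint H, and G = F \<inter> h^\<bottom> is a proper invariant face. As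
  sp(G) < (\<lambda>, m), a \<lambda>-eigenvector v = (B - \<lambda>)^(m-1) w_\<lambda> vanishes on G, so v \<in> H, which is absurd.
  Conversely, for a join-irreducible F with largest proper invariant face M, every \<lambda>-eigenvector
  of B in F* is a multiple of one eigenvector z vanishing on M; if sp(M) = sp(F) there would be one
  that does not vanish on M. The spectral input is local Perron-Frobenius theory, read off the
  poles of the nonnegative power series \<langle>z, (s - A)^(-1) x\<rangle> = \<Sum> s^(-k-1) \<langle>z, A^k x\<rangle>.
*)
theory Submission
  imports Defs "Jordan_Normal_Form.Jordan_Normal_Form_Uniqueness"
begin

no_notation Matrix.vec_index (infixl \<open>$\<close> 100)
no_notation Matrix.scalar_prod (infix \<open>\<bullet>\<close> 70)
hide_const (open) VectorSpace.subspace Matrix.orthogonal module.smult Coset.order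

section \<open>Faces, duality and exposedness\<close>

text \<open>Proper faces have empty interior in the ambient space, so everything is done for a
  \<open>pointed_cone\<close> with the dual taken in its span; the transpose of \<open>A\<close>
  need not preserve that span, whence a projected adjoint. Spectral pairs are defined by complex
  components, whereas the cone sees only real data. The bridge is the minimal polynomial
  \<open>cmin\<close> of \<open>A\<close> at a vector: its roots of largest modulus and their
  multiplicities give the pair. The bound |f(s)| <= f(|s|) for nonnegative series forces the largest
  multiplicity on that circle to be attained at its real point r >= 0, and the leading coefficient
  of the resolvent at this pole lies in the cone. That coefficient is \<open>peak A r m x\<close>, a
  fixed polynomial in \<open>A\<close> applied to \<open>x\<close>, hence additive in
  \<open>x\<close>; in a pointed cone peaks cannot cancel, which gives the order properties of
  spectral pairs of sums and faces. Conditions (1) to (4) are each proved outright: (3) is one half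
  of the first claim, the others come from an invariant subface of least dimension with the same
  pair. For (2), the spectral radius and the index of the restriction to the span of F are shown to
  form the pair of F.\<close>

definition pointed_cone :: "'a::euclidean_space set \<Rightarrow> bool" where
  "pointed_cone F \<longleftrightarrow> convex_cone F \<and> closed F \<and> (\<forall>x\<in>F. -x \<in> F \<longrightarrow> x = 0)"

lemma proper_cone_imp_pointed: "proper_cone K \<Longrightarrow> pointed_cone K"
  unfolding proper_cone_def pointed_cone_def by (metis IntI imageI minus_minus singletonD)

lemma pointed_coneD:
  assumes "pointed_cone F"
  shows "convex_cone F" "closed F" "\<And>x. x \<in> F \<Longrightarrow> -x \<in> F \<Longrightarrow> x = 0" "convex F" "0 \<in> F" "F \<noteq> {}"
    "\<And>x y. x \<in> F \<Longrightarrow> y \<in> F \<Longrightarrow> x + y \<in> F" "\<And>c x. 0 \<le> c \<Longrightarrow> x \<in> F \<Longrightarrow> c *\<^sub>R x \<in> F"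
  using assms by (auto simp: pointed_cone_def convex_cone_def
      intro: convex_cone_contains_0 convex_cone_add convex_cone_scaleR)

lemma convex_cone_imp_convex: "convex_cone F \<Longrightarrow> convex F"
  by (simp add: convex_cone_def)

lemma convex_cone_diff_scale_mono:
  assumes "convex_cone F" "x \<in> F" "x - e *\<^sub>R y \<in> F" "0 \<le> d" "d \<le> e" "y \<in> F"
  shows "x - d *\<^sub>R y \<in> F"
proof -
  have "x - d *\<^sub>R y = (x - e *\<^sub>R y) + (e - d) *\<^sub>R y" by (simp add: algebra_simps)
  then show ?thesis using assms by (metis convex_cone_add convex_cone_scaleR diff_ge_0_iff_ge)
qed

text \<open>Extending the segment from \<open>y\<close> through \<open>x\<close> by a factor
  \<open>e\<close> and then dividing by \<open>e\<close> amounts to subtracting the multiple (e -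
  1)/e of \<open>y\<close> from \<open>x\<close>. This order form of the relative interior matches
  the face condition, so faces can be compared through differences alone.\<close>

lemma rel_interior_cone_iff:
  fixes F :: "'a::euclidean_space set"
  assumes F: "convex_cone F"
  shows "x \<in> rel_interior F \<longleftrightarrow> x \<in> F \<and> (\<forall>y\<in>F. \<exists>e>0. x - e *\<^sub>R y \<in> F)"
proof
  assume x: "x \<in> rel_interior F"
  then have xF: "x \<in> F" using rel_interior_subset by blast
  have "\<exists>e>0. x - e *\<^sub>R y \<in> F" if "y \<in> F" for y
  proof -
    obtain e where e: "e > 1" "(1 - e) *\<^sub>R y + e *\<^sub>R x \<in> F"
      using x convex_rel_interior_iff[of F x] convex_cone_imp_convex[OF F] convex_cone_nonempty[OF F] \<open>y \<in> F\<close>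
      by blast
    have "(1/e) *\<^sub>R ((1 - e) *\<^sub>R y + e *\<^sub>R x) \<in> F"
      using e F by (intro convex_cone_scaleR) auto
    also have "(1/e) *\<^sub>R ((1 - e) *\<^sub>R y + e *\<^sub>R x) = x - ((e-1)/e) *\<^sub>R y"
      using e by (simp add: algebra_simps scaleR_add_right diff_divide_distrib)
    finally show ?thesis using e by (intro exI[of _ "(e-1)/e"]) auto
  qed
  then show "x \<in> F \<and> (\<forall>y\<in>F. \<exists>e>0. x - e *\<^sub>R y \<in> F)" using xF by (intro conjI ballI)
next
  assume R: "x \<in> F \<and> (\<forall>y\<in>F. \<exists>e>0. x - e *\<^sub>R y \<in> F)"
  have "\<exists>e>1. (1 - e) *\<^sub>R y + e *\<^sub>R x \<in> F" if y: "y \<in> F" for y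
  proof -
    obtain e where e: "e > 0" "x - e *\<^sub>R y \<in> F" using R y by blast
    have "(x - e *\<^sub>R y) + e *\<^sub>R x \<in> F" using e R F by (intro convex_cone_add convex_cone_scaleR) auto
    also have "(x - e *\<^sub>R y) + e *\<^sub>R x = (1 - (1+e)) *\<^sub>R y + (1+e) *\<^sub>R x" by (simp add: algebra_simps)
    finally show ?thesis using e by (intro exI[of _ "1+e"]) auto
  qed
  then show "x \<in> rel_interior F"
    using convex_rel_interior_iff[of F x] convex_cone_imp_convex[OF F] convex_cone_nonempty[OF F] by blast
qed

lemma span_convex_cone:
  fixes F :: "'a::euclidean_space set"
  assumes F: "convex_cone F" and u: "u \<in> span F"
  obtains a b where "a \<in> F" "b \<in> F" "u = a - b"
proof -
  have "subspace {a - b | a b. a \<in> F \<and> b \<in> F}" (is "subspace ?S")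
  proof (rule subspaceI)
    show "0 \<in> ?S" using convex_cone_contains_0[OF F] by force
    fix x y assume "x \<in> ?S" "y \<in> ?S"
    then obtain a b c d where "a\<in>F" "b\<in>F" "c\<in>F" "d\<in>F" "x = a - b" "y = c - d" by blast
    then show "x + y \<in> ?S" using convex_cone_add[OF F]
      by (intro CollectI exI[of _ "a+c"] exI[of _ "b+d"]) auto
  next
    fix c :: real and x assume "x \<in> ?S"
    then obtain a b where ab: "a\<in>F" "b\<in>F" "x = a - b" by blast
    show "c *\<^sub>R x \<in> ?S"
    proof (cases "c \<ge> 0")
      case True then show ?thesis using ab convex_cone_scaleR[OF F]
        by (intro CollectI exI[of _ "c *\<^sub>R a"] exI[of _ "c *\<^sub>R b"]) (auto simp: algebra_simps)
    next
      case False
      then have "(-c) *\<^sub>R b \<in> F" "(-c) *\<^sub>R a \<in> F" using ab convex_cone_scaleR[OF F, of "-c"] by simp_all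
      moreover have "c *\<^sub>R x = (-c) *\<^sub>R b - (-c) *\<^sub>R a" unfolding ab(3) by (simp add: algebra_simps)
      ultimately show ?thesis by blast
    qed
  qed
  moreover have "F \<subseteq> ?S" using convex_cone_contains_0[OF F] by force
  ultimately have "span F \<subseteq> ?S" by (rule span_minimal[rotated])
  then show ?thesis using u that by blast
qed

lemma cone_faceD:
  assumes "cone_face F K"
  shows "convex_cone F" "F \<subseteq> K" "\<And>x y. x \<in> K \<Longrightarrow> y \<in> K \<Longrightarrow> x + y \<in> F \<Longrightarrow> x \<in> F"
    "\<And>x y. x \<in> K \<Longrightarrow> y \<in> K \<Longrightarrow> x + y \<in> F \<Longrightarrow> y \<in> F" "0 \<in> F" "convex F" "F \<noteq> {}"
  using assms unfolding cone_face_def by (auto simp: convex_cone_contains_0 convex_cone_imp_convex convex_cone_nonempty)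

lemma cone_face_diffD:
  assumes "cone_face F K" "convex_cone K" "x \<in> F" "0 < e" "x - e *\<^sub>R y \<in> K" "y \<in> K"
  shows "y \<in> F"
proof -
  have "e *\<^sub>R y \<in> K" using assms by (auto intro: convex_cone_scaleR)
  then have "e *\<^sub>R y \<in> F" using cone_faceD(4)[OF assms(1), of "x - e *\<^sub>R y" "e *\<^sub>R y"] assms by simp
  then have "(1/e) *\<^sub>R (e *\<^sub>R y) \<in> F"
    using convex_cone_scaleR[OF cone_faceD(1)[OF assms(1)], of "1/e" "e *\<^sub>R y"] assms(4) by simp
  then show ?thesis using assms(4) by simp
qed

text \<open>If x = a - b lies in \<open>K\<close> with a, b in \<open>F\<close>, then x + b = a lies
  in \<open>F\<close>, so \<open>x\<close> does. Hence faces inherit closedness and are determined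
  by their spans, which permits arguments by dimension.\<close>

lemma cone_face_eq_Int_span:
  assumes "cone_face F K"
  shows "F = K \<inter> span F"
proof
  show "F \<subseteq> K \<inter> span F" using cone_faceD(2)[OF assms] span_superset by blast
  show "K \<inter> span F \<subseteq> F"
  proof
    fix x assume x: "x \<in> K \<inter> span F"
    then obtain a b where "a\<in>F" "b\<in>F" "x = a - b" using span_convex_cone[OF cone_faceD(1)[OF assms]] by blast
    then show "x \<in> F" using cone_faceD(3)[OF assms, of x b] cone_faceD(2)[OF assms] x by auto
  qed
qed

lemma pointed_cone_face:
  assumes "pointed_cone K" "cone_face F K"
  shows "pointed_cone F"
proof -
  have "closed (K \<inter> span F)"
    using pointed_coneD(2)[OF assms(1)] closed_subspace[OF subspace_span, of F] by blast
  then have "closed F" using cone_face_eq_Int_span[OF assms(2)] by simp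
  then show ?thesis unfolding pointed_cone_def
    using cone_faceD(1,2)[OF assms(2)] pointed_coneD(3)[OF assms(1)] by blast
qed

lemma cone_face_refl: "convex_cone K \<Longrightarrow> cone_face K K"
  by (auto simp: cone_face_def)

lemma cone_face_trans: "cone_face F K \<Longrightarrow> cone_face G F \<Longrightarrow> cone_face G K"
  unfolding cone_face_def by (meson subset_eq)

lemma cone_face_subset: "cone_face G K \<Longrightarrow> cone_face F K \<Longrightarrow> G \<subseteq> F \<Longrightarrow> cone_face G F"
  unfolding cone_face_def by (meson subset_eq)

lemma cone_face_rel_interior_subset:
  assumes "cone_face F K" "convex_cone K" "cone_face G K" "x \<in> rel_interior F" "x \<in> G"
  shows "F \<subseteq> G"
proof
  fix y assume "y \<in> F"
  then obtain e where "e > 0" "x - e *\<^sub>R y \<in> F"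
    using assms(4) rel_interior_cone_iff[OF cone_faceD(1)[OF assms(1)]] by blast
  then show "y \<in> G" using cone_face_diffD[OF assms(3,2,5)] cone_faceD(2)[OF assms(1)] \<open>y \<in> F\<close> by blast
qed

lemma cone_face_dim_eq:
  assumes "cone_face F K" "cone_face G K" "F \<subseteq> G" "dim G \<le> dim F"
  shows "F = G"
proof -
  have "span F = span G" using assms(3,4) by (metis dim_eq_span)
  then show ?thesis using cone_face_eq_Int_span assms(1,2) by metis
qed

lemma rel_interior_face_nonempty: "cone_face F K \<Longrightarrow> rel_interior F \<noteq> {}"
  using cone_faceD(6,7) rel_interior_eq_empty by blast

lemma cone_face_Int_orthogonal:
  assumes "convex_cone K" "\<And>x. x \<in> K \<Longrightarrow> 0 \<le> z \<bullet> x"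
  shows "cone_face {x \<in> K. z \<bullet> x = 0} K"
proof -
  have "convex_cone {x \<in> K. z \<bullet> x = 0}"
    using assms(1) unfolding convex_cone_iff by (auto simp: inner_add_right)
  moreover have "z \<bullet> x = 0 \<and> z \<bullet> y = 0" if "x \<in> K" "y \<in> K" "z \<bullet> (x + y) = 0" for x y
    using assms(2)[of x] assms(2)[of y] that by (simp add: inner_add_right)
  ultimately show ?thesis unfolding cone_face_def by auto
qed

text \<open>The vectors dominated by a multiple of \<open>x\<close>: for \<open>x\<close> in a
  convex cone \<open>K\<close> this is the smallest face containing \<open>x\<close>, in a form that
  avoids the intersection in \<open>face_gen\<close>.\<close>

definition point_face :: "'a::euclidean_space set \<Rightarrow> 'a \<Rightarrow> 'a set" where
  "point_face K x = {y \<in> K. \<exists>e>0. x - e *\<^sub>R y \<in> K}"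

lemma point_face:
  assumes K: "convex_cone K" and x: "x \<in> K"
  shows "cone_face (point_face K x) K" "x \<in> point_face K x"
proof -
  show "x \<in> point_face K x" unfolding point_face_def using x convex_cone_contains_0[OF K]
    by (auto intro!: exI[of _ 1])
  have add: "y + z \<in> point_face K x" if y: "y \<in> point_face K x" and z: "z \<in> point_face K x" for y z
  proof -
    obtain d where d: "d > 0" "x - d *\<^sub>R y \<in> K" "y \<in> K" using y by (auto simp: point_face_def)
    obtain e where e: "e > 0" "x - e *\<^sub>R z \<in> K" "z \<in> K" using z by (auto simp: point_face_def)
    note de = d e
    let ?m = "min d e"
    have "x - ?m *\<^sub>R y \<in> K" "x - ?m *\<^sub>R z \<in> K"
      using convex_cone_diff_scale_mono[OF K x d(2) _ _ d(3), of ?m]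
        convex_cone_diff_scale_mono[OF K x e(2) _ _ e(3), of ?m] d(1) e(1) by simp_all
    then have "(1/2) *\<^sub>R ((x - ?m *\<^sub>R y) + (x - ?m *\<^sub>R z)) \<in> K" using K
      by (intro convex_cone_scaleR convex_cone_add) auto
    also have "(1/2) *\<^sub>R ((x - ?m *\<^sub>R y) + (x - ?m *\<^sub>R z)) = x - (?m/2) *\<^sub>R (y + z)"
      by (simp add: algebra_simps flip: scaleR_add_left)
    finally show ?thesis unfolding point_face_def mem_Collect_eq
      using d(1) e(1) convex_cone_add[OF K d(3) e(3)] by (intro conjI exI[of _ "?m/2"]) auto
  qed
  have scale: "c *\<^sub>R y \<in> point_face K x" if c: "c \<ge> 0" and y: "y \<in> point_face K x" for c y
  proof -
    obtain d where d: "d > 0" "x - d *\<^sub>R y \<in> K" "y \<in> K" using y by (auto simp: point_face_def)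
    show ?thesis
    proof (cases "c = 0")
      case True then show ?thesis using x convex_cone_contains_0[OF K] by (auto simp: point_face_def intro: exI[of _ 1])
    next
      case False then show ?thesis using d c convex_cone_scaleR[OF K c d(3)]
        unfolding point_face_def mem_Collect_eq by (intro conjI exI[of _ "d/c"]) auto
    qed
  qed
  have z: "0 \<in> point_face K x" using x convex_cone_contains_0[OF K] by (auto simp: point_face_def intro: exI[of _ 1])
  have f: "y \<in> point_face K x" if yz: "y \<in> K" "z \<in> K" "y + z \<in> point_face K x" for y z
  proof -
    obtain d where d: "d > 0" "x - d *\<^sub>R (y + z) \<in> K" using yz by (auto simp: point_face_def)
    have "(x - d *\<^sub>R (y + z)) + d *\<^sub>R z \<in> K" using d yz K by (intro convex_cone_add convex_cone_scaleR) auto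
    also have "(x - d *\<^sub>R (y + z)) + d *\<^sub>R z = x - d *\<^sub>R y" by (simp add: algebra_simps)
    finally show ?thesis using d yz by (auto simp: point_face_def)
  qed
  show "cone_face (point_face K x) K"
    unfolding cone_face_def convex_cone_iff using add scale z f
    by (metis (no_types, lifting) add.commute mem_Collect_eq point_face_def subsetI)
qed

lemma rel_interior_pointed_cone_nonzero:
  assumes F: "pointed_cone F" "F \<noteq> {0}" and x: "x \<in> rel_interior F"
  shows "x \<noteq> 0"
proof
  assume 0: "x = 0"
  obtain f where f: "f \<in> F" "f \<noteq> 0" using F(2) pointed_coneD(5)[OF F(1)] by blast
  obtain e where e: "e > 0" "x - e *\<^sub>R f \<in> F" using x rel_interior_cone_iff[OF pointed_coneD(1)[OF F(1)]] f(1) by blast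
  have "e *\<^sub>R f \<in> F" using e(1) f(1) pointed_coneD(8)[OF F(1)] by simp
  moreover have "- (e *\<^sub>R f) \<in> F" using e(2) 0 by simp
  ultimately have "e *\<^sub>R f = 0" by (rule pointed_coneD(3)[OF F(1)])
  then show False using e(1) f(2) by simp
qed

lemma orthogonal_decomp_span:
  fixes z :: "'a::euclidean_space"
  obtains p where "p \<in> span S" "\<And>x. x \<in> span S \<Longrightarrow> p \<bullet> x = z \<bullet> x"
proof -
  obtain p q where "p \<in> span S" "\<And>w. w \<in> span S \<Longrightarrow> orthogonal q w" "z = p + q"
    using orthogonal_subspace_decomp_exists[of S z] by blast
  then show ?thesis using that[of p] by (simp add: inner_add_left Linear_Algebra.orthogonal_def)
qed

text \<open>Separation produces functionals on the whole space; projecting onto the span keeps their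
  values on the cone and lands in the dual, which is taken inside the span.\<close>

lemma dual_cone_project:
  assumes "\<And>x. x \<in> F \<Longrightarrow> 0 \<le> z \<bullet> x"
  obtains p where "p \<in> dual_cone F" "\<And>x. x \<in> span F \<Longrightarrow> p \<bullet> x = z \<bullet> x"
proof -
  obtain p where p: "p \<in> span F" "\<And>x. x \<in> span F \<Longrightarrow> p \<bullet> x = z \<bullet> x"
    using orthogonal_decomp_span by blast
  then show ?thesis using assms that[of p] by (auto simp: dual_cone_def span_base)
qed

text \<open>The separating level \<open>b\<close> is negative because 0 lies in \<open>F\<close>. A
  member with negative value could be scaled until its value is exactly \<open>b\<close>, which
  strict separation excludes.\<close>

lemma separate_closed_cone:
  fixes F :: "'a::euclidean_space set"
  assumes "convex_cone F" "closed F" "x \<notin> F"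
  obtains z where "\<And>y. y \<in> F \<Longrightarrow> 0 \<le> z \<bullet> y" "z \<bullet> x < 0"
proof -
  obtain a b where ab: "a \<bullet> x < b" "\<And>y. y \<in> F \<Longrightarrow> b < a \<bullet> y"
    using separating_hyperplane_closed_point[of F x] assms convex_cone_imp_convex by blast
  have b0: "b < 0" using ab(2)[OF convex_cone_contains_0[OF assms(1)]] by simp
  have "0 \<le> a \<bullet> y" if "y \<in> F" for y
  proof (rule ccontr)
    assume n: "\<not> 0 \<le> a \<bullet> y"
    then have "(b / (a \<bullet> y)) *\<^sub>R y \<in> F" using that b0 assms(1) by (intro convex_cone_scaleR) (auto simp: divide_nonpos_neg)
    from ab(2)[OF this] show False using n by simp
  qed
  then show ?thesis using that[of a] ab b0 by auto
qed

lemma positive_functional_coercive: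
  fixes F :: "'a::euclidean_space set"
  assumes F: "convex_cone F" "closed F" and v: "\<And>x. x \<in> F \<Longrightarrow> x \<noteq> 0 \<Longrightarrow> 0 < v \<bullet> x"
  obtains c where "c > 0" "\<And>x. x \<in> F \<Longrightarrow> c * norm x \<le> v \<bullet> x"
proof -
  have unit: "(1 / norm x) *\<^sub>R x \<in> F \<inter> sphere 0 1" if "x \<in> F" "x \<noteq> 0" for x
    using that convex_cone_scaleR[OF F(1), of "1 / norm x" x] by simp
  show ?thesis
  proof (cases "F \<inter> sphere 0 1 = {}")
    case True
    then have "\<And>x. x \<in> F \<Longrightarrow> x = 0" using unit by blast
    then have "1 * norm x \<le> v \<bullet> x" if "x \<in> F" for x using that by fastforce
    then show ?thesis using that[of 1] by simp
  next
    case False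
    have "compact (F \<inter> sphere 0 1)" using F(2) by (auto simp: closed_Int_compact)
    moreover have "continuous_on (F \<inter> sphere 0 1) (\<lambda>x. v \<bullet> x)" by (intro continuous_intros)
    ultimately obtain x0 where x0: "x0 \<in> F \<inter> sphere 0 1" "\<And>y. y \<in> F \<inter> sphere 0 1 \<Longrightarrow> v \<bullet> x0 \<le> v \<bullet> y"
      using False continuous_attains_inf[of "F \<inter> sphere 0 1" "\<lambda>x. v \<bullet> x"] by blast
    have "x0 \<noteq> 0" using x0(1) by auto
    then have pos: "0 < v \<bullet> x0" using v x0(1) by blast
    have "(v \<bullet> x0) * norm x \<le> v \<bullet> x" if x: "x \<in> F" for x
    proof (cases "x = 0")
      case False
      from x0(2)[OF unit[OF x False]] show ?thesis using False by (simp add: field_simps)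
    qed simp
    then show ?thesis using that pos by blast
  qed
qed

text \<open>On \<open>F\<close> the functional \<open>v\<close> grows at least like a multiple of
  the norm, by compactness of the unit sphere, and this absorbs a small multiple of an arbitrary
  \<open>z\<close>. So strict positivity on \<open>F\<close> makes \<open>v\<close> an interior
  point of the cone of nonnegative functionals.\<close>

lemma interior_dual:
  fixes F :: "'a::euclidean_space set"
  assumes F: "convex_cone F" "closed F" and v: "\<And>x. x \<in> F \<Longrightarrow> x \<noteq> 0 \<Longrightarrow> 0 < v \<bullet> x"
  obtains e where "e > 0" "\<And>x. x \<in> F \<Longrightarrow> 0 \<le> (v - e *\<^sub>R z) \<bullet> x"
proof -
  obtain c where c: "c > 0" "\<And>x. x \<in> F \<Longrightarrow> c * norm x \<le> v \<bullet> x"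
    using positive_functional_coercive[OF F v] by metis
  define e where "e = c / (norm z + 1)"
  have nz: "norm z + 1 > 0" using norm_ge_zero[of z] by linarith
  then have e: "e > 0" using c(1) by (simp add: e_def)
  have "e * norm z \<le> e * (norm z + 1)" using e by (intro mult_left_mono) auto
  also have "\<dots> = c" using nz by (simp add: e_def)
  finally have ez: "e * norm z \<le> c" .
  have "0 \<le> (v - e *\<^sub>R z) \<bullet> x" if x: "x \<in> F" for x
  proof -
    have "e * (z \<bullet> x) \<le> e * (norm z * norm x)" using e norm_cauchy_schwarz[of z x] by (intro mult_left_mono) auto
    also have "\<dots> \<le> c * norm x" using mult_right_mono[OF ez norm_ge_zero[of x]] by (simp add: mult.assoc)
    also have "\<dots> \<le> v \<bullet> x" by (rule c(2)[OF x])
    finally show ?thesis by (simp add: inner_diff_left)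
  qed
  then show ?thesis using that e by blast
qed

lemma dual_cone_convex_cone: "convex_cone (dual_cone F)"
  unfolding convex_cone_iff dual_cone_def
  by (auto simp: span_add span_scale span_zero inner_add_left)

lemma dual_cone_eq: "dual_cone F = span F \<inter> (\<Inter>x\<in>F. {z. 0 \<le> x \<bullet> z})"
  by (auto simp: dual_cone_def inner_commute)

lemma dual_cone_closed: "closed (dual_cone F)"
  unfolding dual_cone_eq by (intro closed_Int closed_INT ballI closed_halfspace_ge closed_subspace subspace_span)

lemma dual_cone_pointed: "pointed_cone (dual_cone F)"
proof -
  have "z = 0" if "z \<in> dual_cone F" "-z \<in> dual_cone F" for z
  proof -
    have "\<And>x. x \<in> F \<Longrightarrow> z \<bullet> x = 0" using that by (force simp: dual_cone_def)
    moreover have "subspace {x. z \<bullet> x = 0}" by (rule subspace_hyperplane)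
    ultimately have "\<And>x. x \<in> span F \<Longrightarrow> z \<bullet> x = 0"
      using span_minimal[of F "{x. z \<bullet> x = 0}"] by blast
    moreover have "z \<in> span F" using that by (auto simp: dual_cone_def)
    ultimately show "z = 0" by (metis inner_eq_zero_iff)
  qed
  then show ?thesis unfolding pointed_cone_def using dual_cone_convex_cone dual_cone_closed by blast
qed

text \<open>Any \<open>z\<close> in the relative interior of the dual works: separating -x from
  \<open>F\<close> gives a dual vector \<open>p\<close> positive at \<open>x\<close>, and if
  \<open>z\<close> vanished at \<open>x\<close>, subtracting a little of \<open>p\<close> from
  \<open>z\<close> would leave the dual.\<close>

lemma dual_cone_strictly_positive:
  fixes F :: "'a::euclidean_space set"
  assumes "pointed_cone F"
  obtains z where "z \<in> dual_cone F" "\<And>x. x \<in> F \<Longrightarrow> x \<noteq> 0 \<Longrightarrow> 0 < z \<bullet> x"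
proof -
  have "rel_interior (dual_cone F) \<noteq> {}"
    using dual_cone_convex_cone[of F] by (simp add: rel_interior_eq_empty convex_cone_def)
  then obtain z where z: "z \<in> rel_interior (dual_cone F)" by blast
  have zD: "z \<in> dual_cone F" using z rel_interior_subset by blast
  have "0 < z \<bullet> x" if x: "x \<in> F" "x \<noteq> 0" for x
  proof -
    have "-x \<notin> F" using x pointed_coneD(3)[OF assms] by blast
    then obtain w where w: "\<And>y. y \<in> F \<Longrightarrow> 0 \<le> w \<bullet> y" "w \<bullet> (-x) < 0"
      using separate_closed_cone pointed_coneD(1,2)[OF assms] by blast
    obtain p where p: "p \<in> dual_cone F" "\<And>x. x \<in> span F \<Longrightarrow> p \<bullet> x = w \<bullet> x"
      using dual_cone_project[OF w(1)] by blast
    obtain e where e: "e > 0" "z - e *\<^sub>R p \<in> dual_cone F"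
      using z p rel_interior_cone_iff[OF dual_cone_convex_cone] by blast
    have "p \<bullet> x > 0" using p(2)[of x] x w(2) by (simp add: span_base)
    then have "e * (p \<bullet> x) > 0" using e by simp
    moreover have "0 \<le> (z - e *\<^sub>R p) \<bullet> x" using e(2) x by (auto simp: dual_cone_def)
    ultimately show ?thesis by (simp add: inner_diff_left)
  qed
  then show ?thesis using that zD by blast
qed

text \<open>A strictly positive \<open>z\<close> stays in the dual after a small multiple of any
  \<open>u\<close> in the span is subtracted, so \<open>u\<close> is a combination of two dual
  vectors. This keeps the bidual in the same space.\<close>

lemma span_dual_cone:
  fixes F :: "'a::euclidean_space set"
  assumes "pointed_cone F"
  shows "span (dual_cone F) = span F"
proof
  show "span (dual_cone F) \<subseteq> span F" by (intro span_minimal subspace_span) (auto simp: dual_cone_def)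
  show "span F \<subseteq> span (dual_cone F)"
  proof
    fix u assume u: "u \<in> span F"
    obtain z where z: "z \<in> dual_cone F" "\<And>x. x \<in> F \<Longrightarrow> x \<noteq> 0 \<Longrightarrow> 0 < z \<bullet> x"
      using dual_cone_strictly_positive[OF assms] by blast
    obtain e where e: "e > 0" "\<And>x. x \<in> F \<Longrightarrow> 0 \<le> (z - e *\<^sub>R u) \<bullet> x"
      using interior_dual[OF pointed_coneD(1,2)[OF assms] z(2)] by metis
    then have "z - e *\<^sub>R u \<in> dual_cone F" using z u by (auto simp: dual_cone_def intro: span_diff span_scale)
    then have "z - (z - e *\<^sub>R u) \<in> span (dual_cone F)" using z(1) by (intro span_diff span_base)
    then have "e *\<^sub>R u \<in> span (dual_cone F)" by simp
    then have "(1/e) *\<^sub>R (e *\<^sub>R u) \<in> span (dual_cone F)" by (rule span_scale)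
    moreover have "(1/e) *\<^sub>R (e *\<^sub>R u) = u" using e(1) by simp
    ultimately show "u \<in> span (dual_cone F)" by metis
  qed
qed

lemma dual_dual_cone:
  fixes F :: "'a::euclidean_space set"
  assumes "pointed_cone F"
  shows "dual_cone (dual_cone F) = F"
proof
  show "F \<subseteq> dual_cone (dual_cone F)"
    unfolding dual_cone_def[of "dual_cone F"] span_dual_cone[OF assms]
    by (auto simp: span_base dual_cone_def inner_commute)
  show "dual_cone (dual_cone F) \<subseteq> F"
  proof (rule ccontr)
    assume "\<not> ?thesis"
    then obtain x where x: "x \<in> dual_cone (dual_cone F)" "x \<notin> F" by blast
    obtain w where w: "\<And>y. y \<in> F \<Longrightarrow> 0 \<le> w \<bullet> y" "w \<bullet> x < 0"
      using separate_closed_cone pointed_coneD(1,2)[OF assms] x(2) by blast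
    obtain p where p: "p \<in> dual_cone F" "\<And>x. x \<in> span F \<Longrightarrow> p \<bullet> x = w \<bullet> x"
      using dual_cone_project[OF w(1)] by blast
    have "x \<in> span F" using x(1) span_dual_cone[OF assms] by (auto simp: dual_cone_def)
    then show False using p w(2) x(1) by (force simp: dual_cone_def inner_commute)
  qed
qed

lemma mem_cone_if_dual_nonneg:
  assumes "pointed_cone F" "x \<in> span F" "\<And>z. z \<in> dual_cone F \<Longrightarrow> 0 \<le> z \<bullet> x"
  shows "x \<in> F"
proof -
  have "x \<in> dual_cone (dual_cone F)"
    using assms unfolding dual_cone_def[of "dual_cone F"] span_dual_cone[OF assms(1)]
    by (auto simp: inner_commute)
  then show ?thesis using dual_dual_cone[OF assms(1)] by simp
qed

text \<open>A dual vector vanishing at a relative interior point vanishes on \<open>F\<close>, hence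
  on the span of \<open>F\<close>, to which it belongs itself.\<close>

lemma dual_cone_rel_interior_pos:
  assumes "convex_cone F" "z \<in> dual_cone F" "z \<noteq> 0" "x \<in> rel_interior F"
  shows "0 < z \<bullet> x"
proof (rule ccontr)
  assume n: "\<not> 0 < z \<bullet> x"
  have "x \<in> F" using assms(4) rel_interior_subset by blast
  then have zx: "z \<bullet> x = 0" using n assms(2) by (force simp: dual_cone_def)
  have "z \<bullet> y = 0" if y: "y \<in> F" for y
  proof -
    obtain e where e: "e > 0" "x - e *\<^sub>R y \<in> F" using assms(4) rel_interior_cone_iff[OF assms(1)] y by blast
    have "0 \<le> z \<bullet> (x - e *\<^sub>R y)" "0 \<le> z \<bullet> y" using assms(2) e(2) y by (auto simp: dual_cone_def)
    then have "e * (z \<bullet> y) \<le> 0" by (simp add: inner_diff_right zx)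
    then show ?thesis using e(1) \<open>0 \<le> z \<bullet> y\<close> by (simp add: mult_le_0_iff)
  qed
  then have "span F \<subseteq> {y. z \<bullet> y = 0}" by (intro span_minimal subspace_hyperplane) auto
  then show False using assms(2,3) by (auto simp: dual_cone_def)
qed

lemma nonneg_zero_on_rel_interior:
  fixes F :: "'a::euclidean_space set"
  assumes "convex_cone F" "\<And>y. y \<in> F \<Longrightarrow> 0 \<le> z \<bullet> y" "x \<in> rel_interior F" "z \<bullet> x = 0" "y \<in> F"
  shows "z \<bullet> y = 0"
proof -
  obtain e where e: "e > 0" "x - e *\<^sub>R y \<in> F" using assms(3,5) rel_interior_cone_iff[OF assms(1)] by blast
  then have "0 \<le> z \<bullet> (x - e *\<^sub>R y)" "0 \<le> z \<bullet> y" using assms by blast+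
  then have "e * (z \<bullet> y) \<le> 0" by (simp add: inner_diff_right assms(4))
  then show ?thesis using e(1) \<open>0 \<le> z \<bullet> y\<close> by (simp add: mult_le_0_iff)
qed

text \<open>Were every nonzero dual vector positive at a relative interior point \<open>x\<close> of
  \<open>M\<close>, then \<open>interior_dual\<close>, with the roles of cone and dual exchanged,
  would allow subtracting from \<open>x\<close> a small multiple of any \<open>y\<close> in
  \<open>F\<close>; so \<open>M\<close> would contain \<open>F\<close>.\<close>

lemma proper_face_supporting:
  fixes F :: "'a::euclidean_space set"
  assumes F: "pointed_cone F" and M: "cone_face M F" "M \<noteq> F"
  obtains z where "z \<in> dual_cone F" "z \<noteq> 0" "\<And>y. y \<in> M \<Longrightarrow> z \<bullet> y = 0"
proof -
  obtain x where x: "x \<in> rel_interior M" using rel_interior_face_nonempty[OF M(1)] by blast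
  then have xM: "x \<in> M" using rel_interior_subset by blast
  then have xF: "x \<in> F" using cone_faceD(2)[OF M(1)] by blast
  have "\<exists>z. z \<in> dual_cone F \<and> z \<noteq> 0 \<and> z \<bullet> x = 0"
  proof (rule ccontr)
    assume "\<not> ?thesis"
    then have pos: "\<And>z. z \<in> dual_cone F \<Longrightarrow> z \<noteq> 0 \<Longrightarrow> 0 < x \<bullet> z"
      using xF by (force simp: dual_cone_def inner_commute order.order_iff_strict)
    have "F \<subseteq> M"
    proof
      fix y assume y: "y \<in> F"
      obtain e where e: "e > 0" "\<And>z. z \<in> dual_cone F \<Longrightarrow> 0 \<le> (x - e *\<^sub>R y) \<bullet> z"
        using interior_dual[OF dual_cone_convex_cone dual_cone_closed pos] by metis
      have "x - e *\<^sub>R y \<in> F" using F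
      proof (rule mem_cone_if_dual_nonneg)
        show "x - e *\<^sub>R y \<in> span F" using xF y by (intro span_diff span_scale span_base)
      qed (use e(2) in \<open>simp add: inner_commute\<close>)
      then show "y \<in> M" using cone_face_diffD[OF M(1) pointed_coneD(1)[OF F] xM e(1)] y by blast
    qed
    then show False using M cone_faceD(2) by blast
  qed
  then obtain z where z: "z \<in> dual_cone F" "z \<noteq> 0" "z \<bullet> x = 0" by blast
  have "z \<bullet> y = 0" if "y \<in> M" for y
    using nonneg_zero_on_rel_interior[OF cone_faceD(1)[OF M(1)] _ x z(3) that] z(1) cone_faceD(2)[OF M(1)]
    by (auto simp: dual_cone_def)
  then show ?thesis using that z by blast
qed

text \<open>
  Equivalent to facial exposedness of the dual of \<open>F\<close> in its span, but free of faces of that dual: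
  \<open>v\<close> lies in the relative interior of the smallest exposed face containing it.
\<close>

definition dual_exposing :: "'a::euclidean_space set \<Rightarrow> bool" where
  "dual_exposing F \<longleftrightarrow> (\<forall>v\<in>dual_cone F. \<forall>z\<in>dual_cone F.
     (\<forall>x\<in>F. v \<bullet> x = 0 \<longrightarrow> z \<bullet> x = 0) \<longrightarrow> (\<exists>e>0. v - e *\<^sub>R z \<in> dual_cone F))"

lemma mem_dual_face_iff:
  assumes "G \<subseteq> F"
  shows "z \<in> dual_face F G \<longleftrightarrow> z \<in> dual_cone F \<and> (\<forall>x\<in>G. z \<bullet> x = 0)"
proof -
  have "z \<in> orthogonal_comp (span G) \<longleftrightarrow> (\<forall>x\<in>G. z \<bullet> x = 0)"
  proof
    assume z: "z \<in> orthogonal_comp (span G)"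
    have "z \<bullet> x = 0" if "x \<in> G" for x
      using z span_base[OF that] unfolding orthogonal_comp_def Linear_Algebra.orthogonal_def
      by (simp add: inner_commute)
    then show "\<forall>x\<in>G. z \<bullet> x = 0" by blast
  next
    assume "\<forall>x\<in>G. z \<bullet> x = 0"
    then have "span G \<subseteq> {x. z \<bullet> x = 0}" by (intro span_minimal subspace_hyperplane) auto
    then have "\<forall>y\<in>span G. y \<bullet> z = 0" by (auto simp: inner_commute)
    then show "z \<in> orthogonal_comp (span G)"
      unfolding orthogonal_comp_def Linear_Algebra.orthogonal_def by simp
  qed
  then show ?thesis unfolding dual_face_def by blast
qed

text \<open>One direction applies exposedness to the face of the dual generated by \<open>v\<close>.
  For the other, a face \<open>H\<close> is recovered from some \<open>h\<close> in its relative
  interior: the face of \<open>F\<close> on which \<open>h\<close> vanishes has \<open>H\<close> as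
  its dual face.\<close>

lemma facially_exposed_dual_iff:
  fixes F :: "'a::euclidean_space set"
  assumes F: "pointed_cone F"
  shows "facially_exposed (dual_cone F) \<longleftrightarrow> dual_exposing F"
proof
  assume E: "facially_exposed (dual_cone F)"
  show "dual_exposing F"
    unfolding dual_exposing_def
  proof (intro ballI impI)
    fix v z assume v: "v \<in> dual_cone F" and z: "z \<in> dual_cone F" and vz: "\<forall>x\<in>F. v \<bullet> x = 0 \<longrightarrow> z \<bullet> x = 0"
    note pf = point_face[OF dual_cone_convex_cone v]
    obtain G where G: "cone_face G F" "point_face (dual_cone F) v = dual_face F G"
      using E pf(1) unfolding facially_exposed_def exposed_face_def dual_dual_cone[OF F] by blast
    note GF = cone_faceD(2)[OF G(1)]
    have "v \<in> dual_face F G" using pf G(2) by blast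
    then have "z \<in> dual_face F G" using vz z GF unfolding mem_dual_face_iff[OF GF] by blast
    then show "\<exists>e>0. v - e *\<^sub>R z \<in> dual_cone F" using G(2) by (auto simp: point_face_def)
  qed
next
  assume E: "dual_exposing F"
  show "facially_exposed (dual_cone F)"
    unfolding facially_exposed_def exposed_face_def dual_dual_cone[OF F]
  proof (intro allI impI)
    fix H assume H: "cone_face H (dual_cone F)"
    obtain h where h: "h \<in> rel_interior H" using rel_interior_face_nonempty[OF H] by blast
    then have hH: "h \<in> H" using rel_interior_subset by blast
    then have hD: "h \<in> dual_cone F" using cone_faceD(2)[OF H] by blast
    let ?G = "{x \<in> F. h \<bullet> x = 0}"
    have G: "cone_face ?G F" using hD pointed_coneD(1)[OF F]
      by (intro cone_face_Int_orthogonal) (auto simp: dual_cone_def)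
    have "H = dual_face F ?G"
    proof (rule subset_antisym; rule subsetI)
      fix z assume z: "z \<in> H"
      obtain e where e: "e > 0" "h - e *\<^sub>R z \<in> H" using h z rel_interior_cone_iff[OF cone_faceD(1)[OF H]] by blast
      then have D: "h - e *\<^sub>R z \<in> dual_cone F" "z \<in> dual_cone F" using z cone_faceD(2)[OF H] by blast+
      have "z \<bullet> x = 0" if x: "x \<in> ?G" for x
      proof -
        have "0 \<le> (h - e *\<^sub>R z) \<bullet> x" "0 \<le> z \<bullet> x" using D x by (auto simp: dual_cone_def)
        then have "e * (z \<bullet> x) \<le> 0" using x by (simp add: inner_diff_left)
        then show ?thesis using e(1) \<open>0 \<le> z \<bullet> x\<close> by (simp add: mult_le_0_iff)
      qed
      then show "z \<in> dual_face F ?G" using D by (subst mem_dual_face_iff) auto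
    next
      fix z assume "z \<in> dual_face F ?G"
      then have z: "z \<in> dual_cone F" "\<forall>x\<in>?G. z \<bullet> x = 0" by (subst (asm) mem_dual_face_iff; auto)+
      then obtain e where "e > 0" "h - e *\<^sub>R z \<in> dual_cone F" using E hD unfolding dual_exposing_def by blast
      then show "z \<in> H" using cone_face_diffD[OF H dual_cone_convex_cone hH] z(1) by blast
    qed
    then show "\<exists>G. cone_face G F \<and> H = dual_face F G" using G by blast
  qed
qed

lemma dual_faces_exposed_iff:
  assumes "pointed_cone K"
  shows "dual_faces_exposed K \<longleftrightarrow> (\<forall>F. cone_face F K \<longrightarrow> dual_exposing F)"
  using facially_exposed_dual_iff pointed_cone_face[OF assms] unfolding dual_faces_exposed_def by blast

section \<open>Polynomials acting on a vector\<close>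

text \<open>Modulo X - \<mu> the polynomial \<open>q\<close> is congruent to its value at \<mu>,
  which is invertible; this gives the identity for exponent 1, and multiplying it with the identity
  for \<open>k\<close> gives exponent k + 1.\<close>

lemma bezout_linear_power:
  fixes q :: "'a::field poly"
  assumes "poly q \<mu> \<noteq> 0"
  shows "\<exists>a b. a * [:-\<mu>, 1:] ^ k + b * q = 1"
proof (induction k)
  case 0
  have "1 * [:-\<mu>, 1:] ^ 0 + 0 * q = 1" by simp
  then show ?case by blast
next
  case (Suc k)
  then obtain a b where ab: "a * [:-\<mu>, 1:] ^ k + b * q = 1" by blast
  define s where "s = synthetic_div q \<mu>"
  define c where "c = inverse (poly q \<mu>)"
  have q: "[:-\<mu>, 1:] * s + [:poly q \<mu>:] = q"
    using synthetic_div_correct'[of \<mu> q] by (simp add: s_def)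
  have "smult c q = smult c ([:-\<mu>, 1:] * s + [:poly q \<mu>:])" using q by simp
  also have "\<dots> = [:-\<mu>, 1:] * smult c s + 1" using assms by (simp add: c_def smult_add_right one_pCons del: mult_pCons_left)
  finally have one: "smult c q - [:-\<mu>, 1:] * smult c s = 1" by simp
  have "(a * [:-\<mu>, 1:] ^ k + b * q) * (smult c q - [:-\<mu>, 1:] * smult c s) = 1" using ab one by simp
  moreover have "(a * [:-\<mu>, 1:] ^ k + b * q) * (smult c q - [:-\<mu>, 1:] * smult c s)
      = (- a * smult c s) * [:-\<mu>, 1:] ^ Suc k
        + (smult c (a * [:-\<mu>, 1:] ^ k) + b * (smult c q - [:-\<mu>, 1:] * smult c s)) * q"
    by (simp add: algebra_simps del: mult_pCons_left mult_pCons_right)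
  ultimately show ?case by metis
qed

lemma coprime_linear_power:
  fixes q :: "'a::field poly"
  assumes "poly q \<mu> \<noteq> 0"
  shows "coprime ([:-\<mu>, 1:] ^ k) q"
proof -
  obtain a b where ab: "a * [:-\<mu>, 1:] ^ k + b * q = 1" using bezout_linear_power[OF assms] by blast
  show ?thesis
  proof (rule coprimeI)
    fix c assume "c dvd [:-\<mu>, 1:] ^ k" "c dvd q"
    then have "c dvd a * [:-\<mu>, 1:] ^ k + b * q" by (intro dvd_add dvd_mult)
    then show "is_unit c" using ab by simp
  qed
qed

lemma dvd_linear_power_mult_cancel:
  fixes M q :: "'a::field poly"
  assumes "M dvd [:-\<mu>, 1:] ^ k * q" "poly M \<mu> \<noteq> 0"
  shows "M dvd q"
proof -
  obtain a b where ab: "a * [:-\<mu>, 1:] ^ k + b * M = 1" using bezout_linear_power[OF assms(2)] by blast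
  have "q = (a * [:-\<mu>, 1:] ^ k + b * M) * q" using ab by simp
  also have "\<dots> = a * ([:-\<mu>, 1:] ^ k * q) + (b * q) * M" by (simp only: ring_distribs ac_simps)
  finally have *: "q = a * ([:-\<mu>, 1:] ^ k * q) + (b * q) * M" .
  have "M dvd a * ([:-\<mu>, 1:] ^ k * q) + (b * q) * M" by (intro dvd_add dvd_mult assms(1) dvd_refl)
  then show ?thesis using * by metis
qed

lemma linear_power_dvd_mult_cancel:
  fixes q r :: "'a::field poly"
  assumes "[:-\<mu>, 1:] ^ k dvd q * r" "poly q \<mu> \<noteq> 0"
  shows "[:-\<mu>, 1:] ^ k dvd r"
proof -
  obtain a b where ab: "a * [:-\<mu>, 1:] ^ k + b * q = 1" using bezout_linear_power[OF assms(2)] by blast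
  have "r = (a * [:-\<mu>, 1:] ^ k + b * q) * r" using ab by simp
  also have "\<dots> = (a * r) * [:-\<mu>, 1:] ^ k + b * (q * r)" by (simp only: ring_distribs ac_simps)
  finally have *: "r = (a * r) * [:-\<mu>, 1:] ^ k + b * (q * r)" .
  have "[:-\<mu>, 1:] ^ k dvd (a * r) * [:-\<mu>, 1:] ^ k + b * (q * r)" by (intro dvd_add dvd_mult assms(1) dvd_refl)
  then show ?thesis using * by metis
qed

lemma order_split:
  fixes p :: "'a::field poly"
  assumes "p \<noteq> 0"
  obtains q where "p = [:-\<mu>, 1:] ^ order \<mu> p * q" "poly q \<mu> \<noteq> 0" "q \<noteq> 0"
proof -
  obtain q where q: "p = [:-\<mu>, 1:] ^ order \<mu> p * q" "\<not> [:-\<mu>, 1:] dvd q"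
    using order_decomp[OF assms] by blast
  then have nz: "poly q \<mu> \<noteq> 0" by (simp add: poly_eq_0_iff_dvd)
  then have "q \<noteq> 0" by auto
  then show ?thesis using that[OF q(1) nz] by simp
qed

lemma order_eqI:
  fixes q :: "'a::field poly"
  assumes "p = [:-\<mu>, 1:] ^ k * q" "poly q \<mu> \<noteq> 0"
  shows "order \<mu> p = k"
proof -
  have "q \<noteq> 0" using assms(2) by auto
  then have "order \<mu> p = order \<mu> ([:-\<mu>, 1:] ^ k) + order \<mu> q"
    unfolding assms(1) by (intro order_mult) simp
  then show ?thesis using order_0I[OF assms(2)] by (simp only: order_power_n_n)
qed

text \<open>Two scalar multiplications are in play, \<open>*\<^sub>R\<close> for the real matrix and
  \<open>*s\<close> for its complexification; an abstract endomorphism over a field serves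
  both.\<close>

locale linear_endo = Vector_Spaces.vector_space scale
  for scale :: "'a::field \<Rightarrow> 'v::ab_group_add \<Rightarrow> 'v" +
  fixes f :: "'v \<Rightarrow> 'v"
  assumes f_add: "f (v + w) = f v + f w"
    and f_scale: "f (scale c v) = scale c (f v)"
begin
text \<open>Horner evaluation of \<open>p\<close> at the endomorphism, that is p(f) v.\<close>

definition pact :: "'a poly \<Rightarrow> 'v \<Rightarrow> 'v" where
  "pact p v = fold_coeffs (\<lambda>a w. scale a v + f w) p 0"

lemma f_0 [simp]: "f 0 = 0"
  using f_scale[of 0 0] by simp

lemma pact_0 [simp]: "pact 0 v = 0"
  by (simp add: pact_def)

lemma pact_pCons: "pact (pCons a p) v = scale a v + f (pact p v)"
  by (cases "p = 0 \<and> a = 0") (auto simp: pact_def)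

lemma pact_1 [simp]: "pact 1 v = v"
  by (simp add: one_pCons pact_pCons)

lemma pact_add: "pact (p + q) v = pact p v + pact q v"
  by (induction p q rule: poly_induct2) (simp_all add: pact_pCons f_add scale_left_distrib)

lemma pact_smult: "pact (smult c p) v = scale c (pact p v)"
  by (induction p) (simp_all add: pact_pCons f_scale scale_right_distrib)

lemma pact_vadd: "pact p (v + w) = pact p v + pact p w"
  by (induction p) (simp_all add: pact_pCons f_add scale_right_distrib)

lemma pact_vscale: "pact p (scale c v) = scale c (pact p v)"
  by (induction p) (simp_all add: pact_pCons f_scale scale_right_distrib scale_left_commute)

lemma pact_v0 [simp]: "pact p 0 = 0"
  using pact_vscale[of p 0 0] by simp

lemma pact_vsum: "pact p (sum g S) = (\<Sum>i\<in>S. pact p (g i))"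
  by (induction S rule: infinite_finite_induct) (simp_all add: pact_vadd)

lemma pact_f: "pact p (f v) = f (pact p v)"
  by (induction p) (simp_all add: pact_pCons f_add f_scale)

lemma pact_mult: "pact (p * q) v = pact p (pact q v)"
  by (induction p) (simp_all add: pact_pCons pact_add pact_smult)

lemma pact_minus: "pact (- p) v = - pact p v"
  using pact_smult[of "-1" p v] by simp

lemma pact_diff: "pact (p - q) v = pact p v - pact q v"
  using pact_add[of p "-q" v] by (simp add: pact_minus)

lemma pact_vminus: "pact p (- v) = - pact p v"
  using pact_vscale[of p "-1" v] by simp

lemma pact_vdiff: "pact p (v - w) = pact p v - pact p w"
  using pact_vadd[of p v "-w"] by (simp add: pact_vminus)

lemma pact_commute: "pact p (pact q v) = pact q (pact p v)"
  by (metis pact_mult mult.commute)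

lemma pact_linear: "pact [:-\<mu>, 1:] v = f v - scale \<mu> v"
  by (simp add: pact_pCons)

lemma pact_eigen:
  assumes "f v = scale \<mu> v"
  shows "pact p v = scale (poly p \<mu>) v"
  by (induction p) (simp_all add: pact_pCons f_scale assms scale_left_distrib mult.commute)

lemma pact_dvd: "p dvd q \<Longrightarrow> pact p v = 0 \<Longrightarrow> pact q v = 0"
  by (metis dvdE mult.commute pact_mult pact_v0)

lemma pact_linear_power_mono: "pact ([:-\<mu>, 1:] ^ j) v = 0 \<Longrightarrow> j \<le> k \<Longrightarrow> pact ([:-\<mu>, 1:] ^ k) v = 0"
  by (meson le_imp_power_dvd pact_dvd)

text \<open>The polynomials killing \<open>v\<close> form an ideal; a nonzero member of least degree
  generates it, by division with remainder. This is the minimal polynomial of the endomorphism at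
  \<open>v\<close>.\<close>

lemma annihilator_generator:
  assumes "p \<noteq> 0" "pact p v = 0"
  shows "\<exists>M. M \<noteq> 0 \<and> (\<forall>q. pact q v = 0 \<longleftrightarrow> M dvd q)"
proof -
  define d where "d = (LEAST d. \<exists>q. q \<noteq> 0 \<and> pact q v = 0 \<and> degree q = d)"
  have "\<exists>q. q \<noteq> 0 \<and> pact q v = 0 \<and> degree q = d"
    unfolding d_def by (rule LeastI_ex) (use assms in blast)
  then obtain M where M: "M \<noteq> 0" "pact M v = 0" "degree M = d" by blast
  have "M dvd q" if q: "pact q v = 0" for q
  proof (rule ccontr)
    assume n: "\<not> M dvd q"
    then have r: "q mod M \<noteq> 0" by (simp add: mod_eq_0_iff_dvd)
    have "pact (q mod M) v = pact q v - pact (q div M * M) v"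
      by (simp add: pact_diff[symmetric] minus_div_mult_eq_mod)
    also have "\<dots> = 0" using q M by (simp add: pact_mult)
    finally have "\<exists>r. r \<noteq> 0 \<and> pact r v = 0 \<and> degree r = degree (q mod M)" using r by blast
    then have "d \<le> degree (q mod M)" unfolding d_def by (rule Least_le)
    moreover have "degree (q mod M) < degree M" using degree_mod_less[OF M(1), of q] r by simp
    ultimately show False using M by simp
  qed
  then show ?thesis using M pact_dvd by blast
qed

lemma pact_coprime:
  assumes "pact p v = 0" "pact q v = 0" "coprime p q"
  shows "v = 0"
proof -
  have "p \<noteq> 0 \<or> q \<noteq> 0" using assms(3) by auto
  then obtain M where M: "\<forall>q. pact q v = 0 \<longleftrightarrow> M dvd q" using annihilator_generator assms(1,2) by blast
  then have "M dvd p" "M dvd q" using assms by auto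
  then have "M dvd 1" using assms(3) by (rule coprime_common_divisor[rotated 1])
  then show ?thesis using M by (metis pact_1)
qed

text \<open>The generalized eigenspace with 0 included, unlike in \<open>gen_eigvec\<close>, so that
  it is closed under sums and absent components can be 0.\<close>

definition gen_comp :: "'a \<Rightarrow> 'v \<Rightarrow> bool" where
  "gen_comp \<mu> v \<longleftrightarrow> (\<exists>k. pact ([:-\<mu>, 1:] ^ k) v = 0)"

lemma gen_comp_add: "gen_comp \<mu> v \<Longrightarrow> gen_comp \<mu> w \<Longrightarrow> gen_comp \<mu> (v + w)"
proof -
  assume "gen_comp \<mu> v" "gen_comp \<mu> w"
  then obtain j k where "pact ([:-\<mu>, 1:] ^ j) v = 0" "pact ([:-\<mu>, 1:] ^ k) w = 0" by (auto simp: gen_comp_def)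
  then have "pact ([:-\<mu>, 1:] ^ (j+k)) v = 0" "pact ([:-\<mu>, 1:] ^ (j+k)) w = 0"
    using pact_linear_power_mono le_add1 le_add2 by blast+
  then show ?thesis unfolding gen_comp_def by (metis add_0 pact_vadd)
qed

lemma gen_comp_pact: "gen_comp \<mu> v \<Longrightarrow> gen_comp \<mu> (pact p v)"
  unfolding gen_comp_def by (metis pact_commute pact_v0)

lemma gen_comp_minus: "gen_comp \<mu> v \<Longrightarrow> gen_comp \<mu> (- v)"
  unfolding gen_comp_def by (simp add: pact_vminus)

lemma gen_comp_0: "gen_comp \<mu> 0"
  by (simp add: gen_comp_def)

lemma gen_comp_coprime:
  assumes "gen_comp \<mu> v" "pact q v = 0" "poly q \<mu> \<noteq> 0"
  shows "v = 0"
  using assms coprime_linear_power pact_coprime unfolding gen_comp_def by blast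

text \<open>The product of the powers killing the other summands also kills \<open>c \<mu>\<close>,
  because the total is 0; it does not vanish at \<mu>, so it acts injectively on the generalized
  eigenspace of \<mu>.\<close>

lemma gen_comp_sum_0:
  assumes "finite S" "\<And>\<mu>. \<mu> \<in> S \<Longrightarrow> gen_comp \<mu> (c \<mu>)" "sum c S = 0" "\<mu> \<in> S"
  shows "c \<mu> = 0"
proof -
  obtain k where k: "\<And>\<nu>. \<nu> \<in> S \<Longrightarrow> pact ([:-\<nu>, 1:] ^ k \<nu>) (c \<nu>) = 0"
    using assms(2) unfolding gen_comp_def by metis
  define q where "q = (\<Prod>\<nu>\<in>S - {\<mu>}. [:-\<nu>, 1:] ^ k \<nu>)"
  have q: "poly q \<mu> \<noteq> 0" using assms(1) by (auto simp: q_def poly_prod)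
  have "pact q (c \<nu>) = 0" if "\<nu> \<in> S - {\<mu>}" for \<nu>
  proof -
    have "[:-\<nu>, 1:] ^ k \<nu> dvd q" unfolding q_def using assms(1) that by (intro dvd_prodI) auto
    then show ?thesis using pact_dvd k that by blast
  qed
  then have "pact q (sum c (S - {\<mu>})) = 0" by (simp add: pact_vsum)
  moreover have "sum c (S - {\<mu>}) = - c \<mu>" using sum.remove[OF assms(1,4), of c] assms(3)
    by (metis add_eq_0_iff)
  ultimately have "pact q (c \<mu>) = 0" by (simp add: pact_vminus)
  then show ?thesis using gen_comp_coprime[OF assms(2)[OF assms(4)]] q by blast
qed

lemma gen_comp_sum_unique:
  assumes "finite S" "finite T" "\<And>\<mu>. gen_comp \<mu> (c \<mu>)" "\<And>\<mu>. gen_comp \<mu> (d \<mu>)"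
    "\<And>\<mu>. \<mu> \<notin> S \<Longrightarrow> c \<mu> = 0" "\<And>\<mu>. \<mu> \<notin> T \<Longrightarrow> d \<mu> = 0" "sum c S = sum d T"
  shows "c = d"
proof
  fix \<mu>
  let ?U = "insert \<mu> (S \<union> T)"
  have "sum c ?U = sum c S" using assms(1,2,5) by (intro sum.mono_neutral_right) auto
  moreover have "sum d ?U = sum d T" using assms(1,2,6) by (intro sum.mono_neutral_right) auto
  ultimately have "(\<Sum>\<nu>\<in>?U. c \<nu> + - d \<nu>) = 0" using assms(7) by (simp add: sum_subtractf del: sum.insert)
  moreover have "\<And>\<nu>. gen_comp \<nu> (c \<nu> + - d \<nu>)" using assms(3,4) by (intro gen_comp_add gen_comp_minus)
  ultimately have "c \<mu> + - d \<mu> = 0"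
    using gen_comp_sum_0[of ?U "\<lambda>\<nu>. c \<nu> + - d \<nu>" \<mu>] assms(1,2) by simp
  then show "c \<mu> = d \<mu>" by simp
qed

text \<open>Turns orders of spectral components into root multiplicities. Write M = (X - \<mu>)^k q
  with \<open>q\<close> nonzero at \<mu>. The factor \<open>q\<close> acts injectively on the
  component at \<mu>, which gives one direction; conversely, if (X - \<mu>)^j kills this component,
  then (X - \<mu>)^j q kills all components, hence \<open>v\<close>, and is divisible by
  \<open>M\<close>.\<close>

lemma gen_comp_order_iff:
  assumes M: "M \<noteq> 0" "\<And>q. pact q v = 0 \<longleftrightarrow> M dvd q"
    and S: "finite S" "\<And>\<mu>. gen_comp \<mu> (c \<mu>)" "\<And>\<mu>. \<mu> \<notin> S \<Longrightarrow> c \<mu> = 0" "sum c S = v"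
  shows "pact ([:-\<mu>, 1:] ^ j) (c \<mu>) = 0 \<longleftrightarrow> order \<mu> M \<le> j"
proof -
  have kill: "pact p (c \<nu>) = 0" if "M dvd p" for p \<nu>
  proof -
    have "(\<Sum>\<mu>\<in>S. pact p (c \<mu>)) = 0" using M(2) that S(4) pact_vsum by metis
    then have "\<nu> \<in> S \<Longrightarrow> pact p (c \<nu>) = 0"
      using gen_comp_sum_0[OF S(1), of "\<lambda>\<mu>. pact p (c \<mu>)" \<nu>] S(2) gen_comp_pact by blast
    then show ?thesis using S(3) by (cases "\<nu> \<in> S") auto
  qed
  have ord: "pact ([:-\<nu>, 1:] ^ order \<nu> M) (c \<nu>) = 0" for \<nu>
  proof -
    obtain q where q: "M = [:-\<nu>, 1:] ^ order \<nu> M * q" "poly q \<nu> \<noteq> 0" using order_split[OF M(1)] by metis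
    have "pact (q * [:-\<nu>, 1:] ^ order \<nu> M) (c \<nu>) = 0"
      using kill[of M] q(1) by (metis dvd_refl mult.commute)
    then have "pact q (pact ([:-\<nu>, 1:] ^ order \<nu> M) (c \<nu>)) = 0" by (simp only: pact_mult)
    then show ?thesis using gen_comp_coprime q(2) gen_comp_pact S(2) by blast
  qed
  show ?thesis
  proof
    assume j: "pact ([:-\<mu>, 1:] ^ j) (c \<mu>) = 0"
    obtain q where q: "M = [:-\<mu>, 1:] ^ order \<mu> M * q" "poly q \<mu> \<noteq> 0" "q \<noteq> 0" using order_split[OF M(1)] by metis
    have "pact ([:-\<mu>, 1:] ^ j * q) (c \<nu>) = 0" for \<nu>
    proof (cases "\<nu> = \<mu>")
      case True then show ?thesis using j by (metis pact_mult pact_commute pact_v0)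
    next
      case False
      have "[:-\<nu>, 1:] ^ order \<nu> M dvd [:-\<mu>, 1:] ^ order \<mu> M * q" using order_1[of \<nu> M] q(1) by metis
      then have "[:-\<nu>, 1:] ^ order \<nu> M dvd q" by (rule linear_power_dvd_mult_cancel) (use False in simp)
      then show ?thesis using pact_dvd[OF _ ord] by (meson dvd_mult)
    qed
    then have "pact ([:-\<mu>, 1:] ^ j * q) v = 0" using S(4) by (metis pact_vsum sum.neutral)
    then have d: "M dvd [:-\<mu>, 1:] ^ j * q" using M(2) by simp
    have nz: "[:-\<mu>, 1:] ^ j * q \<noteq> 0" using q(3) by simp
    have "order \<mu> M \<le> order \<mu> ([:-\<mu>, 1:] ^ j * q)" using dvd_imp_order_le[OF nz d] .
    then show "order \<mu> M \<le> j" using order_eqI[OF refl q(2), of j] by simp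
  next
    assume "order \<mu> M \<le> j"
    then show "pact ([:-\<mu>, 1:] ^ j) (c \<mu>) = 0" using ord pact_linear_power_mono by blast
  qed
qed

end

text \<open>Splits off one root \<mu> at a time: the Bezout identity for (X - \<mu>)^k and the
  cofactor \<open>q\<close> writes \<open>v\<close> as a part killed by \<open>q\<close>, which has
  smaller degree, plus a part killed by (X - \<mu>)^k.\<close>

lemma (in linear_endo) gen_comp_decomposition:
  assumes split: "\<And>p :: 'a poly. degree p > 0 \<Longrightarrow> \<exists>z. poly p z = 0"
    and "p \<noteq> 0" "pact p v = 0"
  shows "\<exists>S c. finite S \<and> (\<forall>\<mu>. gen_comp \<mu> (c \<mu>)) \<and> (\<forall>\<mu>. \<mu> \<notin> S \<longrightarrow> c \<mu> = 0) \<and> sum c S = v"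
  using assms(2,3)
proof (induction "degree p" arbitrary: p v rule: less_induct)
  case less
  show ?case
  proof (cases "degree p = 0")
    case True
    then obtain a where a: "p = [:a:]" by (metis degree_eq_zeroE)
    then have "scale a v = 0" "a \<noteq> 0" using less.prems by (auto simp: pact_pCons)
    then have "v = 0" by simp
    then show ?thesis by (intro exI[of _ "{}"] exI[of _ "\<lambda>_. 0"]) (simp add: gen_comp_0)
  next
    case False
    then obtain \<mu> where \<mu>: "poly p \<mu> = 0" using split by blast
    define k where "k = order \<mu> p"
    obtain q where q: "p = [:-\<mu>, 1:] ^ k * q" "poly q \<mu> \<noteq> 0" "q \<noteq> 0" using order_split[OF less.prems(1)] k_def by metis
    have k: "k > 0" using \<mu> less.prems(1) by (simp add: k_def order_gt_0_iff)
    have deg: "degree q < degree p" unfolding q(1) using q(3) k by (simp add: degree_mult_eq degree_linear_power)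
    obtain a b where ab: "a * [:-\<mu>, 1:] ^ k + b * q = 1" using bezout_linear_power[OF q(2)] by blast
    define u w where "u = pact (a * [:-\<mu>, 1:] ^ k) v" and "w = pact (b * q) v"
    have uw: "v = u + w" unfolding u_def w_def by (metis ab pact_1 pact_add)
    have "pact q u = pact (a * p) v" unfolding u_def q(1) by (metis pact_mult mult.commute mult.left_commute)
    then have "pact q u = 0" using less.prems(2) by (simp add: pact_mult)
    from less.hyps[OF deg q(3) this] obtain S c where
      S: "finite S" "\<forall>\<mu>. gen_comp \<mu> (c \<mu>)" "\<forall>\<mu>. \<mu> \<notin> S \<longrightarrow> c \<mu> = 0" "sum c S = u" by blast
    have "pact ([:-\<mu>, 1:] ^ k) w = pact (b * p) v" unfolding w_def q(1) by (metis pact_mult mult.left_commute)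
    then have "gen_comp \<mu> w" using less.prems(2) unfolding gen_comp_def by (metis pact_mult pact_v0)
    \<comment> \<open>Adding \<open>w\<close> to the old component, instead of replacing it, avoids
      an argument that \<open>c \<mu>\<close> is 0.\<close>
    define d where "d = c(\<mu> := c \<mu> + w)"
    have "sum c (insert \<mu> S) = sum c S" using S(1,3) by (intro sum.mono_neutral_right) auto
    then have "sum c (insert \<mu> S) = u" using S(4) by simp
    then have 1: "c \<mu> + sum c (insert \<mu> S - {\<mu>}) = u" using S(1) by (metis finite.insertI insertI1 sum.remove)
    have "sum d (insert \<mu> S) = d \<mu> + sum d (insert \<mu> S - {\<mu>})" using S(1) by (metis finite.insertI insertI1 sum.remove)
    also have "sum d (insert \<mu> S - {\<mu>}) = sum c (insert \<mu> S - {\<mu>})" by (intro sum.cong) (auto simp: d_def)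
    also have "d \<mu> + sum c (insert \<mu> S - {\<mu>}) = v" using 1 uw by (simp add: d_def algebra_simps)
    finally have "sum d (insert \<mu> S) = v" .
    moreover have "\<forall>\<nu>. gen_comp \<nu> (d \<nu>)" using S(2) \<open>gen_comp \<mu> w\<close> gen_comp_add by (auto simp: d_def)
    moreover have "\<forall>\<nu>. \<nu> \<notin> insert \<mu> S \<longrightarrow> d \<nu> = 0" using S(3) by (auto simp: d_def)
    moreover have "finite (insert \<mu> S)" using S(1) by simp
    ultimately show ?thesis by (intro exI[of _ "insert \<mu> S"] exI[of _ d] conjI)
  qed
qed

text \<open>A repeated vector does not make the set of values dependent, so the case of a repetition
  is settled separately, with coefficients 1 and -1.\<close>

lemma euclidean_sequence_dependent:
  fixes g :: "nat \<Rightarrow> 'a::euclidean_space"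
  obtains c where "\<exists>i\<le>DIM('a). c i \<noteq> 0" "(\<Sum>i\<le>DIM('a). c i *\<^sub>R g i) = 0"
proof (cases "inj_on g {..DIM('a)}")
  case True
  then have "card (g ` {..DIM('a)}) > DIM('a)" by (simp add: card_image)
  then have "dependent (g ` {..DIM('a)})" using independent_card_le_dim dim_subset_UNIV
    by (metis independent_bound not_le)
  then obtain u where u: "\<exists>v\<in>g ` {..DIM('a)}. u v \<noteq> 0" "(\<Sum>v\<in>g ` {..DIM('a)}. u v *\<^sub>R v) = 0"
    using dependent_finite[of "g ` {..DIM('a)}"] by auto
  show ?thesis
  proof (rule that[of "\<lambda>i. u (g i)"])
    show "\<exists>i\<le>DIM('a). u (g i) \<noteq> 0" using u(1) by auto
    show "(\<Sum>i\<le>DIM('a). u (g i) *\<^sub>R g i) = 0" using u(2) by (simp add: sum.reindex[OF True])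
  qed
next
  case False
  then obtain i j where ij: "i \<le> DIM('a)" "j \<le> DIM('a)" "i \<noteq> j" "g i = g j" by (auto simp: inj_on_def)
  have "(\<Sum>k\<le>DIM('a). (if k = i then 1 else if k = j then -1 else 0) *\<^sub>R g k)
    = (\<Sum>k\<in>{i,j}. (if k = i then 1 else if k = j then -1 else 0) *\<^sub>R g k)"
    using ij by (intro sum.mono_neutral_right) auto
  also have "\<dots> = 0" using ij by simp
  finally show ?thesis using ij by (intro that[of "\<lambda>k. if k = i then 1 else if k = j then -1 else 0"]) auto
qed

section \<open>Spectral pairs and minimal polynomials\<close>

context linear_endo
begin

lemma pact_monom: "pact (monom c n) v = scale c ((f ^^ n) v)"
  by (induction n) (simp_all add: monom_0 monom_Suc pact_pCons f_scale)

lemma pact_sum: "pact (sum p S) v = (\<Sum>i\<in>S. pact (p i) v)"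
  by (induction S rule: infinite_finite_induct) (simp_all add: pact_add)

lemma funpow_vadd: "(f ^^ n) (v + w) = (f ^^ n) v + (f ^^ n) w"
  by (induction n) (simp_all add: f_add)

lemma funpow_vscale: "(f ^^ n) (scale c v) = scale c ((f ^^ n) v)"
  by (induction n) (simp_all add: f_scale)

end

section \<open>The real matrix, its complexification, and minimal polynomials at a vector\<close>

abbreviation cmat :: "real^'n^'n \<Rightarrow> complex^'n^'n" where
  "cmat A \<equiv> map_matrix complex_of_real A"

interpretation R: linear_endo "\<lambda>c x. c *\<^sub>R x" "\<lambda>x. A *v x" for A :: "real^'n^'n"
proof (unfold_locales, goal_cases)
  case (1 v w) then show ?case by (rule matrix_vector_right_distrib)
next
  case (2 c v) then show ?case by (rule matrix_vector_mult_scaleR)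
qed

interpretation C: linear_endo "\<lambda>c x. c *s x" "\<lambda>v. cmat A *v v" for A :: "real^'n^'n"
proof (unfold_locales, goal_cases)
  case (1 v w) then show ?case by (rule matrix_vector_right_distrib)
next
  case (2 c v) then show ?case by (rule vec.scale)
qed

abbreviation rpact :: "real^'n^'n \<Rightarrow> real poly \<Rightarrow> real^'n \<Rightarrow> real^'n" where
  "rpact A \<equiv> linear_endo.pact (\<lambda>c x. c *\<^sub>R x) (\<lambda>x. A *v x)"

abbreviation cpact :: "real^'n^'n \<Rightarrow> complex poly \<Rightarrow> complex^'n \<Rightarrow> complex^'n" where
  "cpact A \<equiv> linear_endo.pact (\<lambda>c x. c *s x) (\<lambda>v. cmat A *v v)"

abbreviation cgen :: "real^'n^'n \<Rightarrow> complex \<Rightarrow> complex^'n \<Rightarrow> bool" where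
  "cgen A \<equiv> linear_endo.gen_comp (\<lambda>c x. c *s x) (\<lambda>v. cmat A *v v)"

abbreviation cpoly :: "real poly \<Rightarrow> complex poly" where
  "cpoly \<equiv> map_poly complex_of_real"

lemma cvec_0 [simp]: "cvec 0 = 0"
  by (simp add: cvec_def Finite_Cartesian_Product.vec_eq_iff)

lemma cvec_add: "cvec (x + y) = cvec x + cvec y"
  by (simp add: cvec_def Finite_Cartesian_Product.vec_eq_iff)

lemma cvec_diff: "cvec (x - y) = cvec x - cvec y"
  by (simp add: cvec_def Finite_Cartesian_Product.vec_eq_iff)

lemma cvec_scaleR: "cvec (r *\<^sub>R x) = complex_of_real r *s cvec x"
  by (simp add: cvec_def Finite_Cartesian_Product.vec_eq_iff)

lemma cvec_inject [simp]: "cvec x = cvec y \<longleftrightarrow> x = y"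
  by (simp add: cvec_def Finite_Cartesian_Product.vec_eq_iff)

lemma cvec_eq_0_iff [simp]: "cvec x = 0 \<longleftrightarrow> x = 0"
  using cvec_inject[of x 0] by simp

lemma cvec_matrix: "cmat A *v cvec x = cvec (A *v x)"
  by (simp add: cvec_def Finite_Cartesian_Product.vec_eq_iff matrix_vector_mult_def)

lemma cvec_funpow: "((\<lambda>v. cmat A *v v) ^^ k) (cvec x) = cvec (((\<lambda>v. A *v v) ^^ k) x)"
  by (induction k) (simp_all add: cvec_matrix)

lemma cpact_cvec: "cpact A (cpoly p) (cvec x) = cvec (rpact A p x)"
  by (induction p) (simp_all add: map_poly_pCons C.pact_pCons R.pact_pCons cvec_add cvec_scaleR cvec_matrix)

lemma cpoly_add: "cpoly (p + q) = cpoly p + cpoly q"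
  by (intro poly_eqI) (simp add: coeff_map_poly)

lemma cpoly_smult: "cpoly (smult c p) = smult (complex_of_real c) (cpoly p)"
  by (intro poly_eqI) (simp add: coeff_map_poly)

lemma cpoly_pCons: "cpoly (pCons a p) = pCons (complex_of_real a) (cpoly p)"
  by (intro poly_eqI) (simp add: coeff_map_poly coeff_pCons split: nat.split)

lemma cpoly_mult: "cpoly (p * q) = cpoly p * cpoly q"
  by (induction p) (simp_all add: cpoly_pCons cpoly_add cpoly_smult)

lemma poly_cpoly: "poly (cpoly p) (complex_of_real t) = complex_of_real (poly p t)"
  by (induction p) (simp_all add: map_poly_pCons)

lemma cpoly_linear_power: "cpoly ([:-\<mu>, 1:] ^ k) = [:- complex_of_real \<mu>, 1:] ^ k"
proof (induction k)
  case (Suc k)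
  have "cpoly [:-\<mu>, 1:] = [:- complex_of_real \<mu>, 1:]" by (simp add: cpoly_pCons)
  then show ?case unfolding power_Suc cpoly_mult Suc.IH by (rule arg_cong)
qed simp

lemma cvec_decomp:
  fixes v :: "complex^'n"
  obtains a b where "v = cvec a + \<i> *s cvec b"
proof (rule that[of "\<chi> i. Re (v $ i)" "\<chi> i. Im (v $ i)"])
  show "v = cvec (\<chi> i. Re (v $ i)) + \<i> *s cvec (\<chi> i. Im (v $ i))"
    by (simp add: cvec_def Finite_Cartesian_Product.vec_eq_iff complex_eq_iff)
qed

text \<open>The iterates of a vector up to the dimension are dependent, which gives a polynomial
  killing that vector; the product of these polynomials over a basis kills the whole space.\<close>

lemma matrix_annihilator:
  fixes A :: "real^'n^'n"
  obtains p where "p \<noteq> 0" "\<And>x. rpact A p x = 0"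
proof -
  have "\<exists>p. p \<noteq> 0 \<and> rpact A p v = 0" for v
  proof -
    let ?N = "DIM(real^'n)"
    obtain c where c: "\<exists>i\<le>?N. c i \<noteq> 0" "(\<Sum>i\<le>?N. c i *\<^sub>R ((\<lambda>x. A *v x) ^^ i) v) = 0"
      using euclidean_sequence_dependent[where g = "\<lambda>i. ((\<lambda>x. A *v x) ^^ i) v"] by metis
    define p where "p = (\<Sum>i\<le>?N. monom (c i) i)"
    obtain i where i: "i \<le> ?N" "c i \<noteq> 0" using c(1) by blast
    have "coeff p i = c i" using i(1) by (simp add: p_def coeff_sum)
    then have "p \<noteq> 0" using i(2) by auto
    moreover have "rpact A p v = 0" unfolding p_def R.pact_sum R.pact_monom using c(2) .
    ultimately show ?thesis by blast
  qed
  then obtain p where p: "\<And>v. p v \<noteq> 0" "\<And>v. rpact A (p v) v = 0" by metis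
  define P where "P = (\<Prod>b\<in>Basis. p b)"
  have "P \<noteq> 0" using p(1) by (simp add: P_def)
  moreover have "rpact A P x = 0" for x
  proof -
    have b: "rpact A P b = 0" if "b \<in> Basis" for b
      using R.pact_dvd[OF dvd_prodI[OF finite_Basis that] p(2)] unfolding P_def .
    have "rpact A P x = rpact A P (\<Sum>b\<in>Basis. (x \<bullet> b) *\<^sub>R b)" by (simp only: euclidean_representation)
    also have "\<dots> = (\<Sum>b\<in>Basis. rpact A P ((x \<bullet> b) *\<^sub>R b))" by (rule R.pact_vsum)
    also have "\<dots> = 0" using b by (simp add: R.pact_vscale)
    finally show ?thesis .
  qed
  ultimately show ?thesis using that by blast
qed

lemma cpact_annihilator:
  assumes "\<And>x. rpact A p x = 0"
  shows "cpact A (cpoly p) v = 0"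
proof -
  obtain a b where "v = cvec a + \<i> *s cvec b" by (rule cvec_decomp)
  then show ?thesis using assms by (simp add: C.pact_vadd C.pact_vscale cpact_cvec)
qed

text \<open>The minimal polynomial of \<open>A\<close> at \<open>v\<close>, determined up to a
  scalar factor that affects neither roots nor multiplicities. Spectral pairs are read from
  it.\<close>

definition cmin :: "real^'n^'n \<Rightarrow> complex^'n \<Rightarrow> complex poly" where
  "cmin A v = (SOME M. M \<noteq> 0 \<and> (\<forall>q. cpact A q v = 0 \<longleftrightarrow> M dvd q))"

lemma cmin: "cmin A v \<noteq> 0" "cpact A q v = 0 \<longleftrightarrow> cmin A v dvd q"
proof -
  obtain p where p: "p \<noteq> 0" "\<And>x. rpact A p x = 0" using matrix_annihilator[of A] by blast
  have "cpoly p \<noteq> 0" using p(1) by (simp add: map_poly_eq_0_iff)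
  then have "\<exists>M. M \<noteq> 0 \<and> (\<forall>q. cpact A q v = 0 \<longleftrightarrow> M dvd q)"
    using C.annihilator_generator cpact_annihilator[OF p(2)] by blast
  then have "cmin A v \<noteq> 0 \<and> (\<forall>q. cpact A q v = 0 \<longleftrightarrow> cmin A v dvd q)"
    unfolding cmin_def by (rule someI_ex)
  then show "cmin A v \<noteq> 0" "cpact A q v = 0 \<longleftrightarrow> cmin A v dvd q" by blast+
qed

lemma cmin_kill: "cpact A (cmin A v) v = 0"
  by (simp add: cmin(2))

lemma cmin_degree: "v \<noteq> 0 \<Longrightarrow> 0 < degree (cmin A v)"
proof (rule ccontr)
  assume v: "v \<noteq> 0" and "\<not> 0 < degree (cmin A v)"
  then have "cmin A v dvd 1" using is_unit_iff_degree[OF cmin(1)[of A v]] by simp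
  then have "cpact A 1 v = 0" by (simp only: cmin(2))
  then show False using v by simp
qed

lemma cmin_roots:
  assumes "v \<noteq> 0"
  shows "finite {\<mu>. poly (cmin A v) \<mu> = 0}" "{\<mu>. poly (cmin A v) \<mu> = 0} \<noteq> {}"
  using poly_roots_finite[OF cmin(1)] fundamental_theorem_of_algebra_alt cmin_degree[OF assms]
  by (auto simp: fundamental_theorem_of_algebra constant_degree)

lemma shift_map_funpow: "(shift_map A \<mu> ^^ k) v = cpact A ([:\<mu>, -1:] ^ k) v"
proof (induction k)
  case (Suc k)
  have "shift_map A \<mu> w = cpact A [:\<mu>, -1:] w" for w
    by (simp add: shift_map_def C.pact_pCons vec.neg)
  then have "(shift_map A \<mu> ^^ Suc k) v = cpact A [:\<mu>, -1:] ((shift_map A \<mu> ^^ k) v)"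
    by (simp only: funpow.simps o_apply)
  then show ?case by (simp only: Suc C.pact_mult power_Suc)
qed simp

text \<open>\<open>shift_map\<close> uses \<mu> - A, whereas polynomials use X - \<mu>; the sign of
  a power does not affect its kernel.\<close>

lemma shift_map_funpow_eq_0: "(shift_map A \<mu> ^^ k) v = 0 \<longleftrightarrow> cpact A ([:-\<mu>, 1:] ^ k) v = 0"
proof -
  have "[:\<mu>, -1:] = - [:-\<mu>, 1:]" by simp
  then have "[:\<mu>, -1:] ^ k dvd [:-\<mu>, 1:] ^ k" "[:-\<mu>, 1:] ^ k dvd [:\<mu>, -1:] ^ k"
    by (simp_all only: dvd_power_same minus_dvd_iff dvd_minus_iff dvd_refl)
  then show ?thesis unfolding shift_map_funpow
    using C.pact_dvd[of "[:\<mu>, -1:] ^ k" "[:-\<mu>, 1:] ^ k" A v] C.pact_dvd[of "[:-\<mu>, 1:] ^ k" "[:\<mu>, -1:] ^ k" A v] by blast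
qed

lemma gen_eigvec_iff: "gen_eigvec A \<mu> v \<longleftrightarrow> v \<noteq> 0 \<and> cgen A \<mu> v"
proof -
  have "(\<exists>k>0. cpact A ([:-\<mu>, 1:] ^ k) v = 0) \<longleftrightarrow> (\<exists>k. cpact A ([:-\<mu>, 1:] ^ k) v = 0)"
    using C.pact_linear_power_mono[where A = A and \<mu> = \<mu> and v = v, OF _ le_SucI[OF order_refl]] by blast
  then show ?thesis unfolding gen_eigvec_def shift_map_funpow_eq_0 C.gen_comp_def by blast
qed

lemma eigvec_order_eq:
  assumes "gen_eigvec A \<mu> v"
  shows "eigvec_order A \<mu> v = order \<mu> (cmin A v)"
    and "poly (cmin A v) \<nu> = 0 \<longleftrightarrow> \<nu> = \<mu>"
proof -
  let ?c = "\<lambda>\<nu>. if \<nu> = \<mu> then v else 0"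
  have v: "v \<noteq> 0" "cgen A \<mu> v" using assms by (auto simp: gen_eigvec_iff)
  have iff: "cpact A ([:-\<nu>, 1:] ^ j) (?c \<nu>) = 0 \<longleftrightarrow> order \<nu> (cmin A v) \<le> j" for \<nu> j
    by (rule C.gen_comp_order_iff[where S = "{\<mu>}", OF cmin]) (use v in \<open>auto simp: C.gen_comp_0\<close>)
  have 0: "\<not> order \<mu> (cmin A v) \<le> 0" using iff[of \<mu> 0] v(1) by simp
  have "(\<lambda>k. 0 < k \<and> (shift_map A \<mu> ^^ k) v = 0) = (\<lambda>k. order \<mu> (cmin A v) \<le> k)"
    unfolding shift_map_funpow_eq_0 using iff[of \<mu>] 0 by (intro ext) auto
  then show "eigvec_order A \<mu> v = order \<mu> (cmin A v)"
    unfolding eigvec_order_def by (simp add: Least_equality)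
  show "poly (cmin A v) \<nu> = 0 \<longleftrightarrow> \<nu> = \<mu>"
    using iff[of \<nu> 0] 0 cmin(1)[of A v] order_root[of "cmin A v" \<nu>] by (auto split: if_splits)
qed

text \<open>Justifies the definite description in \<open>spec_decomp\<close>: existence because
  complex polynomials split, uniqueness by independence of generalized eigenspaces.\<close>

lemma spec_decomp_ex1:
  "\<exists>!c. finite {\<mu>. c \<mu> \<noteq> 0} \<and> (\<forall>\<mu>. c \<mu> \<noteq> 0 \<longrightarrow> gen_eigvec A \<mu> (c \<mu>)) \<and> (\<Sum>\<mu> | c \<mu> \<noteq> 0. c \<mu>) = cvec x"
proof -
  obtain S c where S: "finite S" "\<forall>\<mu>. cgen A \<mu> (c \<mu>)" "\<forall>\<mu>. \<mu> \<notin> S \<longrightarrow> c \<mu> = 0" "sum c S = cvec x"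
    using C.gen_comp_decomposition[OF _ cmin(1) cmin_kill, of A "cvec x"]
    by (metis fundamental_theorem_of_algebra constant_degree not_gr_zero)
  show ?thesis
  proof (rule ex1I[of _ c])
    have sub: "{\<mu>. c \<mu> \<noteq> 0} \<subseteq> S" using S(3) by blast
    then have "(\<Sum>\<mu> | c \<mu> \<noteq> 0. c \<mu>) = sum c S" using S(1) by (intro sum.mono_neutral_left) auto
    then show "finite {\<mu>. c \<mu> \<noteq> 0} \<and> (\<forall>\<mu>. c \<mu> \<noteq> 0 \<longrightarrow> gen_eigvec A \<mu> (c \<mu>)) \<and> (\<Sum>\<mu> | c \<mu> \<noteq> 0. c \<mu>) = cvec x"
      using S sub finite_subset by (auto simp: gen_eigvec_iff)
    fix d assume d: "finite {\<mu>. d \<mu> \<noteq> 0} \<and> (\<forall>\<mu>. d \<mu> \<noteq> 0 \<longrightarrow> gen_eigvec A \<mu> (d \<mu>)) \<and> (\<Sum>\<mu> | d \<mu> \<noteq> 0. d \<mu>) = cvec x"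
    show "d = c"
    proof (rule C.gen_comp_sum_unique[where S = "{\<mu>. d \<mu> \<noteq> 0}" and T = S and A = A])
      show "cgen A \<mu> (d \<mu>)" for \<mu> using d C.gen_comp_0 by (cases "d \<mu> = 0") (auto simp: gen_eigvec_iff)
    qed (use d S in auto)
  qed
qed

lemma spec_decomp:
  "finite {\<mu>. spec_decomp A x \<mu> \<noteq> 0}" "cgen A \<mu> (spec_decomp A x \<mu>)"
  "(\<Sum>\<mu> | spec_decomp A x \<mu> \<noteq> 0. spec_decomp A x \<mu>) = cvec x"
  "spec_decomp A x \<mu> \<noteq> 0 \<Longrightarrow> gen_eigvec A \<mu> (spec_decomp A x \<mu>)"
proof -
  have *: "finite {\<mu>. spec_decomp A x \<mu> \<noteq> 0} \<and> (\<forall>\<mu>. spec_decomp A x \<mu> \<noteq> 0 \<longrightarrow> gen_eigvec A \<mu> (spec_decomp A x \<mu>))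
    \<and> (\<Sum>\<mu> | spec_decomp A x \<mu> \<noteq> 0. spec_decomp A x \<mu>) = cvec x"
    unfolding spec_decomp_def by (rule theI'[OF spec_decomp_ex1])
  then show "finite {\<mu>. spec_decomp A x \<mu> \<noteq> 0}"
    "(\<Sum>\<mu> | spec_decomp A x \<mu> \<noteq> 0. spec_decomp A x \<mu>) = cvec x"
    "spec_decomp A x \<mu> \<noteq> 0 \<Longrightarrow> gen_eigvec A \<mu> (spec_decomp A x \<mu>)" by blast+
  show "cgen A \<mu> (spec_decomp A x \<mu>)"
    using * C.gen_comp_0 by (cases "spec_decomp A x \<mu> = 0") (auto simp: gen_eigvec_iff)
qed

lemma spec_decomp_order_iff:
  "cpact A ([:-\<mu>, 1:] ^ j) (spec_decomp A x \<mu>) = 0 \<longleftrightarrow> order \<mu> (cmin A (cvec x)) \<le> j"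
  by (rule C.gen_comp_order_iff[OF cmin spec_decomp(1,2) _ spec_decomp(3)]) auto

lemma spec_decomp_nonzero_iff: "spec_decomp A x \<mu> \<noteq> 0 \<longleftrightarrow> poly (cmin A (cvec x)) \<mu> = 0"
  using spec_decomp_order_iff[of A \<mu> 0 x] order_root[of "cmin A (cvec x)" \<mu>] cmin(1)[of A "cvec x"] by auto

lemma eigvec_order_spec_decomp:
  assumes "poly (cmin A (cvec x)) \<mu> = 0"
  shows "eigvec_order A \<mu> (spec_decomp A x \<mu>) = order \<mu> (cmin A (cvec x))"
proof -
  have "0 < order \<mu> (cmin A (cvec x))" using assms by (simp add: order_gt_0_iff cmin(1))
  then have "(\<lambda>k. 0 < k \<and> (shift_map A \<mu> ^^ k) (spec_decomp A x \<mu>) = 0) = (\<lambda>k. order \<mu> (cmin A (cvec x)) \<le> k)"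
    unfolding shift_map_funpow_eq_0 spec_decomp_order_iff by (intro ext) auto
  then show ?thesis unfolding eigvec_order_def by (simp add: Least_equality)
qed

text \<open>Here the decomposition disappears from the spectral pair: what remains is the largest
  modulus of a root of \<open>cmin\<close> and the largest multiplicity on that circle, both
  realised at \<mu>.\<close>

lemma spec_pair_eq:
  assumes "x \<noteq> 0" "poly (cmin A (cvec x)) \<mu> = 0"
    "\<And>\<nu>. poly (cmin A (cvec x)) \<nu> = 0 \<Longrightarrow> cmod \<nu> \<le> cmod \<mu>"
    "\<And>\<nu>. poly (cmin A (cvec x)) \<nu> = 0 \<Longrightarrow> cmod \<nu> = cmod \<mu> \<Longrightarrow> order \<nu> (cmin A (cvec x)) \<le> order \<mu> (cmin A (cvec x))"
  shows "spec_pair A x = (cmod \<mu>, order \<mu> (cmin A (cvec x)))"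
proof -
  let ?M = "cmin A (cvec x)"
  have fin: "finite {\<mu>. poly ?M \<mu> = 0}" using assms(1) by (simp add: cmin_roots(1))
  have lr: "local_radius A x = cmod \<mu>"
    unfolding local_radius_def spec_decomp_nonzero_iff
  proof (rule Max_eqI)
    show "finite {cmod \<mu> |\<mu>. poly ?M \<mu> = 0}" using finite_image_set[OF fin] .
  qed (use assms in auto)
  have "{eigvec_order A \<mu> (spec_decomp A x \<mu>) | \<mu>. spec_decomp A x \<mu> \<noteq> 0 \<and> cmod \<mu> = local_radius A x}
    = {order \<nu> ?M | \<nu>. poly ?M \<nu> = 0 \<and> cmod \<nu> = cmod \<mu>}"
    unfolding lr spec_decomp_nonzero_iff using eigvec_order_spec_decomp by (metis (no_types, lifting))
  moreover have "Max {order \<nu> ?M | \<nu>. poly ?M \<nu> = 0 \<and> cmod \<nu> = cmod \<mu>} = order \<mu> ?M"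
  proof (rule Max_eqI)
    show "finite {order \<nu> ?M | \<nu>. poly ?M \<nu> = 0 \<and> cmod \<nu> = cmod \<mu>}"
      by (rule finite_image_set) (use fin in auto)
  qed (use assms in auto)
  ultimately have "local_order A x = order \<mu> ?M" unfolding local_order_def by simp
  then show ?thesis using assms(1) lr by (simp add: spec_pair_def)
qed

lemma spec_pair_gen_eigvec:
  assumes "gen_eigvec A \<mu> (cvec x)"
  shows "spec_pair A x = (cmod \<mu>, eigvec_order A \<mu> (cvec x))"
  unfolding eigvec_order_eq(1)[OF assms]
proof (rule spec_pair_eq)
  show "x \<noteq> 0" using assms by (simp add: gen_eigvec_iff)
qed (simp_all only: eigvec_order_eq(2)[OF assms] order_refl)

lemma recursive_contraction_tendsto_0:
  fixes a b :: "nat \<Rightarrow> real"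
  assumes "\<And>k. 0 \<le> a k" "\<And>k. a (Suc k) \<le> \<theta> * a k + b k" "0 \<le> \<theta>" "\<theta> < 1" "b \<longlonglongrightarrow> 0"
  shows "a \<longlonglongrightarrow> 0"
proof (rule LIMSEQ_I)
  fix e :: real assume e: "0 < e"
  \<comment> \<open>Chosen so that e/2 is the fixed point of the map t to \<theta> t + d.\<close>
  define d where "d = e * (1 - \<theta>) / 2"
  have d: "d > 0" using e assms(4) by (simp add: d_def)
  obtain N where N: "\<And>k. k \<ge> N \<Longrightarrow> norm (b k - 0) < d" using LIMSEQ_D[OF assms(5) d] by blast
  have step: "a (N + j) \<le> \<theta> ^ j * a N + e / 2" for j
  proof (induction j)
    case 0 then show ?case using e by simp
  next
    case (Suc j)
    have "b (N + j) \<le> d" using N[of "N + j"] by simp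
    then have "a (N + Suc j) \<le> \<theta> * a (N + j) + d" using assms(2)[of "N + j"] by simp
    also have "\<dots> \<le> \<theta> * (\<theta> ^ j * a N + e / 2) + d" using Suc assms(3) by (intro add_right_mono mult_left_mono) auto
    also have "\<dots> = \<theta> ^ Suc j * a N + e / 2" by (simp add: d_def field_simps)
    finally show ?case .
  qed
  have "(\<lambda>j. \<theta> ^ j * a N) \<longlonglongrightarrow> 0"
    using LIMSEQ_power_zero[of \<theta>] assms(3,4) by (intro tendsto_mult_left_zero) auto
  from LIMSEQ_D[OF this, of "e/2"] e obtain J where J: "\<And>j. j \<ge> J \<Longrightarrow> norm (\<theta> ^ j * a N - 0) < e / 2" by auto
  have "norm (a k - 0) < e" if k: "k \<ge> N + J" for k
  proof -
    have "a (N + (k - N)) \<le> \<theta> ^ (k - N) * a N + e / 2" by (rule step)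
    moreover have "norm (\<theta> ^ (k - N) * a N - 0) < e / 2" using k by (intro J) auto
    ultimately show ?thesis using k assms(1)[of k] by auto
  qed
  then show "\<exists>no. \<forall>n\<ge>no. norm (a n - 0) < e" by blast
qed

lemma norm_vscale: "norm (c *s v) = cmod c * norm (v :: complex^'n)"
proof -
  have "norm (c *s v) = L2_set (\<lambda>i. cmod c * cmod (v $ i)) UNIV"
    by (simp add: norm_vec_def norm_mult)
  also have "\<dots> = cmod c * norm v" by (simp add: L2_set_right_distrib norm_vec_def)
  finally show ?thesis .
qed

text \<open>Growth of iterates by induction on the degree: with \<mu> a root of \<open>p\<close> and
  u = A v - \<mu> v, the vector \<open>u\<close> is killed by a polynomial of smaller degree, and
  the iterates of \<open>v\<close> obey a first-order recursion with factor \<mu> whose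
  inhomogeneity consists of the iterates of \<open>u\<close>.\<close>

lemma cpact_power_tendsto_0:
  assumes "p \<noteq> 0" "cpact A p v = 0" "\<And>\<mu>. poly p \<mu> = 0 \<Longrightarrow> cmod \<mu> < r" "0 < r"
  shows "(\<lambda>k. norm (((\<lambda>v. cmat A *v v) ^^ k) v) / r ^ k) \<longlonglongrightarrow> 0"
  using assms
proof (induction "degree p" arbitrary: p v rule: less_induct)
  case less
  show ?case
  proof (cases "degree p = 0")
    case True
    then obtain a where a: "p = [:a:]" by (metis degree_eq_zeroE)
    then have "v = 0" using less.prems by (auto simp: C.pact_pCons)
    moreover have "((\<lambda>v. cmat A *v v) ^^ k) 0 = 0" for k by (induction k) auto
    ultimately show ?thesis by simp
  next
    case False
    then obtain \<mu> where \<mu>: "poly p \<mu> = 0" by (metis fundamental_theorem_of_algebra constant_degree)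
    then obtain q where q: "p = [:-\<mu>, 1:] * q" by (metis dvdE poly_eq_0_iff_dvd)
    have q0: "q \<noteq> 0" using q less.prems(1) by auto
    have deg: "degree q < degree p" unfolding q using q0 by (simp add: degree_mult_eq del: mult_pCons_left)
    define u where "u = cmat A *v v - \<mu> *s v"
    have u: "u = cpact A [:-\<mu>, 1:] v" by (simp add: u_def C.pact_linear)
    have "cpact A q u = cpact A p v" unfolding u q by (metis C.pact_mult mult.commute)
    then have "cpact A q u = 0" using less.prems(2) by simp
    moreover have "\<And>\<nu>. poly q \<nu> = 0 \<Longrightarrow> cmod \<nu> < r" using less.prems(3) by (simp add: q)
    ultimately have lim: "(\<lambda>k. norm (((\<lambda>v. cmat A *v v) ^^ k) u) / r ^ k) \<longlonglongrightarrow> 0"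
      using less.hyps[OF deg q0 _ _ less.prems(4)] by blast
    have rr: "r > 0" using less.prems(4) .
    let ?T = "\<lambda>k v. ((\<lambda>v. cmat A *v v) ^^ k) v"
    have rec: "?T (Suc k) v = \<mu> *s ?T k v + ?T k u" for k
    proof -
      have "?T (Suc k) v = ?T k (cmat A *v v)" by (simp only: funpow_Suc_right o_apply)
      also have "cmat A *v v = \<mu> *s v + u" by (simp add: u_def)
      finally show ?thesis by (simp only: C.funpow_vadd C.funpow_vscale)
    qed
    show ?thesis
    proof (rule recursive_contraction_tendsto_0[where \<theta> = "cmod \<mu> / r" and b = "\<lambda>k. (norm (?T k u) / r ^ k) / r"])
      fix k
      have "norm (?T (Suc k) v) \<le> cmod \<mu> * norm (?T k v) + norm (?T k u)"
        unfolding rec using norm_triangle_ineq[of "\<mu> *s ?T k v" "?T k u"] by (simp only: norm_vscale)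
      then have "norm (?T (Suc k) v) / r ^ Suc k \<le> (cmod \<mu> * norm (?T k v) + norm (?T k u)) / r ^ Suc k"
        using rr by (intro divide_right_mono) auto
      then show "norm (?T (Suc k) v) / r ^ Suc k \<le> cmod \<mu> / r * (norm (?T k v) / r ^ k) + norm (?T k u) / r ^ k / r"
        by (simp add: add_divide_distrib mult.commute)
      show "0 \<le> norm (?T k v) / r ^ k" using rr by simp
    next
      show "(\<lambda>k. (norm (?T k u) / r ^ k) / r) \<longlonglongrightarrow> 0" using tendsto_divide[OF lim tendsto_const, of r] rr by simp
    qed (use rr less.prems(3)[OF \<mu>] in auto)
  qed
qed

section \<open>The local Perron--Frobenius theorem\<close>

text \<open>Bilinear rather than Hermitian, so that a real functional \<open>z\<close> extends
  complex-linearly and can be applied termwise to complex series.\<close>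

definition cdot :: "real^'n \<Rightarrow> complex^'n \<Rightarrow> complex" where
  "cdot z v = (\<Sum>i\<in>UNIV. complex_of_real (z $ i) * v $ i)"

lemma cdot_cvec: "cdot z (cvec x) = complex_of_real (z \<bullet> x)"
  by (simp add: cdot_def cvec_def inner_vec_def)

lemma cdot_add: "cdot z (v + w) = cdot z v + cdot z w"
  by (simp add: cdot_def algebra_simps sum.distrib)

lemma cdot_scale: "cdot z (c *s v) = c * cdot z v"
  by (simp add: cdot_def sum_distrib_left algebra_simps)

lemma cdot_0 [simp]: "cdot z 0 = 0"
  by (simp add: cdot_def)

lemma cdot_sum: "cdot z (sum g S) = (\<Sum>i\<in>S. cdot z (g i))"
  by (induction S rule: infinite_finite_induct) (simp_all add: cdot_add)

lemma tendsto_cdot: "(g \<longlongrightarrow> l) F \<Longrightarrow> ((\<lambda>x. cdot z (g x)) \<longlongrightarrow> cdot z l) F"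
  unfolding cdot_def by (intro tendsto_sum tendsto_mult tendsto_const tendsto_vec_nth)

lemma continuous_on_matrix_vector_mult:
  fixes B :: "complex^'n^'m"
  shows "continuous_on S g \<Longrightarrow> continuous_on S (\<lambda>s. B *v g s)"
  unfolding matrix_vector_mult_def by (intro continuous_intros)

text \<open>\<open>synthetic_div p s\<close> is the quotient (p - p(s)) / (X - s), so for p =
  \<open>cmin A v\<close> this is the numerator of the resolvent at \<open>s\<close>. It is
  continuous also at the poles, which allows limits there.\<close>

lemma continuous_on_cpact_synthetic_div:
  "continuous_on UNIV (\<lambda>s. cpact A (synthetic_div p s) v)"
proof (induction p)
  case 0
  then show ?case by simp
next
  case (pCons a p)
  have *: "cpact A (synthetic_div (pCons a p) s) v = poly p s *s v + cmat A *v cpact A (synthetic_div p s) v" for s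
    by (simp add: C.pact_pCons)
  have "continuous_on UNIV (\<lambda>s. poly p s *s v)"
    unfolding vector_scalar_mult_def by (intro continuous_intros)
  moreover have "continuous_on UNIV (\<lambda>s. cmat A *v cpact A (synthetic_div p s) v)"
    by (rule continuous_on_matrix_vector_mult[OF pCons.IH])
  ultimately show ?case unfolding * by (intro continuous_on_add)
qed

lemma continuous_on_cdot_cpact:
  "continuous_on UNIV (\<lambda>s. cdot z (cpact A (synthetic_div p s) v))"
  unfolding cdot_def by (intro continuous_intros continuous_on_cpact_synthetic_div)

text \<open>A strictly positive functional remains nonnegative after a small perturbation in any
  direction \<open>w\<close>, so only a vector whose real and imaginary parts are both 0 is
  annihilated by all nonnegative functionals.\<close>

lemma dual_functional_nonzero:
  assumes C: "pointed_cone C" and c: "c \<noteq> 0"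
  obtains z where "\<And>x. x \<in> C \<Longrightarrow> 0 \<le> z \<bullet> x" "cdot z c \<noteq> 0"
proof -
  have "\<exists>z. (\<forall>x\<in>C. 0 \<le> z \<bullet> x) \<and> cdot z c \<noteq> 0"
  proof (rule ccontr)
    assume "\<not> ?thesis"
    then have all0: "\<And>z. (\<And>x. x \<in> C \<Longrightarrow> 0 \<le> z \<bullet> x) \<Longrightarrow> cdot z c = 0" by blast
    obtain z0 where z0: "z0 \<in> dual_cone C" "\<And>x. x \<in> C \<Longrightarrow> x \<noteq> 0 \<Longrightarrow> 0 < z0 \<bullet> x"
      using dual_cone_strictly_positive[OF C] by blast
    have z0c: "cdot z0 c = 0" using all0[of z0] z0(1) by (auto simp: dual_cone_def)
    obtain a b where ab: "c = cvec a + \<i> *s cvec b" by (rule cvec_decomp)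
    have zero: "w \<bullet> a = 0 \<and> w \<bullet> b = 0" for w
    proof -
      obtain e where e: "e > 0" "\<And>x. x \<in> C \<Longrightarrow> 0 \<le> (z0 - e *\<^sub>R w) \<bullet> x"
        using interior_dual[OF pointed_coneD(1,2)[OF C] z0(2), where z = w] by metis
      have "cdot (z0 - e *\<^sub>R w) c = 0" using all0[OF e(2)] .
      moreover have "cdot (z0 - e *\<^sub>R w) c = cdot z0 c - complex_of_real e * cdot w c"
        by (simp add: cdot_def algebra_simps sum_subtractf sum_distrib_left)
      ultimately have "cdot w c = 0" using z0c e(1) by simp
      then show ?thesis by (simp add: ab cdot_add cdot_scale cdot_cvec complex_eq_iff)
    qed
    have "a = 0" "b = 0" using zero[of a] zero[of b] by simp_all
    then show False using c ab by simp
  qed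
  then show ?thesis using that by blast
qed

context
  fixes A :: "real^'n^'n" and x :: "real^'n" and M X
  defines "M \<equiv> cmin A (cvec x)" and "X \<equiv> cvec x"
begin

text \<open>The division M = (t - s) Q + M(s) in the indeterminate t, with Q the synthetic quotient,
  is applied to \<open>X\<close>, which \<open>M\<close> kills. The result is a solution of the
  resolvent equation even if \<open>s\<close> is an eigenvalue of \<open>A\<close> that does not
  occur in \<open>x\<close>.\<close>

lemma resolvent_eq:
  fixes s :: complex
  assumes "poly M s \<noteq> 0"
  defines "Y \<equiv> (1 / poly M s) *s cpact A (synthetic_div M s) X"
  shows "s *s Y - cmat A *v Y = X"
proof -
  let ?W = "cpact A (synthetic_div M s) X"
  have "cpact A ([:-s, 1:] * synthetic_div M s + [:poly M s:]) X = 0"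
    using synthetic_div_correct'[of s M] cmin_kill[of A "cvec x"] by (simp only: M_def X_def)
  then have "cmat A *v ?W - s *s ?W + poly M s *s X = 0"
    by (simp add: C.pact_add C.pact_mult C.pact_linear C.pact_pCons[of _ _ 0] del: mult_pCons_left)
  then have "s *s ?W - cmat A *v ?W = poly M s *s X" by (simp add: algebra_simps)
  then have "(1 / poly M s) *s (s *s ?W - cmat A *v ?W) = X"
    using assms(1) by (simp add: vector_smult_assoc)
  then show ?thesis
    by (simp add: Y_def vec.scale_right_diff_distrib vector_smult_assoc mult.commute vec.scale)
qed

text \<open>Neumann series for the resolvent. Its remainder s^(-K) A^K Y tends to 0 because
  \<open>Y\<close> is killed by the same polynomial as \<open>x\<close>; thus convergence depends on
  the local radius of \<open>x\<close> only.\<close>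

lemma resolvent_sums:
  fixes s :: complex
  assumes roots: "\<And>\<mu>. poly M \<mu> = 0 \<Longrightarrow> cmod \<mu> < cmod s" and s: "s \<noteq> 0"
  shows "(\<lambda>k. (1/s) ^ Suc k * complex_of_real (z \<bullet> ((\<lambda>y. A *v y) ^^ k) x))
    sums (cdot z (cpact A (synthetic_div M s) X) / poly M s)"
proof -
  define Y where "Y = (1 / poly M s) *s cpact A (synthetic_div M s) X"
  let ?T = "\<lambda>k v. ((\<lambda>v. cmat A *v v) ^^ k) v"
  have Ms: "poly M s \<noteq> 0" using roots by blast
  have Y: "X = s *s Y - cmat A *v Y" using resolvent_eq[OF Ms] by (simp add: Y_def)
  have XT: "?T k X = s *s ?T k Y - ?T (Suc k) Y" for k
  proof -
    have "?T k X = ?T k (s *s Y + (-1) *s (cmat A *v Y))" using Y by simp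
    also have "\<dots> = s *s ?T k Y + (-1) *s ?T k (cmat A *v Y)"
      by (simp only: C.funpow_vadd C.funpow_vscale)
    finally show ?thesis by (simp add: funpow_swap1)
  qed
  have part: "(\<Sum>k<K. (1/s) ^ Suc k *s ?T k X) = Y - (1/s) ^ K *s ?T K Y" for K
  proof (induction K)
    case (Suc K)
    have "(1/s) ^ Suc K *s ?T K X = (1/s) ^ Suc K *s (s *s ?T K Y) - (1/s) ^ Suc K *s ?T (Suc K) Y"
      unfolding XT by (simp only: vec.scale_right_diff_distrib)
    also have "(1/s) ^ Suc K *s (s *s ?T K Y) = (1/s) ^ K *s ?T K Y"
      using s by (simp add: vector_smult_assoc)
    finally show ?case using Suc by (simp only: sum.lessThan_Suc) simp
  qed simp
  have "cpact A M Y = 0"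
    unfolding Y_def C.pact_vscale using cmin_kill[of A "cvec x"]
    by (metis C.pact_commute C.pact_v0 M_def X_def vector_smult_rzero)
  moreover have "M \<noteq> 0" using cmin(1)[of A "cvec x"] by (simp add: M_def)
  ultimately have "(\<lambda>k. norm (?T k Y) / cmod s ^ k) \<longlonglongrightarrow> 0"
    using cpact_power_tendsto_0[of M A Y "cmod s"] roots s by simp
  moreover have "norm ((1/s) ^ K *s ?T K Y) = norm (?T K Y) / cmod s ^ K" for K
    by (simp add: norm_vscale norm_power norm_divide power_divide)
  ultimately have "(\<lambda>K. norm ((1/s) ^ K *s ?T K Y)) \<longlonglongrightarrow> 0" by presburger
  then have "(\<lambda>K. (1/s) ^ K *s ?T K Y) \<longlonglongrightarrow> 0" by (rule tendsto_norm_zero_cancel)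
  then have "(\<lambda>K. Y - (1/s) ^ K *s ?T K Y) \<longlonglongrightarrow> Y - 0" by (intro tendsto_diff tendsto_const)
  then have "(\<lambda>K. cdot z (\<Sum>k<K. (1/s) ^ Suc k *s ?T k X)) \<longlonglongrightarrow> cdot z Y"
    unfolding part by (intro tendsto_cdot) simp
  moreover have "cdot z (\<Sum>k<K. (1/s) ^ Suc k *s ?T k X)
    = (\<Sum>k<K. (1/s) ^ Suc k * complex_of_real (z \<bullet> ((\<lambda>y. A *v y) ^^ k) x))" for K
    unfolding cdot_sum cdot_scale X_def cvec_funpow cdot_cvec by (rule refl)
  moreover have "cdot z Y = cdot z (cpact A (synthetic_div M s) X) / poly M s"
    by (simp add: Y_def cdot_scale)
  ultimately show ?thesis unfolding sums_def by simp
qed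

text \<open>With nonnegative coefficients the series is real and nonnegative at |s| and, by the
  triangle inequality, dominates there its values on the whole circle.\<close>

lemma resolvent_positive:
  fixes s :: complex
  assumes roots: "\<And>\<mu>. poly M \<mu> = 0 \<Longrightarrow> cmod \<mu> < cmod s" and s: "s \<noteq> 0"
    and pos: "\<And>k. 0 \<le> z \<bullet> ((\<lambda>y. A *v y) ^^ k) x"
  defines "f \<equiv> \<lambda>s. cdot z (cpact A (synthetic_div M s) X) / poly M s"
  shows "Im (f (of_real (cmod s))) = 0" "0 \<le> Re (f (of_real (cmod s)))"
    "cmod (f s) \<le> cmod (f (of_real (cmod s)))"
proof -
  let ?t = "complex_of_real (cmod s)"
  define a where "a k = z \<bullet> ((\<lambda>y. A *v y) ^^ k) x" for k
  define b where "b k = (1 / cmod s) ^ Suc k * a k" for k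
  have b0: "0 \<le> b k" for k using pos by (simp add: b_def a_def)
  have "(\<lambda>k. (1/?t) ^ Suc k * complex_of_real (a k)) sums f ?t"
    unfolding f_def a_def by (rule resolvent_sums) (use roots s in auto)
  moreover have "(1/?t) ^ Suc k * complex_of_real (a k) = complex_of_real (b k)" for k
    by (simp add: b_def)
  ultimately have t: "(\<lambda>k. complex_of_real (b k)) sums f ?t" by simp
  have re: "b sums Re (f ?t)" using sums_Re[OF t] by simp
  have im: "(\<lambda>k. 0) sums Im (f ?t)" using sums_Im[OF t] by simp
  show Im0: "Im (f ?t) = 0" using sums_unique2[OF im sums_zero] .
  show Re0: "0 \<le> Re (f ?t)" using sums_le[OF b0 sums_zero re] .
  have S: "(\<lambda>k. (1/s) ^ Suc k * complex_of_real (a k)) sums f s"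
    unfolding f_def a_def by (rule resolvent_sums) (use roots s in auto)
  have nb: "norm ((1/s) ^ Suc k * complex_of_real (a k)) = b k" for k
    using pos[of k] by (simp add: b_def a_def norm_mult norm_power norm_divide)
  have "summable (\<lambda>k. norm ((1/s) ^ Suc k * complex_of_real (a k)))"
    unfolding nb using re by (rule sums_summable)
  then have "norm (\<Sum>k. (1/s) ^ Suc k * complex_of_real (a k)) \<le> (\<Sum>k. norm ((1/s) ^ Suc k * complex_of_real (a k)))"
    by (rule summable_norm)
  then have "cmod (f s) \<le> Re (f ?t)" unfolding nb using sums_unique[OF S] sums_unique[OF re] by simp
  also have "\<dots> \<le> cmod (f ?t)" by (rule complex_Re_le_cmod)
  finally show "cmod (f s) \<le> cmod (f ?t)" .
qed

text \<open>The quotient has smaller degree than \<open>M\<close>, so \<open>M\<close> cannot divide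
  it.\<close>

lemma cpact_synthetic_div_nonzero:
  assumes "x \<noteq> 0"
  shows "cpact A (synthetic_div M \<mu>) X \<noteq> 0"
proof
  assume "cpact A (synthetic_div M \<mu>) X = 0"
  then have d: "M dvd synthetic_div M \<mu>" unfolding M_def X_def by (simp only: cmin(2))
  have deg: "0 < degree M" using cmin_degree[of "cvec x" A] assms by (simp add: M_def)
  then have "synthetic_div M \<mu> \<noteq> 0" by (simp add: synthetic_div_eq_0_iff)
  from dvd_imp_degree_le[OF d this] show False using deg by (simp add: degree_synthetic_div)
qed

lemma right_limit_le:
  fixes G H :: "real \<Rightarrow> real"
  assumes "continuous_on UNIV G" "continuous_on UNIV H" "\<And>t. r < t \<Longrightarrow> G t \<le> H t"
  shows "G r \<le> H r"
proof -
  have "isCont H r" "isCont G r" using assms(1,2) by (simp_all add: continuous_on_eq_continuous_at)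
  then have "(H \<longlongrightarrow> H r) (at_right r)" "(G \<longlongrightarrow> G r) (at_right r)"
    unfolding isCont_def by (auto intro: tendsto_within_subset)
  moreover have "\<forall>\<^sub>F t in at_right r. G t \<le> H t"
    using eventually_at_right_less[of r] by eventually_elim (use assms(3) in blast)
  ultimately show ?thesis by (rule tendsto_le[OF trivial_limit_at_right_real])
qed

text \<open>Pringsheim-type comparison: along the ray through \<mu>, the bound |f(s)| <= f(|s|)
  limits the pole at \<mu> by the pole at its modulus. Multiplicity 0 at the modulus is not excluded
  beforehand, so this also shows that the modulus is a root.\<close>

lemma peripheral_order_le:
  fixes \<mu> :: complex
  assumes C: "pointed_cone C" "\<And>y. y \<in> C \<Longrightarrow> A *v y \<in> C" and x: "x \<in> C" "x \<noteq> 0"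
    and \<mu>: "poly M \<mu> = 0" "\<And>\<nu>. poly M \<nu> = 0 \<Longrightarrow> cmod \<nu> \<le> cmod \<mu>"
  shows "order \<mu> M \<le> order (complex_of_real (cmod \<mu>)) M"
proof (cases "\<mu> = 0")
  case False
  define r where "r = cmod \<mu>"
  have r: "r > 0" using False by (simp add: r_def)
  define \<theta> where "\<theta> = \<mu> / of_real r"
  have th: "cmod \<theta> = 1" "of_real r * \<theta> = \<mu>" using r by (simp_all add: \<theta>_def norm_divide r_def)
  have M0: "M \<noteq> 0" using cmin(1)[of A "cvec x"] by (simp add: M_def)
  define j k where "j = order (of_real r) M" and "k = order \<mu> M"
  obtain q1 where q1: "M = [:-\<mu>, 1:] ^ k * q1" "poly q1 \<mu> \<noteq> 0" using order_split[OF M0] k_def by metis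
  obtain q2 where q2: "M = [:-of_real r, 1:] ^ j * q2" "poly q2 (of_real r) \<noteq> 0" using order_split[OF M0] j_def by metis
  define n where "n z s = cdot z (cpact A (synthetic_div M s) X)" for z s
  \<comment> \<open>The numerator must not vanish at \<mu>, otherwise this functional would not see
    the full pole.\<close>
  obtain z where z: "\<And>y. y \<in> C \<Longrightarrow> 0 \<le> z \<bullet> y" "n z \<mu> \<noteq> 0"
    using dual_functional_nonzero[OF C(1) cpact_synthetic_div_nonzero[OF x(2), of \<mu>]] unfolding n_def by metis
  have orb: "((\<lambda>y. A *v y) ^^ i) x \<in> C" for i by (induction i) (use C(2) x in auto)
  have ncont: "continuous_on UNIV (n z)" unfolding n_def by (rule continuous_on_cdot_cpact)
  have "\<not> j < k"
  proof
    assume jk: "j < k"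
    \<comment> \<open>The two sides of the cross-multiplied inequality with the factor |t - r|^j
      removed. As \<open>j < k\<close>, the right side keeps a positive power of |t - r| and
      vanishes at t = r, whereas the left side does not.\<close>
    define G H where "G t = cmod (n z (of_real t * \<theta>)) * cmod (poly q2 (of_real t))"
      and "H t = cmod (n z (of_real t)) * \<bar>t - r\<bar> ^ (k - j) * cmod (poly q1 (of_real t * \<theta>))" for t
    have "G r \<le> H r"
    proof (rule right_limit_le[of G H r])
      show "continuous_on UNIV G" unfolding G_def
        by (intro continuous_intros continuous_on_compose2[OF ncont]) auto
      show "continuous_on UNIV H" unfolding H_def
        by (intro continuous_intros continuous_on_compose2[OF ncont]) auto
      fix t assume t: "r < t"
      define s where "s = of_real t * \<theta>"
      have cs: "cmod s = t" using t r th by (simp add: s_def norm_mult)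
      have rts: "\<And>\<nu>. poly M \<nu> = 0 \<Longrightarrow> cmod \<nu> < cmod s" using \<mu>(2) t cs by (force simp: r_def)
      have s0: "s \<noteq> 0" using cs t r by auto
      have Ms: "poly M s \<noteq> 0" using rts[of s] by blast
      have Mt: "poly M (of_real t) \<noteq> 0" using rts[of "of_real t"] t r cs by auto
      have "cmod (n z s / poly M s) \<le> cmod (n z (of_real t) / poly M (of_real t))"
        using resolvent_positive(3)[OF rts s0 z(1)[OF orb]] unfolding cs n_def by blast
      then have le: "cmod (n z s) * cmod (poly M (of_real t)) \<le> cmod (n z (of_real t)) * cmod (poly M s)"
        using Ms Mt by (simp add: norm_divide field_simps)
      have "cmod (complex_of_real t - complex_of_real r) = \<bar>t - r\<bar>"
        by (metis norm_of_real of_real_diff)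
      then have 1: "cmod (poly M (of_real t)) = \<bar>t - r\<bar> ^ j * cmod (poly q2 (of_real t))"
        by (subst q2(1)) (simp add: norm_mult norm_power)
      have "s - \<mu> = of_real (t - r) * \<theta>" using th(2) by (simp add: s_def algebra_simps)
      then have "cmod (s - \<mu>) = \<bar>t - r\<bar>" using th(1) by (simp add: norm_mult del: of_real_diff)
      then have 2: "cmod (poly M s) = \<bar>t - r\<bar> ^ k * cmod (poly q1 s)"
        by (subst q1(1)) (simp add: norm_mult norm_power)
      have k: "\<bar>t - r\<bar> ^ k = \<bar>t - r\<bar> ^ j * \<bar>t - r\<bar> ^ (k - j)" using jk by (simp flip: power_add)
      have p: "0 < \<bar>t - r\<bar> ^ j" using t by simp
      have "\<bar>t - r\<bar> ^ j * G t \<le> \<bar>t - r\<bar> ^ j * H t"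
        using le unfolding 1 2 k G_def H_def s_def[symmetric] by (simp only: ac_simps)
      then show "G t \<le> H t" using p by (simp only: mult_le_cancel_left_pos)
    qed
    moreover have "H r = 0" using jk by (simp add: H_def)
    moreover have "0 < G r" using z(2) q2(2) th(2) by (simp add: G_def)
    ultimately show False by simp
  qed
  then show ?thesis by (simp add: j_def k_def r_def)
qed simp

text \<open>The vector \<open>d\<close> is the leading coefficient of the resolvent at
  \<open>r\<close>, the limit of (t - r)^m (t - A)^(-1) x as t decreases to \<open>r\<close>.
  Functionals nonnegative on \<open>C\<close> are nonnegative along this limit, so it lies in the
  closed cone. The multiplicity at \<open>r\<close> is maximal on its circle by
  \<open>peripheral_order_le\<close>.\<close>

lemma perron_frobenius_local:
  assumes C: "pointed_cone C" "\<And>y. y \<in> C \<Longrightarrow> A *v y \<in> C" and x: "x \<in> C" "x \<noteq> 0"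
  obtains r m q d where "0 \<le> r" "1 \<le> m" "spec_pair A x = (r, m)"
    "M = [:- complex_of_real r, 1:] ^ m * q" "poly q (complex_of_real r) \<noteq> 0"
    "\<And>\<nu>. poly M \<nu> = 0 \<Longrightarrow> cmod \<nu> \<le> r"
    "d \<in> C" "d \<noteq> 0" "cvec d = (1 / poly q (of_real r)) *s cpact A ([:-of_real r, 1:] ^ (m - 1) * q) X"
proof -
  have M0: "M \<noteq> 0" using cmin(1)[of A "cvec x"] by (simp add: M_def)
  let ?R = "{\<mu>. poly M \<mu> = 0}"
  have R: "finite ?R" "?R \<noteq> {}" using cmin_roots[of "cvec x" A] x(2) by (simp_all add: M_def)
  define r where "r = Max (cmod ` ?R)"
  have le: "cmod \<nu> \<le> r" if "poly M \<nu> = 0" for \<nu> using R that unfolding r_def by (intro Max_ge) auto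
  have "r \<in> cmod ` ?R" unfolding r_def using R by (intro Max_in) auto
  then obtain \<mu> where \<mu>: "poly M \<mu> = 0" "cmod \<mu> = r" by auto
  have r0: "0 \<le> r" using \<mu>(2) by (metis norm_ge_zero)
  define m where "m = order (of_real r) M"
  have per: "order \<nu> M \<le> m" if "poly M \<nu> = 0" "cmod \<nu> = r" for \<nu>
    using peripheral_order_le[OF C x that(1)] le that(2) unfolding m_def by simp
  have "0 < order \<mu> M" using \<mu>(1) M0 by (simp add: order_gt_0_iff)
  then have m: "1 \<le> m" using per[OF \<mu>] by simp
  then have root: "poly M (of_real r) = 0" using M0 order_gt_0_iff[of M "of_real r"] by (simp add: m_def)
  have nr: "cmod (of_real r) = r" using r0 by simp
  have sp: "spec_pair A x = (r, m)"
    using spec_pair_eq[of x A "of_real r"] x(2) root le per nr unfolding M_def m_def by simp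
  obtain q where q: "M = [:- of_real r, 1:] ^ m * q" "poly q (of_real r) \<noteq> 0" using order_split[OF M0] m_def by metis
  have "[:- of_real r, 1:] * synthetic_div M (of_real r) = [:- of_real r, 1:] * ([:- of_real r, 1:] ^ (m - 1) * q)"
    using synthetic_div_correct'[of "of_real r" M] root q(1) m
    by (metis add.right_neutral le_add_diff_inverse mult.assoc pCons_0_0 power_Suc plus_1_eq_Suc)
  then have syn: "synthetic_div M (of_real r) = [:- of_real r, 1:] ^ (m - 1) * q"
    by (subst (asm) mult_left_cancel) simp_all
  define c where "c = (1 / poly q (of_real r)) *s cpact A (synthetic_div M (of_real r)) X"
  have c0: "c \<noteq> 0" using cpact_synthetic_div_nonzero[OF x(2)] q(2) by (simp add: c_def)
  have orb: "((\<lambda>y. A *v y) ^^ i) x \<in> C" for i by (induction i) (use C(2) x in auto)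
  have pos: "Im (cdot z c) = 0 \<and> 0 \<le> Re (cdot z c)" if z: "\<And>y. y \<in> C \<Longrightarrow> 0 \<le> z \<bullet> y" for z
  proof -
    define n where "n s = cdot z (cpact A (synthetic_div M s) X)" for s
    have ncont: "continuous_on UNIV n" unfolding n_def by (rule continuous_on_cdot_cpact)
    have ev: "Im (n (of_real t) / poly q (of_real t)) = 0 \<and> 0 \<le> Re (n (of_real t) / poly q (of_real t))"
      if t: "r < t" for t
    proof -
      have ct: "cmod (of_real t) = t" using t r0 by simp
      have rts: "\<And>\<nu>. poly M \<nu> = 0 \<Longrightarrow> cmod \<nu> < cmod (of_real t)" using le t r0 by force
      have t0: "complex_of_real t \<noteq> 0" using t r0 by simp
      have f: "Im (n (of_real t) / poly M (of_real t)) = 0" "0 \<le> Re (n (of_real t) / poly M (of_real t))"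
        using resolvent_positive(1,2)[OF rts t0 z[OF orb]] unfolding ct n_def by blast+
      define w where "w = complex_of_real ((t - r) ^ m)"
      have Mw: "poly M (of_real t) = w * poly q (of_real t)"
        unfolding w_def by (subst q(1)) simp
      have "(t - r) ^ m > 0" using t by simp
      then have w: "w \<noteq> 0" unfolding w_def by (simp only: of_real_eq_0_iff)
      then have "w * (n (of_real t) / (w * poly q (of_real t))) = n (of_real t) / poly q (of_real t)" by simp
      then have "n (of_real t) / poly q (of_real t) = of_real ((t - r) ^ m) * (n (of_real t) / poly M (of_real t))"
        unfolding Mw w_def[symmetric] by (rule sym)
      then show ?thesis using f \<open>(t - r) ^ m > 0\<close>
        by (simp add: times_divide_eq_right[symmetric] del: of_real_power times_divide_eq_right)
    qed
    have cz: "cdot z c = n (of_real r) / poly q (of_real r)" by (simp add: c_def n_def cdot_scale)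
    have "((\<lambda>t. n (of_real t) / poly q (of_real t)) \<longlongrightarrow> n (of_real r) / poly q (of_real r)) (at_right r)"
    proof (rule tendsto_divide)
      have "continuous_on UNIV (\<lambda>t. n (complex_of_real t))"
        by (intro continuous_on_compose2[OF ncont] continuous_intros) auto
      then show "((\<lambda>t. n (of_real t)) \<longlongrightarrow> n (of_real r)) (at_right r)"
        by (auto simp: continuous_on_eq_continuous_at isCont_def intro: tendsto_within_subset)
      show "((\<lambda>t. poly q (of_real t)) \<longlongrightarrow> poly q (of_real r)) (at_right r)"
        by (intro tendsto_intros)
    qed (rule q(2))
    then have lim: "((\<lambda>t. n (of_real t) / poly q (of_real t)) \<longlongrightarrow> cdot z c) (at_right r)" unfolding cz .
    have e: "\<forall>\<^sub>F t in at_right r. Im (n (of_real t) / poly q (of_real t)) = 0"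
       "\<forall>\<^sub>F t in at_right r. 0 \<le> Re (n (of_real t) / poly q (of_real t))"
      using eventually_at_right_less[of r] by (eventually_elim, use ev in blast)+
    have "((\<lambda>t. Im (n (of_real t) / poly q (of_real t))) \<longlongrightarrow> 0) (at_right r)"
      using e(1) by (rule tendsto_eventually)
    then have "Im (cdot z c) = 0"
      using tendsto_unique[OF _ tendsto_Im[OF lim]] by (metis trivial_limit_at_right_real)
    moreover have "0 \<le> Re (cdot z c)"
      using tendsto_lowerbound[OF tendsto_Re[OF lim] e(2)] by simp
    ultimately show ?thesis by blast
  qed
  obtain a b where ab: "c = cvec a + \<i> *s cvec b" by (rule cvec_decomp)
  have cz: "Re (cdot z c) = z \<bullet> a" "Im (cdot z c) = z \<bullet> b" for z
    by (simp_all add: ab cdot_add cdot_scale cdot_cvec)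
  \<comment> \<open>Every nonnegative functional is real on \<open>c\<close>, and a nonzero
    imaginary part would be detected by one of them.\<close>
  have "b = 0"
  proof (rule ccontr)
    assume "b \<noteq> 0"
    then obtain z where "\<And>y. y \<in> C \<Longrightarrow> 0 \<le> z \<bullet> y" "cdot z (cvec b) \<noteq> 0"
      using dual_functional_nonzero[OF C(1), of "cvec b"] by auto
    then show False using pos[of z] cz(2)[of z] by (simp add: cdot_cvec)
  qed
  then have ca: "c = cvec a" using ab by simp
  then have "a \<noteq> 0" using c0 by auto
  have "a \<in> C"
  proof (rule ccontr)
    assume "a \<notin> C"
    then obtain z where "\<And>y. y \<in> C \<Longrightarrow> 0 \<le> z \<bullet> y" "z \<bullet> a < 0"
      using separate_closed_cone[OF pointed_coneD(1,2)[OF C(1)]] by metis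
    then show False using pos[of z] cz(1)[of z] by simp
  qed
  show ?thesis
    by (rule that[OF r0 m sp q le \<open>a \<in> C\<close> \<open>a \<noteq> 0\<close>]) (simp_all add: ca[symmetric] c_def syn)
qed

end

section \<open>Spectral pairs of vectors of an invariant cone\<close>

text \<open>Chinese remainder: if (X - \<mu>)^N q kills \<open>A\<close> with \<open>q\<close>
  nonzero at \<mu>, take \<open>e\<close> congruent to 1 modulo (X - \<mu>)^N and divisible by
  \<open>q\<close>.\<close>

lemma spectral_polynomial_exists:
  fixes A :: "real^'n^'n"
  shows "\<exists>e N. 1 \<le> N \<and> (\<forall>x. rpact A ([:-\<mu>, 1:] ^ N * e) x = 0) \<and> [:-\<mu>, 1:] ^ N dvd 1 - e"
proof -
  obtain p where p: "p \<noteq> 0" "\<And>x. rpact A p x = 0" using matrix_annihilator[of A] by blast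
  \<comment> \<open>The additional factor makes \<open>N\<close> positive even if \<mu> is not an
    eigenvalue.\<close>
  define P where "P = [:-\<mu>, 1:] * p"
  have P0: "P \<noteq> 0" using p(1) by (simp add: P_def del: mult_pCons_left)
  define N where "N = order \<mu> P"
  have "poly P \<mu> = 0" by (simp add: P_def)
  then have N: "1 \<le> N" using order_gt_0_iff[OF P0, of \<mu>] by (simp add: N_def)
  obtain q where q: "P = [:-\<mu>, 1:] ^ N * q" "poly q \<mu> \<noteq> 0" using order_split[OF P0] N_def by metis
  obtain a b where ab: "a * [:-\<mu>, 1:] ^ N + b * q = 1" using bezout_linear_power[OF q(2)] by blast
  have "1 - b * q = a * [:-\<mu>, 1:] ^ N" using ab by (simp add: algebra_simps)
  then have "[:-\<mu>, 1:] ^ N dvd 1 - b * q" by (metis dvd_triv_right)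
  moreover have "rpact A ([:-\<mu>, 1:] ^ N * (b * q)) x = 0" for x
  proof -
    have "[:-\<mu>, 1:] ^ N * (b * q) = (b * [:-\<mu>, 1:]) * p"
      using q(1) unfolding P_def by (metis mult.assoc mult.left_commute)
    then show ?thesis by (simp only: R.pact_mult p(2) R.pact_v0)
  qed
  ultimately show ?thesis using N by blast
qed

text \<open>
  Evaluated at \<open>A\<close>, this is the projection onto the generalized eigenspace of \<open>\<mu>\<close>.
\<close>

definition spectral_poly :: "real^'n^'n \<Rightarrow> real \<Rightarrow> real poly" where
  "spectral_poly A \<mu> = (SOME e. \<exists>N\<ge>1. (\<forall>x. rpact A ([:-\<mu>, 1:] ^ N * e) x = 0) \<and> [:-\<mu>, 1:] ^ N dvd 1 - e)"

lemma spectral_poly: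
  obtains N where "1 \<le> N" "\<And>x. rpact A ([:-\<mu>, 1:] ^ N * spectral_poly A \<mu>) x = 0"
    "[:-\<mu>, 1:] ^ N dvd 1 - spectral_poly A \<mu>"
proof -
  have "\<exists>e. \<exists>N\<ge>1. (\<forall>x. rpact A ([:-\<mu>, 1:] ^ N * e) x = 0) \<and> [:-\<mu>, 1:] ^ N dvd 1 - e"
    using spectral_polynomial_exists[of A \<mu>] by blast
  then have "\<exists>N\<ge>1. (\<forall>x. rpact A ([:-\<mu>, 1:] ^ N * spectral_poly A \<mu>) x = 0) \<and> [:-\<mu>, 1:] ^ N dvd 1 - spectral_poly A \<mu>"
    unfolding spectral_poly_def by (rule someI_ex)
  then show ?thesis using that by blast
qed

lemma spectral_poly_at: "poly (spectral_poly A \<mu>) \<mu> = 1"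
proof -
  obtain N where "1 \<le> N" "[:-\<mu>, 1:] ^ N dvd 1 - spectral_poly A \<mu>" using spectral_poly[of A \<mu>] by metis
  then have "poly (1 - spectral_poly A \<mu>) \<mu> = 0"
    by (metis dvd_power dvd_trans less_eq_Suc_le One_nat_def poly_eq_0_iff_dvd)
  then show ?thesis by simp
qed

lemma spectral_poly_idem: "rpact A (spectral_poly A \<mu>) (rpact A (spectral_poly A \<mu>) x) = rpact A (spectral_poly A \<mu>) x"
proof -
  let ?e = "spectral_poly A \<mu>"
  obtain N where N: "\<And>x. rpact A ([:-\<mu>, 1:] ^ N * ?e) x = 0" "[:-\<mu>, 1:] ^ N dvd 1 - ?e" using spectral_poly[of A \<mu>] by metis
  then obtain r where r: "1 - ?e = [:-\<mu>, 1:] ^ N * r" by (metis dvdE)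
  have "(1 - ?e) * ?e = r * ([:-\<mu>, 1:] ^ N * ?e)" unfolding r by (simp only: ac_simps)
  then have "rpact A ((1 - ?e) * ?e) x = rpact A r (rpact A ([:-\<mu>, 1:] ^ N * ?e) x)"
    by (simp only: R.pact_mult)
  then have "rpact A ((1 - ?e) * ?e) x = 0" using N(1) by simp
  then show ?thesis by (simp add: R.pact_mult R.pact_diff)
qed

lemma spectral_poly_gen:
  obtains N where "\<And>x. rpact A ([:-\<mu>, 1:] ^ N) (rpact A (spectral_poly A \<mu>) x) = 0"
proof -
  obtain N where N: "\<And>x. rpact A ([:-\<mu>, 1:] ^ N * spectral_poly A \<mu>) x = 0" using spectral_poly[of A \<mu>] by metis
  show ?thesis by (rule that[of N]) (use N in \<open>simp add: R.pact_mult\<close>)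
qed

text \<open>On vectors of a cone with spectral pair (\<mu>, m) this is the leading coefficient of
  the resolvent at \<mu>; on smaller pairs it vanishes. Using the spectral polynomial instead of the
  cofactor in \<open>cmin\<close> makes it one linear map for all vectors.\<close>

definition peak :: "real^'n^'n \<Rightarrow> real \<Rightarrow> nat \<Rightarrow> real^'n \<Rightarrow> real^'n" where
  "peak A \<mu> m x = rpact A ([:-\<mu>, 1:] ^ (m - 1)) (rpact A (spectral_poly A \<mu>) x)"

lemma peak_add: "peak A \<mu> m (x + y) = peak A \<mu> m x + peak A \<mu> m y"
  by (simp add: peak_def R.pact_vadd)

lemma peak_0 [simp]: "peak A \<mu> m 0 = 0"
  by (simp add: peak_def)

definition cone_map :: "real^'n^'n \<Rightarrow> (real^'n) set \<Rightarrow> bool" where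
  "cone_map A C \<longleftrightarrow> pointed_cone C \<and> (\<forall>y\<in>C. A *v y \<in> C)"

lemma cone_mapD: "cone_map A C \<Longrightarrow> pointed_cone C" "cone_map A C \<Longrightarrow> y \<in> C \<Longrightarrow> A *v y \<in> C"
  by (auto simp: cone_map_def)

text \<open>The cofactor \<open>q\<close> of (X - r)^m in \<open>cmin\<close> divides the spectral
  polynomial, say with quotient \<open>s\<close>. The Perron vector from the resolvent is an
  eigenvector, on which \<open>s\<close> acts as the scalar s(r) = 1 / q(r). This is exactly its
  normalisation, so \<open>peak\<close> reproduces it.\<close>

lemma spec_pair_props:
  assumes A: "cone_map A C" and x: "x \<in> C" "x \<noteq> 0"
  obtains r m where "spec_pair A x = (r, m)" "0 \<le> r" "1 \<le> m"
    "peak A r m x \<in> C" "peak A r m x \<noteq> 0"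
    "rpact A ([:-r, 1:] ^ m) (rpact A (spectral_poly A r) x) = 0"
    "\<And>\<mu>. r < \<mu> \<Longrightarrow> rpact A (spectral_poly A \<mu>) x = 0"
    "\<And>\<nu>. poly (cmin A (cvec x)) \<nu> = 0 \<Longrightarrow> cmod \<nu> \<le> r"
proof -
  let ?M = "cmin A (cvec x)" and ?X = "cvec x"
  obtain r m q d where 0: "0 \<le> r" "1 \<le> m" "spec_pair A x = (r, m)"
    and M: "?M = [:- complex_of_real r, 1:] ^ m * q" "poly q (complex_of_real r) \<noteq> 0"
    and le: "\<And>\<nu>. poly ?M \<nu> = 0 \<Longrightarrow> cmod \<nu> \<le> r"
    and d: "d \<in> C" "d \<noteq> 0" "cvec d = (1 / poly q (of_real r)) *s cpact A ([:-of_real r, 1:] ^ (m - 1) * q) ?X"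
    using perron_frobenius_local[OF cone_mapD(1)[OF A] cone_mapD(2)[OF A] x] by metis
  note lin = cpoly_linear_power
  have big: "\<exists>N. ?M dvd [:- complex_of_real \<mu>, 1:] ^ N * cpoly (spectral_poly A \<mu>)" for \<mu>
  proof -
    obtain N where N: "\<And>x. rpact A ([:-\<mu>, 1:] ^ N * spectral_poly A \<mu>) x = 0" using spectral_poly[of A \<mu>] by metis
    have "cpact A (cpoly ([:-\<mu>, 1:] ^ N * spectral_poly A \<mu>)) ?X = 0" unfolding cpact_cvec N by simp
    then have "?M dvd cpoly ([:-\<mu>, 1:] ^ N * spectral_poly A \<mu>)" by (simp only: cmin(2))
    then show ?thesis by (metis lin cpoly_mult)
  qed
  have zero: "rpact A (spectral_poly A \<mu>) x = 0" if "r < \<mu>" for \<mu>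
  proof -
    have "poly ?M (of_real \<mu>) \<noteq> 0"
    proof
      assume "poly ?M (of_real \<mu>) = 0"
      from le[OF this] show False using that 0(1) by simp
    qed
    then have "?M dvd cpoly (spectral_poly A \<mu>)" using big[of \<mu>] dvd_linear_power_mult_cancel by blast
    then have "cpact A (cpoly (spectral_poly A \<mu>)) ?X = 0" by (simp only: cmin(2))
    then show ?thesis by (simp only: cpact_cvec cvec_eq_0_iff)
  qed
  let ?E = "cpoly (spectral_poly A r)" and ?L = "[:- complex_of_real r, 1:]"
  have "q dvd ?E"
  proof -
    obtain N where "?M dvd ?L ^ N * ?E" using big by blast
    moreover have "q dvd ?M" unfolding M(1) by (rule dvd_triv_right)
    ultimately show ?thesis using dvd_linear_power_mult_cancel[OF _ M(2)] dvd_trans by blast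
  qed
  then obtain s where s: "?E = q * s" by (metis dvdE)
  have "poly ?E (of_real r) = 1" using spectral_poly_at[of A r] by (simp add: poly_cpoly)
  then have "poly q (of_real r) * poly s (of_real r) = 1" using s by simp
  then have sr: "poly s (of_real r) = 1 / poly q (of_real r)" using M(2) by (simp add: field_simps)
  define c where "c = cpact A (?L ^ (m - 1) * q) ?X"
  have "?L * (?L ^ (m - 1) * q) = ?M" using 0(2) M(1)
    by (metis le_add_diff_inverse mult.assoc plus_1_eq_Suc power_Suc)
  then have "cpact A ?L c = 0" unfolding c_def using cmin_kill[of A ?X] by (metis C.pact_mult)
  then have "cmat A *v c = of_real r *s c" by (simp add: C.pact_linear)
  then have "cpact A s c = poly s (of_real r) *s c" by (rule C.pact_eigen)
  then have sc: "cpact A s c = cvec d" using d(3) sr by (simp add: c_def)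
  have "cvec (peak A r m x) = cpact A (?L ^ (m - 1)) (cpact A ?E ?X)"
    unfolding peak_def cpact_cvec[symmetric] lin by (rule refl)
  also have "\<dots> = cpact A s c" unfolding s c_def by (metis C.pact_mult C.pact_commute)
  finally have pk: "peak A r m x = d" using sc by simp
  have "cvec (rpact A ([:-r, 1:] ^ m) (rpact A (spectral_poly A r) x)) = cpact A (?L ^ m) (cpact A ?E ?X)"
    unfolding cpact_cvec[symmetric] lin by (rule refl)
  also have "\<dots> = cpact A s (cpact A ?M ?X)" unfolding s M(1) by (metis C.pact_mult C.pact_commute)
  also have "\<dots> = 0" by (simp add: cmin_kill)
  finally have top: "rpact A ([:-r, 1:] ^ m) (rpact A (spectral_poly A r) x) = 0" by simp
  show ?thesis
    by (rule that[OF 0(3,1,2) _ _ top zero le]) (use pk d(1,2) in simp_all)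
qed

lemma spec_pair_0 [simp]: "spec_pair A 0 = (0, 0)"
  by (simp add: spec_pair_def)

lemma pair_le_refl [simp]: "pair_le s s" by (simp add: pair_le_def)
lemma pair_le_trans: "pair_le s t \<Longrightarrow> pair_le t u \<Longrightarrow> pair_le s u" by (auto simp: pair_le_def)
lemma pair_le_total: "pair_le s t \<or> pair_le t s" by (auto simp: pair_le_def)
lemma pair_le_antisym: "pair_le s t \<Longrightarrow> pair_le t s \<Longrightarrow> s = t" by (auto simp: pair_le_def prod_eq_iff)
lemma not_pair_le_iff: "\<not> pair_le s t \<longleftrightarrow> pair_less t s"
  by (auto simp: pair_le_def pair_less_def prod_eq_iff)

lemma spec_pair_nonneg:
  assumes "cone_map A C" "x \<in> C"
  shows "pair_le (0, 0) (spec_pair A x)"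
proof (cases "x = 0")
  case False
  then show ?thesis using spec_pair_props[OF assms] by (metis fst_conv less_eq_real_def pair_le_def snd_conv zero_le)
qed simp

lemma peak_eq_0:
  assumes A: "cone_map A C" and x: "x \<in> C" and m: "1 \<le> m" and less: "pair_less (spec_pair A x) (r, m)"
  shows "peak A r m x = 0"
proof (cases "x = 0")
  case False
  obtain r' m' where p: "spec_pair A x = (r', m')" "rpact A ([:-r', 1:] ^ m') (rpact A (spectral_poly A r') x) = 0"
    "\<And>\<mu>. r' < \<mu> \<Longrightarrow> rpact A (spectral_poly A \<mu>) x = 0"
    using spec_pair_props[OF A x False] by metis
  have "r' < r \<or> r' = r \<and> m' \<le> m - 1" using less m unfolding p(1) by (auto simp: pair_less_def pair_le_def)
  then show ?thesis
  proof
    assume "r' < r" then show ?thesis using p(3) by (simp add: peak_def)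
  next
    assume "r' = r \<and> m' \<le> m - 1"
    then show ?thesis using p(2) R.pact_linear_power_mono unfolding peak_def by blast
  qed
qed simp

lemma peak_mem:
  assumes A: "cone_map A C" and x: "x \<in> C" and m: "1 \<le> m" and eq: "spec_pair A x = (r, m)"
  shows "peak A r m x \<in> C" "peak A r m x \<noteq> 0"
proof -
  have "x \<noteq> 0" using m eq by auto
  then show "peak A r m x \<in> C" "peak A r m x \<noteq> 0" using spec_pair_props[OF A x] eq by (metis prod.inject)+
qed

lemma peak_le_mem:
  assumes A: "cone_map A C" and x: "x \<in> C" and m: "1 \<le> m" and le: "pair_le (spec_pair A x) (r, m)"
  shows "peak A r m x \<in> C" "rpact A ([:-r, 1:] ^ m) (rpact A (spectral_poly A r) x) = 0"
proof -
  have C0: "0 \<in> C" using pointed_coneD(5) cone_mapD(1)[OF A] by blast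
  show "peak A r m x \<in> C"
  proof (cases "spec_pair A x = (r, m)")
    case False
    then have "pair_less (spec_pair A x) (r, m)" using le by (simp add: pair_less_def)
    then show ?thesis using peak_eq_0[OF A x m] C0 by simp
  qed (use peak_mem[OF A x m] in simp)
  show "rpact A ([:-r, 1:] ^ m) (rpact A (spectral_poly A r) x) = 0"
  proof -
    \<comment> \<open>Raising the order by one turns the weak bound into a strict one, and
      \<open>peak\<close> with \<open>Suc m\<close> involves the m-th power of A - r.\<close>
    have "pair_less (spec_pair A x) (r, Suc m)" using le
      by (cases "spec_pair A x") (auto simp: pair_less_def pair_le_def)
    from peak_eq_0[OF A x _ this] show ?thesis by (simp add: peak_def)
  qed
qed

lemma spec_pair_snd_pos:
  assumes "cone_map A C" "x \<in> C" "x \<noteq> 0"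
  shows "1 \<le> snd (spec_pair A x)" "0 \<le> fst (spec_pair A x)"
  using spec_pair_props[OF assms] by (metis fst_conv snd_conv)+

text \<open>Peaks add, and in a pointed cone a sum of members is 0 only if each of them is; so
  leading terms can neither cancel nor be created by addition.\<close>

lemma spec_pair_add_le:
  assumes A: "cone_map A C" and x: "x \<in> C" and y: "y \<in> C" and le: "pair_le (spec_pair A x) (spec_pair A y)"
  shows "spec_pair A (x + y) = spec_pair A y"
proof (cases "y = 0")
  case True
  have "spec_pair A x = (0, 0)" using le True spec_pair_nonneg[OF A x] pair_le_antisym by fastforce
  then have "x = 0" using spec_pair_snd_pos[OF A x] by fastforce
  then show ?thesis using True by simp
next
  case False
  have C: "pointed_cone C" using cone_mapD(1)[OF A] .
  have xy: "x + y \<in> C" using pointed_coneD(7)[OF C x y] .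
  obtain r m where rm: "spec_pair A y = (r, m)" "1 \<le> m" using spec_pair_snd_pos[OF A y False] by (metis prod.collapse)
  have "pair_le (spec_pair A (x + y)) (r, m)"
  proof (rule ccontr)
    assume n: "\<not> ?thesis"
    then have "x + y \<noteq> 0" using rm spec_pair_nonneg[OF A y] by auto
    then obtain r' m' where rm': "spec_pair A (x + y) = (r', m')" "1 \<le> m'" using spec_pair_snd_pos[OF A xy] by (metis prod.collapse)
    have "pair_less (spec_pair A y) (r', m')" using n rm rm' by (simp add: not_pair_le_iff)
    moreover have "pair_less (spec_pair A x) (r', m')"
      using n rm rm' le by (metis not_pair_le_iff pair_le_trans)
    ultimately have "peak A r' m' (x + y) = 0" using peak_eq_0[OF A _ rm'(2)] x y by (simp add: peak_add)
    then show False using peak_mem(2)[OF A xy rm'(2,1)] by simp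
  qed
  moreover have "\<not> pair_less (spec_pair A (x + y)) (r, m)"
  proof
    assume l: "pair_less (spec_pair A (x + y)) (r, m)"
    have "peak A r m x + peak A r m y = 0" using peak_eq_0[OF A xy rm(2) l] by (simp add: peak_add)
    moreover have px: "peak A r m x \<in> C" using peak_le_mem(1)[OF A x rm(2)] le rm(1) by simp
    moreover have py: "peak A r m y \<in> C" "peak A r m y \<noteq> 0" using peak_mem[OF A y rm(2,1)] by simp_all
    ultimately have "- peak A r m y \<in> C" by (metis add_eq_0_iff2)
    then show False using pointed_coneD(3)[OF C py(1)] py(2) by simp
  qed
  ultimately show ?thesis using rm(1) by (simp add: pair_less_def)
qed

lemma spec_pair_le_add:
  assumes A: "cone_map A C" and x: "x \<in> C" and y: "y \<in> C"
  shows "pair_le (spec_pair A x) (spec_pair A (x + y))"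
  using spec_pair_add_le[OF A x y] spec_pair_add_le[OF A y x] pair_le_total[of "spec_pair A x" "spec_pair A y"]
  by (metis add.commute pair_le_refl)

lemma spec_pair_add_cases:
  assumes A: "cone_map A C" and x: "x \<in> C" and y: "y \<in> C"
  shows "spec_pair A (x + y) = spec_pair A x \<or> spec_pair A (x + y) = spec_pair A y"
  using spec_pair_add_le[OF A x y] spec_pair_add_le[OF A y x] pair_le_total[of "spec_pair A x" "spec_pair A y"]
  by (metis add.commute)

text \<open>Obtained from monotonicity under addition: factors at most 1 by splitting
  \<open>y\<close>, powers of 2 by doubling, and any factor by comparison with a power of 2.\<close>

lemma spec_pair_scale:
  assumes A: "cone_map A C" and x: "x \<in> C" and c: "0 < c"
  shows "spec_pair A (c *\<^sub>R x) = spec_pair A x"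
proof -
  have "pair_le (spec_pair A (a *\<^sub>R y)) (spec_pair A y)" if y: "y \<in> C" and a: "0 < a" "a \<le> 1" for a y
  proof -
    have m: "a *\<^sub>R y \<in> C" "(1 - a) *\<^sub>R y \<in> C" using a y pointed_coneD(8)[OF cone_mapD(1)[OF A]] by auto
    have "a *\<^sub>R y + (1 - a) *\<^sub>R y = y" by (simp flip: scaleR_add_left)
    then show ?thesis using spec_pair_le_add[OF A m] by simp
  qed
  note small = this
  have dbl: "spec_pair A (y + y) = spec_pair A y" if "y \<in> C" for y
    using spec_pair_add_le[OF A that that] by simp
  have pow: "spec_pair A ((2 ^ k) *\<^sub>R y) = spec_pair A y" if y: "y \<in> C" for y and k :: nat
  proof (induction k)
    case (Suc k)
    have "(2 ^ k) *\<^sub>R y \<in> C" using y pointed_coneD(8)[OF cone_mapD(1)[OF A]] by simp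
    from dbl[OF this] show ?case using Suc by (simp flip: scaleR_add_left)
  qed simp
  have le: "pair_le (spec_pair A (a *\<^sub>R y)) (spec_pair A y)" if y: "y \<in> C" and a: "0 < a" for a y
  proof -
    obtain k where k: "a < 2 ^ k" using real_arch_pow[of 2 a] by auto
    have "(2 ^ k) *\<^sub>R y \<in> C" using y pointed_coneD(8)[OF cone_mapD(1)[OF A]] by simp
    from small[OF this, of "a / 2 ^ k"] show ?thesis using a k pow[OF y] by simp
  qed
  have "c *\<^sub>R x \<in> C" using c x pointed_coneD(8)[OF cone_mapD(1)[OF A]] by simp
  from le[OF this, of "1 / c"] have "pair_le (spec_pair A x) (spec_pair A (c *\<^sub>R x))" using c by simp
  then show ?thesis using le[OF x c] pair_le_antisym by blast
qed

lemma spec_pair_mono: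
  assumes A: "cone_map A C" and x: "x \<in> C" and y: "y \<in> C" and e: "0 < e" "x - e *\<^sub>R y \<in> C"
  shows "pair_le (spec_pair A y) (spec_pair A x)"
proof -
  have ey: "e *\<^sub>R y \<in> C" using e(1) y pointed_coneD(8)[OF cone_mapD(1)[OF A]] by simp
  have "pair_le (spec_pair A (e *\<^sub>R y)) (spec_pair A (e *\<^sub>R y + (x - e *\<^sub>R y)))" by (rule spec_pair_le_add[OF A ey e(2)])
  then show ?thesis using spec_pair_scale[OF A y e(1)] by simp
qed

lemma spec_pair_rel_interior_max:
  assumes A: "cone_map A C" and F: "cone_face F C" and x: "x \<in> rel_interior F" and y: "y \<in> F"
  shows "pair_le (spec_pair A y) (spec_pair A x)"
proof -
  obtain e where e: "e > 0" "x - e *\<^sub>R y \<in> F" using x y rel_interior_cone_iff[OF cone_faceD(1)[OF F]] by blast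
  then show ?thesis using spec_pair_mono[OF A _ _ e(1)] x y rel_interior_subset cone_faceD(2)[OF F] by blast
qed

text \<open>Two relative interior points each dominate a positive multiple of the other, so their
  pairs agree and the definite description is meaningful.\<close>

lemma face_spec_pair_eq:
  assumes A: "cone_map A C" and F: "cone_face F C" and x: "x \<in> rel_interior F"
  shows "face_spec_pair A F = spec_pair A x"
  unfolding face_spec_pair_def
proof (rule the_equality)
  show "\<forall>y\<in>rel_interior F. spec_pair A y = spec_pair A x"
  proof
    fix y assume y: "y \<in> rel_interior F"
    have "x \<in> F" "y \<in> F" using x y rel_interior_subset by blast+
    then show "spec_pair A y = spec_pair A x"
      using spec_pair_rel_interior_max[OF A F x] spec_pair_rel_interior_max[OF A F y] pair_le_antisym by blast
  qed
next
  fix s assume "\<forall>y\<in>rel_interior F. spec_pair A y = s"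
  then show "s = spec_pair A x" using x by simp
qed

lemma face_spec_pair_ge:
  assumes A: "cone_map A C" and F: "cone_face F C" and y: "y \<in> F"
  shows "pair_le (spec_pair A y) (face_spec_pair A F)"
proof -
  obtain x where x: "x \<in> rel_interior F" using rel_interior_face_nonempty[OF F] by blast
  then show ?thesis using face_spec_pair_eq[OF A F x] spec_pair_rel_interior_max[OF A F x y] by simp
qed

section \<open>Semi-distinguished faces and the adjoint cone\<close>

lemma orthogonal_projection_exists:
  fixes S :: "'a::euclidean_space set"
  assumes S: "Real_Vector_Spaces.subspace S"
  obtains p where "linear p" "\<And>x. p x \<in> S" "\<And>x. x \<in> S \<Longrightarrow> p x = x" "\<And>x y. p x \<bullet> y = x \<bullet> p y"
proof -
  obtain B where B: "B \<subseteq> S" "pairwise Linear_Algebra.orthogonal B" "\<And>x. x \<in> B \<Longrightarrow> norm x = 1"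
    "independent B" "card B = dim S" "span B = S"
    using orthonormal_basis_subspace[OF S] by metis
  have fin: "finite B" using B(4) independent_bound by blast
  define p where "p x = (\<Sum>b\<in>B. (x \<bullet> b) *\<^sub>R b)" for x
  have lin: "linear p" unfolding p_def
    by (intro linearI) (simp_all add: inner_add_left scaleR_add_left sum.distrib scaleR_sum_right)
  have inS: "p x \<in> S" for x unfolding p_def
    using B(1) S by (intro subspace_sum subspace_scale) auto
  have sym: "p x \<bullet> y = x \<bullet> p y" for x y
    unfolding p_def by (simp add: inner_sum_left inner_sum_right inner_commute mult.commute)
  have pb: "p b = b" if b: "b \<in> B" for b
  proof -
    have "(b \<bullet> c) *\<^sub>R c = (if c = b then b else 0)" if c: "c \<in> B" for c
    proof (cases "c = b")
      case True
      have "b \<bullet> b = 1" using B(3)[OF b] by (simp add: dot_square_norm)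
      then show ?thesis using True by simp
    next
      case False
      then have "Linear_Algebra.orthogonal b c" using B(2) b c by (auto simp: pairwise_def)
      then show ?thesis using False by (simp add: Linear_Algebra.orthogonal_def)
    qed
    then have "p b = (\<Sum>c\<in>B. if c = b then b else 0)" unfolding p_def by (intro sum.cong) auto
    then show ?thesis using fin b by (simp add: sum.delta')
  qed
  have "p x = x" if "x \<in> S" for x
  proof -
    have "x \<in> span B" using that B(6) by simp
    then show ?thesis by (rule linear_eq_on[OF lin linear_id[unfolded id_def]]) (use pb in simp)
  qed
  then show ?thesis using that[OF lin inS _ sym] by blast
qed

text \<open>Transpose followed by the orthogonal projection onto \<open>S\<close>, since the
  transpose alone may leave \<open>S\<close>; pairing with vectors of \<open>S\<close> does not
  notice the projection.\<close>

lemma restricted_adjoint_exists: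
  fixes A :: "real^'n^'n"
  assumes S: "Real_Vector_Spaces.subspace S" and inv: "\<And>x. x \<in> S \<Longrightarrow> A *v x \<in> S"
  obtains B :: "real^'n^'n" where "\<And>y. B *v y \<in> S" "\<And>x y. x \<in> S \<Longrightarrow> (B *v y) \<bullet> x = y \<bullet> (A *v x)"
proof -
  obtain p where p: "linear p" "\<And>x. p x \<in> S" "\<And>x. x \<in> S \<Longrightarrow> p x = x" "\<And>x y. p x \<bullet> y = x \<bullet> p y"
    using orthogonal_projection_exists[OF S] by metis
  define B where "B = matrix (\<lambda>y. p (transpose A *v y))"
  have "linear (\<lambda>y. p (transpose A *v y))"
    using linear_compose[OF matrix_vector_mul_linear p(1), of "transpose A"] by (simp add: o_def)
  then have B: "B *v y = p (transpose A *v y)" for y unfolding B_def by (simp add: matrix_works)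
  have "(B *v y) \<bullet> x = y \<bullet> (A *v x)" if "x \<in> S" for x y
    using p(3)[OF that] by (simp add: B p(4) dot_lmul_matrix transpose_matrix_vector)
  then show ?thesis using that[of B] B p(2) by metis
qed

lemma rpact_subspace:
  assumes "Real_Vector_Spaces.subspace S" "\<And>x. x \<in> S \<Longrightarrow> A *v x \<in> S" "x \<in> S"
  shows "rpact A p x \<in> S"
  by (induction p) (use assms in \<open>auto simp: R.pact_pCons intro: subspace_add subspace_scale subspace_0\<close>)

lemma rpact_adjoint:
  assumes "Real_Vector_Spaces.subspace S" "\<And>x. x \<in> S \<Longrightarrow> A *v x \<in> S"
    "\<And>x y. x \<in> S \<Longrightarrow> (B *v y) \<bullet> x = y \<bullet> (A *v x)" "x \<in> S"
  shows "rpact B p y \<bullet> x = y \<bullet> rpact A p x"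
proof (induction p arbitrary: y)
  case (pCons a p)
  have "rpact B (pCons a p) y \<bullet> x = a * (y \<bullet> x) + rpact B p (B *v y) \<bullet> x"
    by (simp add: R.pact_pCons R.pact_f[symmetric] inner_add_left)
  also have "rpact B p (B *v y) \<bullet> x = y \<bullet> (A *v rpact A p x)"
    using pCons.IH assms(3)[OF rpact_subspace[OF assms(1,2,4)]] by simp
  finally show ?case by (simp add: R.pact_pCons inner_add_right)
qed simp

lemma gen_eigvec_of_real:
  assumes "x \<noteq> 0" "rpact A ([:-\<mu>, 1:] ^ k) x = 0"
  shows "gen_eigvec A (complex_of_real \<mu>) (cvec x)"
proof -
  have "cpact A ([:- complex_of_real \<mu>, 1:] ^ k) (cvec x) = 0"
    unfolding cpoly_linear_power[symmetric] cpact_cvec assms(2) by simp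
  then show ?thesis using assms(1) by (auto simp: gen_eigvec_iff C.gen_comp_def)
qed

text \<open>The component \<open>?u\<close> of \<open>x\<close> at its local radius is nonzero
  because its peak is. It lies in the generalized eigenspaces of both \<mu> and the radius, which
  forces them to agree; then x - \<open>?u\<close> lies in that space and is killed by the spectral
  polynomial, so it is 0.\<close>

lemma gen_eigvec_in_cone:
  assumes A: "cone_map A C" and x: "x \<in> C" and g: "gen_eigvec A \<mu> (cvec x)"
  shows "\<mu> = complex_of_real (fst (spec_pair A x))" "rpact A (spectral_poly A (fst (spec_pair A x))) x = x"
proof -
  have x0: "x \<noteq> 0" using g by (simp add: gen_eigvec_iff)
  obtain r m where rm: "spec_pair A x = (r, m)" "peak A r m x \<noteq> 0" using spec_pair_props[OF A x x0] by metis
  let ?u = "rpact A (spectral_poly A r) x"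
  obtain N where N: "rpact A ([:-r, 1:] ^ N) ?u = 0" using spectral_poly_gen[of A r] by metis
  have u0: "?u \<noteq> 0" using rm(2) by (auto simp: peak_def)
  from gen_eigvec_of_real[OF this N] have gr: "cgen A (of_real r) (cvec ?u)" by (simp add: gen_eigvec_iff)
  have gm: "cgen A \<mu> (cvec ?u)" unfolding cpact_cvec[symmetric] using g by (simp add: gen_eigvec_iff C.gen_comp_pact)
  have eq: "\<mu> = of_real r"
  proof (rule ccontr)
    assume ne: "\<mu> \<noteq> of_real r"
    obtain k where k: "cpact A ([:- of_real r, 1:] ^ k) (cvec ?u) = 0" using gr by (auto simp: C.gen_comp_def)
    have "cvec ?u = 0" by (rule C.gen_comp_coprime[OF gm k]) (use ne in simp)
    then show False using u0 by simp
  qed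
  then show "\<mu> = complex_of_real (fst (spec_pair A x))" using rm(1) by simp
  let ?w = "x - ?u"
  have w: "rpact A (spectral_poly A r) ?w = 0" using spectral_poly_idem[of A r x] by (simp add: R.pact_vdiff)
  have "cgen A \<mu> (cvec ?w)"
    using C.gen_comp_add[of A \<mu> "cvec x" "- cvec ?u"] C.gen_comp_minus[OF gm] g by (simp add: cvec_diff gen_eigvec_iff)
  moreover have "cpact A (cpoly (spectral_poly A r)) (cvec ?w) = 0" unfolding cpact_cvec w by simp
  moreover have "poly (cpoly (spectral_poly A r)) \<mu> \<noteq> 0" unfolding eq poly_cpoly spectral_poly_at by simp
  ultimately have "cvec ?w = 0" by (rule C.gen_comp_coprime)
  then show "rpact A (spectral_poly A (fst (spec_pair A x))) x = x" using rm(1) by simp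
qed

lemma peak_eigen:
  assumes "1 \<le> m" "rpact A ([:-r, 1:] ^ m) (rpact A (spectral_poly A r) x) = 0"
  shows "A *v peak A r m x = r *\<^sub>R peak A r m x"
proof -
  have "[:-r, 1:] * [:-r, 1:] ^ (m - 1) = [:-r, 1:] ^ m" using assms(1) by (cases m) (simp_all del: mult_pCons_left)
  then have "rpact A [:-r, 1:] (peak A r m x) = 0" using assms(2) unfolding peak_def by (metis R.pact_mult)
  then show ?thesis by (simp add: R.pact_linear)
qed

text \<open>The peak of \<open>x\<close> is an eigenvector and a polynomial in \<open>A\<close>
  applied to \<open>x\<close>, so it inherits all annihilators of \<open>x\<close>. This inheritance
  serves to exclude eigenvalues whose component in \<open>x\<close> vanishes.\<close>

lemma eigenvector_in_cone:
  assumes "cone_map A C" "x \<in> C" "x \<noteq> 0"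
  obtains r y where "y \<in> C" "y \<noteq> 0" "A *v y = r *\<^sub>R y" "r = fst (spec_pair A x)"
    "\<And>p. rpact A p x = 0 \<Longrightarrow> rpact A p y = 0"
proof -
  obtain r m where rm: "spec_pair A x = (r, m)" "1 \<le> m" "peak A r m x \<in> C" "peak A r m x \<noteq> 0"
    "rpact A ([:-r, 1:] ^ m) (rpact A (spectral_poly A r) x) = 0"
    using spec_pair_props[OF assms] by metis
  have "rpact A p (peak A r m x) = 0" if "rpact A p x = 0" for p
    unfolding peak_def using that by (metis R.pact_commute R.pact_v0)
  then show ?thesis using that[OF rm(3,4) peak_eigen[OF rm(2,5)]] rm(1) by simp
qed

lemma spec_pair_eigen:
  assumes "x \<noteq> 0" "A *v x = r *\<^sub>R x" "0 \<le> r"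
  shows "fst (spec_pair A x) = r"
proof -
  have "rpact A ([:-r, 1:] ^ 1) x = 0" using assms(2) by (simp add: R.pact_linear)
  from spec_pair_gen_eigvec[OF gen_eigvec_of_real[OF assms(1) this]] show ?thesis using assms(3) by simp
qed

lemma cone_map_span:
  assumes "cone_map A F" "x \<in> span F"
  shows "A *v x \<in> span F"
proof -
  obtain a b where "a \<in> F" "b \<in> F" "x = a - b"
    using span_convex_cone[OF pointed_coneD(1)[OF cone_mapD(1)[OF assms(1)]] assms(2)] by metis
  then show ?thesis using cone_mapD(2)[OF assms(1)]
    by (auto simp: matrix_vector_mult_diff_distrib intro: span_diff span_base)
qed

text \<open>\<open>B\<close> is the adjoint of \<open>A\<close> restricted to the span of
  \<open>F\<close>, with values in that span; thus it preserves the dual cone of \<open>F\<close> as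
  \<open>A\<close> preserves \<open>F\<close>.\<close>

locale adjoint_cone =
  fixes A B :: "real^'n^'n" and F
  assumes A: "cone_map A F"
    and B_span: "\<And>y. B *v y \<in> span F"
    and B_inner: "\<And>x y. x \<in> span F \<Longrightarrow> (B *v y) \<bullet> x = y \<bullet> (A *v x)"
begin

lemma F: "pointed_cone F"
  using cone_mapD(1)[OF A] .

lemma A_span: "x \<in> span F \<Longrightarrow> A *v x \<in> span F"
  using cone_map_span[OF A] .

lemma inner_rpact: "x \<in> span F \<Longrightarrow> rpact B p y \<bullet> x = y \<bullet> rpact A p x"
  using rpact_adjoint[OF subspace_span A_span B_inner] .

lemma rpact_A_span: "x \<in> span F \<Longrightarrow> rpact A p x \<in> span F"
  using rpact_subspace[OF subspace_span A_span] .

lemma rpact_B_span: "y \<in> span F \<Longrightarrow> rpact B p y \<in> span F"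
  using rpact_subspace[OF subspace_span B_span] .

lemma span_eq_0I: "y \<in> span F \<Longrightarrow> (\<And>x. x \<in> span F \<Longrightarrow> y \<bullet> x = 0) \<Longrightarrow> y = 0"
  by (metis inner_eq_zero_iff)

lemma span_eq_0I': "y \<in> span F \<Longrightarrow> (\<And>x. x \<in> F \<Longrightarrow> y \<bullet> x = 0) \<Longrightarrow> y = 0"
proof (rule span_eq_0I)
  fix x assume y: "\<And>x. x \<in> F \<Longrightarrow> y \<bullet> x = 0" and "x \<in> span F"
  then obtain a b where "a \<in> F" "b \<in> F" "x = a - b" using span_convex_cone pointed_coneD(1)[OF F] by metis
  then show "y \<bullet> x = 0" using y by (simp add: inner_diff_right)
qed

lemma dual_span: "z \<in> dual_cone F \<Longrightarrow> z \<in> span F"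
  by (simp add: dual_cone_def)

lemma dual_nonneg: "z \<in> dual_cone F \<Longrightarrow> x \<in> F \<Longrightarrow> 0 \<le> z \<bullet> x"
  by (simp add: dual_cone_def)

lemma B_dual: "cone_map B (dual_cone F)"
  unfolding cone_map_def
proof (intro conjI ballI dual_cone_pointed)
  fix y assume y: "y \<in> dual_cone F"
  have "0 \<le> (B *v y) \<bullet> x" if "x \<in> F" for x
    using dual_nonneg[OF y cone_mapD(2)[OF A that]] B_inner[OF span_base[OF that]] by simp
  then show "B *v y \<in> dual_cone F" using B_span by (simp add: dual_cone_def)
qed

lemma eigen_inner:
  assumes "B *v u = r *\<^sub>R u" "x \<in> span F"
  shows "u \<bullet> rpact A p x = poly p r * (u \<bullet> x)"
  using inner_rpact[OF assms(2), of p u] R.pact_eigen[OF assms(1), of p] by simp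

text \<open>If the radius \<open>r\<close> of \<open>z\<close> exceeded that of \<open>x\<close>,
  the spectral polynomial for \<open>r\<close> would kill \<open>x\<close>, while it acts as 1 on an
  eigenvector \<open>u\<close> for \<open>r\<close> in the dual; then \<open>u\<close> would vanish
  at \<open>x\<close>, impossible at a relative interior point.\<close>

lemma dual_radius_le:
  assumes x: "x \<in> rel_interior F" "x \<noteq> 0" and z: "z \<in> dual_cone F" "z \<noteq> 0"
  shows "fst (spec_pair B z) \<le> fst (spec_pair A x)"
proof (rule ccontr)
  assume n: "\<not> ?thesis"
  have xF: "x \<in> F" using x(1) rel_interior_subset by blast
  obtain r u where u: "u \<in> dual_cone F" "u \<noteq> 0" "B *v u = r *\<^sub>R u" "r = fst (spec_pair B z)"
    using eigenvector_in_cone[OF B_dual z] by metis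
  obtain l where "fst (spec_pair A x) = l" "\<And>\<mu>. l < \<mu> \<Longrightarrow> rpact A (spectral_poly A \<mu>) x = 0"
    using spec_pair_props[OF A xF x(2)] by (metis fst_conv)
  then have "rpact A (spectral_poly A r) x = 0" using n u(4) by simp
  then have "u \<bullet> x = 0" using eigen_inner[OF u(3) span_base[OF xF], of "spectral_poly A r"] spectral_poly_at[of A r] by simp
  then show False using dual_cone_rel_interior_pos[OF pointed_coneD(1)[OF F] u(1,2) x(1)] by simp
qed

text \<open>Composing \<open>w\<close> with \<open>peak\<close> keeps it nonnegative, because peaks
  of \<open>F\<close> stay in \<open>F\<close>; nonzero peaks are eigenvectors for \<open>r\<close>,
  so the composite satisfies the eigenvalue equation of the adjoint.\<close>

lemma dual_eigenvector:
  assumes w: "w \<in> dual_cone F" and le: "\<And>x. x \<in> F \<Longrightarrow> pair_le (spec_pair A x) (r, m)" and m: "1 \<le> m"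
  obtains v where "v \<in> dual_cone F" "B *v v = r *\<^sub>R v" "\<And>x. x \<in> span F \<Longrightarrow> v \<bullet> x = w \<bullet> peak A r m x"
proof -
  define v where "v = rpact B (spectral_poly A r) (rpact B ([:-r, 1:] ^ (m - 1)) w)"
  have vS: "v \<in> span F" unfolding v_def using dual_span[OF w] by (intro rpact_B_span)
  have vx: "v \<bullet> x = w \<bullet> peak A r m x" if "x \<in> span F" for x
    unfolding v_def peak_def using that by (simp add: inner_rpact rpact_A_span)
  have vD: "v \<in> dual_cone F"
    using vS vx dual_nonneg[OF w peak_le_mem(1)[OF A _ m le]] by (auto simp: dual_cone_def span_base)
  have "B *v v - r *\<^sub>R v = 0"
  proof (rule span_eq_0I')
    show "B *v v - r *\<^sub>R v \<in> span F" using vS B_span by (intro span_diff span_scale)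
    fix x assume x: "x \<in> F"
    have "peak A r m (A *v x) = A *v peak A r m x" unfolding peak_def by (simp only: R.pact_f)
    also have "\<dots> = r *\<^sub>R peak A r m x" by (rule peak_eigen[OF m peak_le_mem(2)[OF A x m le[OF x]]])
    finally have "v \<bullet> (A *v x) = r * (v \<bullet> x)"
      using vx[OF A_span[OF span_base[OF x]]] vx[OF span_base[OF x]] by simp
    then show "(B *v v - r *\<^sub>R v) \<bullet> x = 0" using B_inner[OF span_base[OF x]] by (simp add: inner_diff_left)
  qed
  then show ?thesis using that[OF vD _ vx] by simp
qed

lemma dominating_imp_gen_eigvec:
  assumes F0: "F \<noteq> {0}" and E: "dual_exposing F"
    and dom: "\<And>G. cone_face G F \<Longrightarrow> (\<And>x. x \<in> G \<Longrightarrow> A *v x \<in> G) \<Longrightarrow> G \<noteq> F \<Longrightarrow>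
      pair_less (face_spec_pair A G) (face_spec_pair A F)"
  shows "\<exists>x\<in>rel_interior F. \<exists>\<mu>. gen_eigvec A \<mu> (cvec x)"
proof (rule ccontr)
  assume no: "\<not> ?thesis"
  note cF = pointed_coneD(1)[OF F] and fF = cone_face_refl[OF pointed_coneD(1)[OF F]]
  obtain x0 where x0: "x0 \<in> rel_interior F" using rel_interior_face_nonempty[OF fF] by blast
  then have x0F: "x0 \<in> F" using rel_interior_subset by blast
  have x0n: "x0 \<noteq> 0" by (rule rel_interior_pointed_cone_nonzero[OF F F0 x0])
  obtain l m where lm: "spec_pair A x0 = (l, m)" "0 \<le> l" "1 \<le> m" "peak A l m x0 \<in> F" "peak A l m x0 \<noteq> 0"
    using spec_pair_props[OF A x0F x0n] by metis
  have spF: "face_spec_pair A F = (l, m)" using face_spec_pair_eq[OF A fF x0] lm(1) by simp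
  have leF: "pair_le (spec_pair A x) (l, m)" if "x \<in> F" for x
    using face_spec_pair_ge[OF A fF that] spF by simp
  let ?e = "spectral_poly A l"
  \<comment> \<open>If 0 were in \<open>T\<close>, some relative interior point would have no
    component outside \<open>l\<close> and so be a generalized eigenvector.\<close>
  define T where "T = (\<lambda>x. rpact A (1 - ?e) x) ` rel_interior F"
  have T0: "0 \<notin> T"
  proof
    assume "0 \<in> T"
    then obtain x where x: "x \<in> rel_interior F" "rpact A (1 - ?e) x = 0" by (auto simp: T_def)
    then have "rpact A ?e x = x" by (simp add: R.pact_diff)
    moreover obtain N where "rpact A ([:-l, 1:] ^ N) (rpact A ?e x) = 0" using spectral_poly_gen[of A l] by metis
    ultimately have N: "rpact A ([:-l, 1:] ^ N) x = 0" by simp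
    have "x \<noteq> 0"
    proof
      assume "x = 0"
      have "spec_pair A x = (l, m)" using face_spec_pair_eq[OF A fF x(1)] spF by simp
      then show False using \<open>x = 0\<close> lm(3) by simp
    qed
    then show False using no x(1) gen_eigvec_of_real[OF _ N] by blast
  qed
  have linT: "linear (\<lambda>x. rpact A (1 - ?e) x)"
    by (intro linearI) (simp_all add: R.pact_vadd R.pact_vscale)
  have "convex T" unfolding T_def using linT convex_rel_interior[OF pointed_coneD(4)[OF F]] by (rule convex_linear_image)
  moreover have "T \<noteq> {}" using x0 by (auto simp: T_def)
  \<comment> \<open>Taking the normal in the span of \<open>T\<close> is what later makes
    \<open>w\<close> nonzero: otherwise \<open>a\<close> would be orthogonal to a span containing
    it.\<close>
  ultimately obtain a where a: "a \<in> span T" "a \<noteq> 0" "\<forall>t\<in>T. 0 \<le> a \<bullet> t"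
    using separating_hyperplane_set_0_inspan[of T] T0 by metis
  have TS: "T \<subseteq> span F" unfolding T_def using rel_interior_subset rpact_A_span span_base by blast
  have aS: "a \<in> span F" using a(1) span_minimal[OF TS subspace_span] by blast
  define w where "w = rpact B (1 - ?e) a"
  have wS: "w \<in> span F" unfolding w_def using aS by (rule rpact_B_span)
  have wx: "w \<bullet> x = a \<bullet> rpact A (1 - ?e) x" if "x \<in> span F" for x unfolding w_def using that by (rule inner_rpact)
  have wri: "0 \<le> w \<bullet> x" if "x \<in> rel_interior F" for x
  proof -
    have "x \<in> span F" using that rel_interior_subset span_base by blast
    then show ?thesis using wx a(3) that by (auto simp: T_def)
  qed
  \<comment> \<open>Nonnegativity of \<open>w\<close> is known on the relative interior only; from
    \<open>x0\<close> one may move arbitrarily far in a direction of \<open>F\<close> without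
    leaving it.\<close>
  have ri_add: "x0 + s *\<^sub>R y \<in> rel_interior F" if y: "y \<in> F" and s: "0 \<le> s" for s y
  proof -
    have sy: "s *\<^sub>R y \<in> F" using y s pointed_coneD(8)[OF F] by simp
    have "\<exists>e>0. x0 + s *\<^sub>R y - e *\<^sub>R u \<in> F" if u: "u \<in> F" for u
    proof -
      obtain e where e: "e > 0" "x0 - e *\<^sub>R u \<in> F" using x0 rel_interior_cone_iff[OF cF] u by blast
      have "(x0 - e *\<^sub>R u) + s *\<^sub>R y \<in> F" using pointed_coneD(7)[OF F e(2) sy] .
      then show ?thesis using e(1) by (intro exI[of _ e]) (simp add: algebra_simps)
    qed
    then show ?thesis unfolding rel_interior_cone_iff[OF cF] using pointed_coneD(7)[OF F x0F sy] by blast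
  qed
  have "0 \<le> w \<bullet> y" if y: "y \<in> F" for y
  proof (rule ccontr)
    assume n: "\<not> 0 \<le> w \<bullet> y"
    \<comment> \<open>This distance brings the value of \<open>w\<close> down to -1.\<close>
    define s where "s = (w \<bullet> x0 + 1) / - (w \<bullet> y)"
    have "0 \<le> w \<bullet> x0" using wri[OF x0] .
    then have "0 \<le> s" using n by (simp add: s_def divide_nonneg_neg)
    then have "0 \<le> w \<bullet> (x0 + s *\<^sub>R y)" using wri[OF ri_add[OF y]] by blast
    also have "\<dots> = w \<bullet> x0 + s * (w \<bullet> y)" by (simp add: inner_add_right)
    also have "s * (w \<bullet> y) = - (w \<bullet> x0 + 1)" using n by (simp add: s_def)
    finally show False by simp
  qed
  then have wD: "w \<in> dual_cone F" using wS by (simp add: dual_cone_def)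
  have w0: "w \<noteq> 0"
  proof
    assume "w = 0"
    then have "a \<bullet> t = 0" if "t \<in> T" for t
    proof -
      obtain x where x: "x \<in> rel_interior F" "t = rpact A (1 - ?e) x" using \<open>t \<in> T\<close> by (auto simp: T_def)
      have "x \<in> span F" using x(1) rel_interior_subset span_base by blast
      from wx[OF this] show ?thesis using x(2) \<open>w = 0\<close> by simp
    qed
    then have "span T \<subseteq> {t. a \<bullet> t = 0}" by (intro span_minimal subspace_hyperplane) auto
    then show False using a(1,2) by auto
  qed
  have ew: "rpact B ?e w = 0"
  proof (rule span_eq_0I)
    show "rpact B ?e w \<in> span F" using wS by (rule rpact_B_span)
    fix x assume x: "x \<in> span F"
    have "rpact B ?e w \<bullet> x = a \<bullet> rpact A (1 - ?e) (rpact A ?e x)"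
      using inner_rpact[OF x] wx[OF rpact_A_span[OF x]] by simp
    also have "rpact A (1 - ?e) (rpact A ?e x) = 0" by (simp add: R.pact_diff spectral_poly_idem)
    finally show "rpact B ?e w \<bullet> x = 0" by simp
  qed
  have rad_le: "fst (spec_pair B z) \<le> l" if "z \<in> dual_cone F" "z \<noteq> 0" for z
    using dual_radius_le[OF x0 x0n that] lm(1) by simp
  \<comment> \<open>The vector 0 is listed separately because its radius is 0, which is not below
    \<open>l\<close> when \<open>l\<close> is 0.\<close>
  define H where "H = {z \<in> dual_cone F. z = 0 \<or> fst (spec_pair B z) < l}"
  have H_D: "H \<subseteq> dual_cone F" by (auto simp: H_def)
  note DP = dual_cone_pointed[of F]
  have sp0: "z = 0" if "z \<in> dual_cone F" "pair_le (spec_pair B z) (0, 0)" for z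
    using spec_pair_snd_pos[OF B_dual that(1)] that(2) by (force simp: pair_le_def)
  have Hface: "cone_face H (dual_cone F)"
    unfolding cone_face_def convex_cone_iff
  proof (intro conjI ballI impI allI H_D)
    show "0 \<in> H" using pointed_coneD(5)[OF DP] by (simp add: H_def)
    fix y z assume yz: "y \<in> H" "z \<in> H"
    then have D: "y \<in> dual_cone F" "z \<in> dual_cone F" using H_D by blast+
    show "y + z \<in> H"
    proof (cases "y = 0 \<or> z = 0")
      case False
      then show ?thesis using yz pointed_coneD(7)[OF DP D] spec_pair_add_cases[OF B_dual D] by (auto simp: H_def)
    qed (use yz in auto)
  next
    fix y and c :: real assume y: "y \<in> H" and c: "0 \<le> c"
    then have D: "y \<in> dual_cone F" using H_D by blast
    show "c *\<^sub>R y \<in> H"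
    proof (cases "c = 0")
      case True then show ?thesis using pointed_coneD(5)[OF DP] by (simp add: H_def)
    next
      case False
      then show ?thesis using y c spec_pair_scale[OF B_dual D, of c] pointed_coneD(8)[OF DP c D] by (auto simp: H_def)
    qed
  next
    have key: "y \<in> H" if D: "y \<in> dual_cone F" "z \<in> dual_cone F" and s: "y + z \<in> H" for y z
    proof -
      have le: "pair_le (spec_pair B y) (spec_pair B (y + z))" by (rule spec_pair_le_add[OF B_dual D])
      show ?thesis
      proof (cases "y + z = 0")
        case True then show ?thesis using le sp0[OF D(1)] D(1) by (simp add: H_def)
      next
        case False
        then have "fst (spec_pair B (y + z)) < l" using s by (simp add: H_def)
        then show ?thesis using le D(1) by (auto simp: H_def pair_le_def)
      qed
    qed
    fix y z assume "y \<in> dual_cone F" "z \<in> dual_cone F" "y + z \<in> H"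
    then show "y \<in> H" "z \<in> H" using key[of y z] key[of z y] by (simp_all add: add.commute)
  qed
  have HB: "B *v z \<in> H" if z: "z \<in> H" for z
  proof (cases "B *v z = 0")
    case False
    have D: "z \<in> dual_cone F" "B *v z \<in> dual_cone F" using z H_D cone_mapD(2)[OF B_dual] by blast+
    have z0: "z \<noteq> 0" using False by auto
    obtain r where r: "fst (spec_pair B z) = r" "\<And>\<mu>. r < \<mu> \<Longrightarrow> rpact B (spectral_poly B \<mu>) z = 0"
      using spec_pair_props[OF B_dual D(1) z0] by (metis fst_conv)
    obtain r' m' where r': "spec_pair B (B *v z) = (r', m')" "peak B r' m' (B *v z) \<noteq> 0"
      using spec_pair_props[OF B_dual D(2) False] by metis
    have "\<not> r < r'"
    proof
      assume "r < r'"
      then have "peak B r' m' (B *v z) = 0" using r(2) by (simp add: peak_def R.pact_f)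
      then show False using r'(2) by simp
    qed
    then show ?thesis using z z0 r(1) r'(1) D(2) by (simp add: H_def)
  qed (use pointed_coneD(5)[OF DP] in \<open>simp add: H_def\<close>)
  \<comment> \<open>\<open>w\<close> has no component for \<open>l\<close>: an eigenvector for
    \<open>l\<close> derived from \<open>w\<close> would be killed by the spectral polynomial, whose
    value at \<open>l\<close> is 1.\<close>
  have wH: "w \<in> H"
  proof -
    have "fst (spec_pair B w) \<noteq> l"
    proof
      assume eq: "fst (spec_pair B w) = l"
      obtain u where u: "u \<noteq> 0" "B *v u = l *\<^sub>R u" "\<And>p. rpact B p w = 0 \<Longrightarrow> rpact B p u = 0"
        using eigenvector_in_cone[OF B_dual wD w0] eq by metis
      have "rpact B ?e u = poly ?e l *\<^sub>R u" by (rule R.pact_eigen[OF u(2)])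
      then show False using u(1) u(3)[OF ew] by (simp add: spectral_poly_at)
    qed
    then show ?thesis using rad_le[OF wD w0] wD by (simp add: H_def)
  qed
  obtain h where h: "h \<in> rel_interior H" using rel_interior_face_nonempty[OF Hface] by blast
  then have hH: "h \<in> H" using rel_interior_subset by blast
  then have hD: "h \<in> dual_cone F" using H_D by blast
  have h_orth: "y \<bullet> x = 0" if y: "y \<in> H" and x: "x \<in> F" "h \<bullet> x = 0" for x y
  proof -
    obtain e where e: "e > 0" "h - e *\<^sub>R y \<in> H" using h y rel_interior_cone_iff[OF cone_faceD(1)[OF Hface]] by blast
    have "0 \<le> (h - e *\<^sub>R y) \<bullet> x" "0 \<le> y \<bullet> x" using e(2) y H_D x(1) dual_nonneg by blast+
    then have "e * (y \<bullet> x) \<le> 0" using x(2) by (simp add: inner_diff_left)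
    then show ?thesis using e(1) \<open>0 \<le> y \<bullet> x\<close> by (simp add: mult_le_0_iff)
  qed
  define G where "G = {x \<in> F. h \<bullet> x = 0}"
  have Gface: "cone_face G F" unfolding G_def using cF dual_nonneg[OF hD] by (rule cone_face_Int_orthogonal)
  have GA: "A *v x \<in> G" if "x \<in> G" for x
  proof -
    have x: "x \<in> F" "h \<bullet> x = 0" using that by (auto simp: G_def)
    have "(B *v h) \<bullet> x = 0" using h_orth[OF HB[OF hH] x] .
    then show ?thesis using B_inner[OF span_base[OF x(1)]] cone_mapD(2)[OF A x(1)] by (simp add: G_def)
  qed
  have "G \<noteq> F"
  proof
    assume "G = F"
    then have "w \<bullet> x0 = 0" using h_orth[OF wH x0F] x0F by (auto simp: G_def)
    then show False using dual_cone_rel_interior_pos[OF cF wD w0 x0] by simp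
  qed
  then have less: "pair_less (face_spec_pair A G) (l, m)" using dom[OF Gface GA] spF by simp
  obtain g where g: "g \<in> rel_interior G" using rel_interior_face_nonempty[OF Gface] by blast
  then have gF: "g \<in> F" using rel_interior_subset by (auto simp: G_def)
  have "pair_less (spec_pair A g) (l, m)" using less face_spec_pair_eq[OF A Gface g] by simp
  then have pg: "peak A l m g = 0" using peak_eq_0[OF A gF lm(3)] by blast
  \<comment> \<open>A strictly positive functional guarantees that the eigenvector \<open>v\<close>
    built from it is nonzero.\<close>
  obtain w1 where w1: "w1 \<in> dual_cone F" "\<And>x. x \<in> F \<Longrightarrow> x \<noteq> 0 \<Longrightarrow> 0 < w1 \<bullet> x"
    using dual_cone_strictly_positive[OF F] by blast
  obtain v where v: "v \<in> dual_cone F" "B *v v = l *\<^sub>R v" "\<And>x. x \<in> span F \<Longrightarrow> v \<bullet> x = w1 \<bullet> peak A l m x"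
    using dual_eigenvector[OF w1(1) leF lm(3)] by metis
  have "v \<bullet> x0 > 0" using v(3)[OF span_base[OF x0F]] w1(2)[OF lm(4,5)] by simp
  then have v0: "v \<noteq> 0" by auto
  have "v \<bullet> g = 0" using v(3)[OF span_base[OF gF]] pg by simp
  then have "v \<bullet> y = 0" if "y \<in> G" for y
    using nonneg_zero_on_rel_interior[OF cone_faceD(1)[OF Gface] _ g _ that] dual_nonneg[OF v(1)] cone_faceD(2)[OF Gface]
    by blast
  then have "\<forall>x\<in>F. h \<bullet> x = 0 \<longrightarrow> v \<bullet> x = 0" by (auto simp: G_def)
  \<comment> \<open>Exposedness enters here: \<open>v\<close> vanishes on \<open>F\<close> wherever
    \<open>h\<close> does, so it belongs to the face generated by \<open>h\<close>, which lies in
    \<open>H\<close>.\<close>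
  then obtain e where "e > 0" "h - e *\<^sub>R v \<in> dual_cone F" using E hD v(1) unfolding dual_exposing_def by blast
  then have "v \<in> H" using cone_face_diffD[OF Hface dual_cone_convex_cone hH] v(1) by blast
  then show False using v0 spec_pair_eigen[OF v0 v(2) lm(2)] by (simp add: H_def)
qed

text \<open>Join-irreducibility enters as \<open>irr\<close>, phrased with faces of \<open>F\<close>
  only; it turns a proper invariant face of maximal dimension into one that contains all the
  others.\<close>

lemma gen_eigvec_irreducible_imp_dominating:
  assumes E: "dual_exposing F" and x: "x \<in> rel_interior F" "gen_eigvec A \<mu> (cvec x)"
    and irr: "\<And>G H. cone_face G F \<Longrightarrow> (\<And>x. x \<in> G \<Longrightarrow> A *v x \<in> G) \<Longrightarrow> G \<noteq> F \<Longrightarrow>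
        cone_face H F \<Longrightarrow> (\<And>x. x \<in> H \<Longrightarrow> A *v x \<in> H) \<Longrightarrow> H \<noteq> F \<Longrightarrow>
        \<exists>J. cone_face J F \<and> (\<forall>x\<in>J. A *v x \<in> J) \<and> J \<noteq> F \<and> G \<subseteq> J \<and> H \<subseteq> J"
    and G: "cone_face G F" "\<And>x. x \<in> G \<Longrightarrow> A *v x \<in> G" "G \<noteq> F"
  shows "pair_less (face_spec_pair A G) (face_spec_pair A F)"
proof -
  note cF = pointed_coneD(1)[OF F] and fF = cone_face_refl[OF pointed_coneD(1)[OF F]]
  have xF: "x \<in> F" using x(1) rel_interior_subset by blast
  have x0: "x \<noteq> 0" using x(2) by (simp add: gen_eigvec_iff)
  obtain l m where lm: "spec_pair A x = (l, m)" "0 \<le> l" "1 \<le> m" using spec_pair_props[OF A xF x0] by metis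
  have spF: "face_spec_pair A F = (l, m)" using face_spec_pair_eq[OF A fF x(1)] lm(1) by simp
  have leF: "pair_le (spec_pair A x) (l, m)" if "x \<in> F" for x
    using face_spec_pair_ge[OF A fF that] spF by simp
  obtain N where N: "rpact A ([:-l, 1:] ^ N) x = 0"
    using spectral_poly_gen[of A l] gen_eigvec_in_cone(2)[OF A xF x(2)] lm(1) by (metis fst_conv)
  obtain g where g: "g \<in> rel_interior G" using rel_interior_face_nonempty[OF G(1)] by blast
  then have gG: "g \<in> G" using rel_interior_subset by blast
  then have gF: "g \<in> F" using cone_faceD(2)[OF G(1)] by blast
  have spG: "face_spec_pair A G = spec_pair A g" using face_spec_pair_eq[OF A G(1) g] .
  have "spec_pair A g \<noteq> (l, m)"
  proof
    assume sg: "spec_pair A g = (l, m)"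
    let ?I = "\<lambda>J. cone_face J F \<and> (\<forall>x\<in>J. A *v x \<in> J) \<and> J \<noteq> F"
    have "?I G" using G by blast
    moreover have "\<forall>J. ?I J \<longrightarrow> dim J < Suc (DIM(real^'n))" using dim_subset_UNIV le_imp_less_Suc by blast
    ultimately have "\<exists>M. ?I M \<and> (\<forall>J. ?I J \<longrightarrow> dim J \<le> dim M)"
      using ex_has_greatest_nat[of ?I G dim "Suc (DIM(real^'n))"] by blast
    then obtain M where M: "cone_face M F" "\<And>x. x \<in> M \<Longrightarrow> A *v x \<in> M" "M \<noteq> F" and Mmax: "\<And>J. ?I J \<Longrightarrow> dim J \<le> dim M"
      by blast
    have sub: "J \<subseteq> M" if J: "cone_face J F" "\<And>x. x \<in> J \<Longrightarrow> A *v x \<in> J" "J \<noteq> F" for J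
    proof -
      obtain L where L: "cone_face L F" "\<forall>x\<in>L. A *v x \<in> L" "L \<noteq> F" "M \<subseteq> L" "J \<subseteq> L"
        using irr[OF M J] by blast
      have "M = L" using cone_face_dim_eq[OF M(1) L(1,4) Mmax] L(1,2,3) by blast
      then show ?thesis using L(5) by simp
    qed
    have GM: "G \<subseteq> M" using sub[OF G] .
    obtain z1 where z1: "z1 \<in> dual_cone F" "z1 \<noteq> 0" "\<And>y. y \<in> M \<Longrightarrow> z1 \<bullet> y = 0"
      using proper_face_supporting[OF F M(1,3)] by metis
    obtain y0 where y0: "y0 \<in> rel_interior M" using rel_interior_face_nonempty[OF M(1)] by blast
    then have y0M: "y0 \<in> M" using rel_interior_subset by blast
    \<comment> \<open>The dual face of \<open>M\<close>; by
      \<open>nonneg_zero_on_rel_interior\<close>, vanishing at the single point \<open>y0\<close> is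
      vanishing on \<open>M\<close>.\<close>
    define D where "D = {z \<in> dual_cone F. y0 \<bullet> z = 0}"
    have D_orth: "z \<bullet> y = 0" if z: "z \<in> D" and y: "y \<in> M" for z y
    proof (rule nonneg_zero_on_rel_interior[OF cone_faceD(1)[OF M(1)] _ y0 _ y])
      show "0 \<le> z \<bullet> u" if "u \<in> M" for u using that z cone_faceD(2)[OF M(1)] dual_nonneg by (auto simp: D_def)
      show "z \<bullet> y0 = 0" using z by (simp add: D_def inner_commute)
    qed
    have Dface: "cone_face D (dual_cone F)" unfolding D_def
      using cone_faceD(2)[OF M(1)] y0M dual_nonneg
      by (intro cone_face_Int_orthogonal dual_cone_convex_cone) (auto simp: inner_commute)
    have DB: "cone_map B D"
      unfolding cone_map_def
    proof (intro conjI ballI)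
      show "pointed_cone D" by (rule pointed_cone_face[OF dual_cone_pointed Dface])
      fix z assume z: "z \<in> D"
      have "(B *v z) \<bullet> y0 = z \<bullet> (A *v y0)" using B_inner y0M cone_faceD(2)[OF M(1)] span_base by blast
      also have "\<dots> = 0" using D_orth[OF z M(2)[OF y0M]] .
      finally show "B *v z \<in> D" using z cone_mapD(2)[OF B_dual] by (auto simp: D_def inner_commute)
    qed
    have "z1 \<in> D" using z1 y0M by (auto simp: D_def inner_commute)
    then obtain r z where z: "z \<in> D" "z \<noteq> 0" "B *v z = r *\<^sub>R z" using eigenvector_in_cone[OF DB _ z1(2)] by metis
    have zD: "z \<in> dual_cone F" using z(1) by (simp add: D_def)
    have zx: "z \<bullet> x > 0" by (rule dual_cone_rel_interior_pos[OF cF zD z(2) x(1)])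
    \<comment> \<open>A power of A - l kills \<open>x\<close>, so pairing with the eigenvector
      \<open>z\<close>, which is positive at \<open>x\<close>, leaves no other eigenvalue.\<close>
    have "r = l"
    proof -
      have "poly ([:-l, 1:] ^ N) r * (z \<bullet> x) = 0"
        using eigen_inner[OF z(3) span_base[OF xF], of "[:-l, 1:] ^ N"] N by simp
      then show ?thesis using zx by simp
    qed
    \<comment> \<open>The zero set of \<open>u\<close> in \<open>F\<close> is a proper invariant
      face, hence inside \<open>M\<close>, where \<open>z\<close> vanishes; exposedness then allows
      a little of \<open>z\<close> to be subtracted from \<open>u\<close>.\<close>
    have kern: "\<exists>e>0. u - e *\<^sub>R z \<in> dual_cone F" if u: "u \<in> dual_cone F" "u \<noteq> 0" "B *v u = l *\<^sub>R u" for u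
    proof -
      let ?J = "{y \<in> F. u \<bullet> y = 0}"
      have J: "cone_face ?J F" using cF dual_nonneg[OF u(1)] by (rule cone_face_Int_orthogonal)
      have JA: "A *v y \<in> ?J" if "y \<in> ?J" for y
        using that B_inner[of y u] u(3) cone_mapD(2)[OF A] by (auto simp: span_base)
      have "?J \<noteq> F"
      proof
        assume "?J = F"
        then have "x \<in> ?J" using xF by simp
        then show False using dual_cone_rel_interior_pos[OF cF u(1,2) x(1)] by simp
      qed
      then have "?J \<subseteq> M" using sub[OF J JA] by blast
      then have "\<forall>y\<in>F. u \<bullet> y = 0 \<longrightarrow> z \<bullet> y = 0" using D_orth[OF z(1)] by blast
      then show ?thesis using E u(1) zD unfolding dual_exposing_def by blast
    qed
    obtain w where w: "w \<in> dual_cone F" "\<And>x. x \<in> F \<Longrightarrow> x \<noteq> 0 \<Longrightarrow> 0 < w \<bullet> x"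
      using dual_cone_strictly_positive[OF F] by blast
    obtain v where v: "v \<in> dual_cone F" "B *v v = l *\<^sub>R v" "\<And>x. x \<in> span F \<Longrightarrow> v \<bullet> x = w \<bullet> peak A l m x"
      using dual_eigenvector[OF w(1) leF lm(3)] by metis
    have vg: "v \<bullet> g > 0" using v(3)[OF span_base[OF gF]] w(2)[OF peak_mem[OF A gF lm(3) sg]] by simp
    \<comment> \<open>The largest possible multiple of \<open>z\<close> is subtracted from
      \<open>v\<close>. The remainder still satisfies the eigenvalue equation for \<open>l\<close>;
      unless it is 0, \<open>kern\<close> would permit a further subtraction.\<close>
    define TT where "TT = {t. 0 \<le> t \<and> v - t *\<^sub>R z \<in> dual_cone F}"
    have "closed ((\<lambda>t. v - t *\<^sub>R z) -` dual_cone F)"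
      by (rule closed_vimage[OF dual_cone_closed]) (intro continuous_intros)
    then have "closed ({0..} \<inter> (\<lambda>t. v - t *\<^sub>R z) -` dual_cone F)" by (intro closed_Int closed_atLeast)
    moreover have "TT = {0..} \<inter> (\<lambda>t. v - t *\<^sub>R z) -` dual_cone F" by (auto simp: TT_def)
    ultimately have "closed TT" by simp
    moreover have bnd: "t \<le> (v \<bullet> x) / (z \<bullet> x)" if "t \<in> TT" for t
    proof -
      have "v - t *\<^sub>R z \<in> dual_cone F" using that by (simp add: TT_def)
      from dual_nonneg[OF this xF] show ?thesis using zx by (simp add: inner_diff_left pos_le_divide_eq)
    qed
    then have "bounded TT" by (intro boundedI[of _ "(v \<bullet> x) / (z \<bullet> x)"]) (auto simp: TT_def)
    ultimately have "compact TT" by (simp add: compact_eq_bounded_closed)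
    moreover have "0 \<in> TT" using v(1) by (simp add: TT_def)
    ultimately obtain t where t: "t \<in> TT" "\<And>s. s \<in> TT \<Longrightarrow> s \<le> t"
      using compact_attains_sup[of TT] by blast
    define v' where "v' = v - t *\<^sub>R z"
    have v'D: "v' \<in> dual_cone F" using t(1) by (simp add: TT_def v'_def)
    have "v' = 0"
    proof (rule ccontr)
      assume "v' \<noteq> 0"
      moreover have "B *v v' = l *\<^sub>R v'"
        using v(2) z(3) \<open>r = l\<close> by (simp add: v'_def matrix_vector_mult_diff_distrib matrix_vector_mult_scaleR algebra_simps)
      ultimately obtain e where e: "e > 0" "v' - e *\<^sub>R z \<in> dual_cone F" using kern[OF v'D] by blast
      have "v - (t + e) *\<^sub>R z = v' - e *\<^sub>R z" by (simp add: v'_def algebra_simps)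
      then have "t + e \<in> TT" using e t(1) by (simp add: TT_def)
      then show False using t(2) e(1) by fastforce
    qed
    then have "v \<bullet> g = t * (z \<bullet> g)" by (simp add: v'_def)
    then show False using D_orth[OF z(1)] gG GM vg by auto
  qed
  then show ?thesis using leF[OF gF] spG spF by (simp add: pair_less_def)
qed

end

section \<open>The Jordan form of a restriction\<close>

lemma mult_mat_zero_vec: "M \<in> carrier_mat a b \<Longrightarrow> M *\<^sub>v 0\<^sub>v b = 0\<^sub>v a"
  by (intro eq_vecI) auto

lemma zero_mat_mult_vec: "v \<in> carrier_vec b \<Longrightarrow> 0\<^sub>m a b *\<^sub>v v = 0\<^sub>v a"
  by (intro eq_vecI) auto

text \<open>For c = 0 the block is nilpotent and its power m - 1 is already the zero matrix;
  otherwise it is triangular with nonzero determinant, so that no power has a kernel.\<close>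

lemma jordan_block_kernel_power:
  fixes c :: "'a::field"
  assumes w: "w \<in> carrier_vec n" and J: "(jordan_block n c ^\<^sub>m m) *\<^sub>v w = 0\<^sub>v n"
    and c: "c = 0 \<Longrightarrow> n \<le> m - 1"
  shows "(jordan_block n c ^\<^sub>m (m - 1)) *\<^sub>v w = 0\<^sub>v n"
proof (cases "c = 0")
  case True
  have "jordan_block n c ^\<^sub>m (m - 1) = 0\<^sub>m n n"
    unfolding True jordan_block_zero_pow using c[OF True] by (intro eq_matI) auto
  then show ?thesis using zero_mat_mult_vec[OF w] by simp
next
  case False
  let ?J = "jordan_block n c"
  have Jc: "?J \<in> carrier_mat n n" by simp
  have "upper_triangular ?J" by (auto simp: upper_triangular_def jordan_block_def)
  then have "det ?J = prod_list (diag_mat ?J)" using Jc by (rule det_upper_triangular)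
  also have "diag_mat ?J = replicate n c"
    using diag_jordan_block_pow[of n c 1] by (simp add: pow_mat.simps One_nat_def del: One_nat_def[symmetric])
  finally have "det ?J \<noteq> 0" using False by simp
  then have inj: "v = 0\<^sub>v n" if "v \<in> carrier_vec n" "?J *\<^sub>v v = 0\<^sub>v n" for v
    using det_0_iff_vec_prod_zero_field[OF Jc] that by blast
  have "v = 0\<^sub>v n" if "v \<in> carrier_vec n" "(?J ^\<^sub>m k) *\<^sub>v v = 0\<^sub>v n" for v k
    using that
  proof (induction k arbitrary: v)
    case (Suc k)
    have Jv: "?J *\<^sub>v v \<in> carrier_vec n" by (rule mult_mat_vec_carrier[OF Jc Suc.prems(1)])
    have Jk: "?J ^\<^sub>m k \<in> carrier_mat n n" by simp
    have "(?J ^\<^sub>m k) *\<^sub>v (?J *\<^sub>v v) = 0\<^sub>v n"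
      using Suc.prems(2) assoc_mult_mat_vec[OF Jk Jc Suc.prems(1)] by simp
    then show ?case using Suc.IH[OF Jv] inj Suc.prems(1) by blast
  qed simp
  then have "w = 0\<^sub>v n" using w J by blast
  then show ?thesis using mult_mat_zero_vec[OF pow_carrier_mat[OF Jc]] by simp
qed

lemma jordan_matrix_kernel_power:
  fixes n_as :: "(nat \<times> 'a::field) list"
  assumes "\<And>n. (n, ev) \<in> set n_as \<Longrightarrow> n \<le> m - 1"
    and "u \<in> carrier_vec (sum_list (map fst n_as))"
    and "(char_matrix (jordan_matrix n_as) ev ^\<^sub>m m) *\<^sub>v u = 0\<^sub>v (sum_list (map fst n_as))"
  shows "(char_matrix (jordan_matrix n_as) ev ^\<^sub>m (m - 1)) *\<^sub>v u = 0\<^sub>v (sum_list (map fst n_as))"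
  using assms
proof (induction n_as arbitrary: u)
  case Nil
  have "char_matrix (jordan_matrix ([] :: (nat \<times> 'a) list)) ev \<in> carrier_mat 0 0"
    using jordan_matrix_carrier[of "[] :: (nat \<times> 'a) list"] by (intro char_matrix_closed) simp
  from pow_carrier_mat[OF this, of "m - 1"]
  have "(char_matrix (jordan_matrix []) ev ^\<^sub>m (m - 1)) *\<^sub>v u \<in> carrier_vec 0"
    using mult_mat_vec_carrier Nil.prems(2) by (metis list.map(1) sum_list.Nil)
  then show ?case by (metis carrier_vecD sum_list.Nil list.map(1) vec_of_dim_0 zero_carrier_vec)
next
  case (Cons na n_as)
  obtain n a where na: "na = (n, a)" by force
  let ?N = "sum_list (map fst n_as)"
  let ?J = "jordan_block n (a - ev)" and ?M = "char_matrix (jordan_matrix n_as) ev"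
  have Jc: "?J \<in> carrier_mat n n" by simp
  have Mc: "?M \<in> carrier_mat ?N ?N" by simp
  have "char_matrix (jordan_matrix (na # n_as)) ev
      = four_block_mat (char_matrix (jordan_block n a) ev) (0\<^sub>m n ?N) (0\<^sub>m ?N n) ?M"
    unfolding na jordan_matrix_Cons char_matrix_def by (intro eq_matI) auto
  then have eq: "char_matrix (jordan_matrix (na # n_as)) ev = four_block_mat ?J (0\<^sub>m n ?N) (0\<^sub>m ?N n) ?M"
    by (simp only: char_matrix_jordan_block)
  have pow: "char_matrix (jordan_matrix (na # n_as)) ev ^\<^sub>m k
      = four_block_mat (?J ^\<^sub>m k) (0\<^sub>m n ?N) (0\<^sub>m ?N n) (?M ^\<^sub>m k)" for k
    unfolding eq by (rule pow_four_block_mat[OF Jc Mc])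
  have sum: "sum_list (map fst (na # n_as)) = n + ?N" by (simp add: na)
  define b d where "b = vec_first u n" and "d = vec_last u ?N"
  have u: "u = b @\<^sub>v d" using Cons.prems(2) unfolding b_def d_def sum by simp
  have bc: "b \<in> carrier_vec n" and dc: "d \<in> carrier_vec ?N" by (simp_all add: b_def d_def)
  have act: "(char_matrix (jordan_matrix (na # n_as)) ev ^\<^sub>m k) *\<^sub>v u = (?J ^\<^sub>m k) *\<^sub>v b @\<^sub>v (?M ^\<^sub>m k) *\<^sub>v d" for k
    unfolding pow u by (rule mult_mat_vec_split[OF pow_carrier_mat[OF Jc] pow_carrier_mat[OF Mc] bc dc])
  have z: "0\<^sub>v (n + ?N) = 0\<^sub>v n @\<^sub>v (0\<^sub>v ?N :: 'a Matrix.vec)" by (intro eq_vecI) auto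
  have Jb: "(?J ^\<^sub>m k) *\<^sub>v b \<in> carrier_vec n" for k by (rule mult_mat_vec_carrier[OF pow_carrier_mat[OF Jc] bc])
  have "(?J ^\<^sub>m m) *\<^sub>v b @\<^sub>v (?M ^\<^sub>m m) *\<^sub>v d = 0\<^sub>v n @\<^sub>v 0\<^sub>v ?N"
    using Cons.prems(3) unfolding act sum z .
  then have 0: "(?J ^\<^sub>m m) *\<^sub>v b = 0\<^sub>v n" "(?M ^\<^sub>m m) *\<^sub>v d = 0\<^sub>v ?N"
    using append_vec_eq[OF Jb zero_carrier_vec] by blast+
  have "(?J ^\<^sub>m (m - 1)) *\<^sub>v b = 0\<^sub>v n"
    by (rule jordan_block_kernel_power[OF bc 0(1)]) (use Cons.prems(1)[of n] na in auto)
  moreover have "(?M ^\<^sub>m (m - 1)) *\<^sub>v d = 0\<^sub>v ?N"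
    by (rule Cons.IH[OF _ dc 0(2)]) (use Cons.prems(1) in auto)
  ultimately show ?case unfolding act sum z by simp
qed

text \<open>Gives the lower bound for the index: a vector killed by the power \<open>m\<close> but
  not by the power m - 1 forces a block of size at least \<open>m\<close>. The claim is checked
  blockwise and transported along the similarity.\<close>

lemma jordan_nf_kernel_power:
  fixes R :: "'a::field mat"
  assumes R: "R \<in> carrier_mat d d" and nf: "jordan_nf R n_as" and le: "\<And>n. (n, ev) \<in> set n_as \<Longrightarrow> n \<le> m - 1"
    and v: "v \<in> carrier_vec d" "(char_matrix R ev ^\<^sub>m m) *\<^sub>v v = 0\<^sub>v d"
  shows "(char_matrix R ev ^\<^sub>m (m - 1)) *\<^sub>v v = 0\<^sub>v d"
proof -
  let ?J = "jordan_matrix n_as"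
  obtain P Q where wit: "similar_mat_wit R ?J P Q" using nf by (auto simp: jordan_nf_def similar_mat_def)
  have dR: "d = dim_row R" using R by simp
  note W = similar_mat_witD[OF dR wit]
  have d: "sum_list (map fst n_as) = d" using W(5) by (metis carrier_matD(1) jordan_matrix_dim(1))
  let ?C = "\<lambda>k. char_matrix R ev ^\<^sub>m k" and ?E = "\<lambda>k. char_matrix ?J ev ^\<^sub>m k"
  have Cc: "?C k \<in> carrier_mat d d" for k using R by (intro pow_carrier_mat char_matrix_closed)
  have Ec: "?E k \<in> carrier_mat d d" for k using W(5) by (intro pow_carrier_mat char_matrix_closed)
  have CE: "?C k = P * ?E k * Q" for k
  proof -
    have "similar_mat_wit (?C k) (?E k) P Q" by (rule similar_mat_wit_pow[OF similar_mat_wit_char_matrix[OF wit]])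
    then show ?thesis using similar_mat_witD(3)[OF refl] by blast
  qed
  have Qv: "Q *\<^sub>v v \<in> carrier_vec d" using W(7) v(1) by simp
  have PEQ: "?C k *\<^sub>v v = P *\<^sub>v (?E k *\<^sub>v (Q *\<^sub>v v))" for k
    unfolding CE using W(6,7) Ec[of k] v(1) Qv
    by (simp add: assoc_mult_mat_vec[where n\<^sub>1 = d and n\<^sub>2 = d and n\<^sub>3 = d])
  have Em: "?E m *\<^sub>v (Q *\<^sub>v v) \<in> carrier_vec d" using Ec[of m] Qv by simp
  have "?E m *\<^sub>v (Q *\<^sub>v v) = (Q * P) *\<^sub>v (?E m *\<^sub>v (Q *\<^sub>v v))" unfolding W(2) using Em by simp
  also have "\<dots> = Q *\<^sub>v (?C m *\<^sub>v v)" unfolding PEQ by (rule assoc_mult_mat_vec[OF W(7,6) Em])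
  also have "\<dots> = 0\<^sub>v d" unfolding v(2) by (rule mult_mat_zero_vec[OF W(7)])
  finally have "?E m *\<^sub>v (Q *\<^sub>v v) = 0\<^sub>v d" .

  then have "?E (m - 1) *\<^sub>v (Q *\<^sub>v v) = 0\<^sub>v d"
    using jordan_matrix_kernel_power[of ev n_as m "Q *\<^sub>v v", OF le] Qv unfolding d by blast
  then show ?thesis unfolding PEQ by (simp only: mult_mat_zero_vec[OF W(6)])
qed

text \<open>The sum of \<open>min k n\<close> over the block sizes is the dimension of the kernel of
  the k-th power, so a block of size \<open>k\<close> makes the kernels grow strictly up to exponent
  \<open>k\<close>.\<close>

lemma sum_list_min_less:
  fixes ns :: "nat list"
  assumes "m < k" "k \<in> set ns"
  shows "(\<Sum>n\<leftarrow>ns. min m n) < (\<Sum>n\<leftarrow>ns. min k n)"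
  using assms(2)
proof (induction ns)
  case (Cons a ns)
  have le: "(\<Sum>n\<leftarrow>ns. min m n) \<le> (\<Sum>n\<leftarrow>ns. min k n)" using assms(1) by (intro sum_list_mono) auto
  show ?case
  proof (cases "k \<in> set ns")
    case True
    have "min m a \<le> min k a" using assms(1) by auto
    then show ?thesis using Cons.IH[OF True] by simp
  next
    case False
    then have "a = k" using Cons.prems by simp
    then show ?thesis using le assms(1) by simp
  qed
qed simp

text \<open>Equal kernels have equal dimension, whereas a block of size \<open>k\<close> above
  \<open>m\<close> makes the dimension formula strictly larger at \<open>k\<close> than at
  \<open>m\<close>.\<close>

lemma jordan_nf_block_le:
  fixes R :: "'a::field mat"
  assumes R: "R \<in> carrier_mat d d" and nf: "jordan_nf R n_as" and k: "(k, ev) \<in> set n_as"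
    and stab: "\<And>v. v \<in> carrier_vec d \<Longrightarrow> (char_matrix R ev ^\<^sub>m k) *\<^sub>v v = 0\<^sub>v d \<Longrightarrow>
      (char_matrix R ev ^\<^sub>m m) *\<^sub>v v = 0\<^sub>v d"
  shows "k \<le> m"
proof (rule ccontr)
  assume "\<not> k \<le> m"
  then have mk: "m < k" by simp
  let ?C = "\<lambda>k. char_matrix R ev ^\<^sub>m k"
  have C1: "char_matrix R ev \<in> carrier_mat d d" using R by simp
  have Cc: "?C k \<in> carrier_mat d d" for k using C1 by (rule pow_carrier_mat)
  have up: "?C (j + i) *\<^sub>v v = 0\<^sub>v d" if v: "v \<in> carrier_vec d" "?C j *\<^sub>v v = 0\<^sub>v d" for i j v
  proof (induction i)
    case (Suc i)
    have comm: "?C (Suc n) = char_matrix R ev * ?C n" for n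
    proof (induction n)
      case (Suc n)
      have "?C (Suc (Suc n)) = (char_matrix R ev * ?C n) * char_matrix R ev"
        using Suc by (simp only: pow_mat.simps(2)[of _ "Suc n"])
      also have "\<dots> = char_matrix R ev * (?C n * char_matrix R ev)" by (rule assoc_mult_mat[OF C1 Cc C1])
      finally show ?case by simp
    qed (use C1 in simp)
    have "?C (j + Suc i) *\<^sub>v v = char_matrix R ev *\<^sub>v (?C (j + i) *\<^sub>v v)"
      unfolding add_Suc_right comm by (rule assoc_mult_mat_vec[OF C1 Cc v(1)])
    then show ?case unfolding Suc by (simp only: mult_mat_zero_vec[OF C1])
  qed (use v in simp)
  have "mat_kernel (?C k) = mat_kernel (?C m)"
    unfolding mat_kernel[OF Cc] using stab up[of _ m "k - m"] mk by auto
  moreover have "kernel.dim d (?C k) = kernel.dim d (?C m)" if "mat_kernel (?C k) = mat_kernel (?C m)"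
    by (simp only: that)
  ultimately have "dim_gen_eigenspace R ev k = dim_gen_eigenspace R ev m"
    unfolding dim_gen_eigenspace_def kernel_dim_def using Cc carrier_matD(2) by metis
  moreover have "k \<in> set (map fst [(n, e)\<leftarrow>n_as . e = ev])" using k by force
  ultimately show False unfolding dim_gen_eigenspace[OF nf] using sum_list_min_less[OF mk] by (metis less_irrefl)
qed

text \<open>The maximum ranges over all Jordan forms of the matrix, so the upper bound is shown for
  each of them; that there is one follows since the characteristic polynomial splits.\<close>

lemma jordan_nf_index_eq:
  fixes R :: "complex mat"
  assumes R: "R \<in> carrier_mat d d" and m: "1 \<le> m"
    and stab: "\<And>v k. m \<le> k \<Longrightarrow> v \<in> carrier_vec d \<Longrightarrow> (char_matrix R ev ^\<^sub>m k) *\<^sub>v v = 0\<^sub>v d \<Longrightarrow>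
      (char_matrix R ev ^\<^sub>m m) *\<^sub>v v = 0\<^sub>v d"
    and v: "v \<in> carrier_vec d" "(char_matrix R ev ^\<^sub>m m) *\<^sub>v v = 0\<^sub>v d" "(char_matrix R ev ^\<^sub>m (m - 1)) *\<^sub>v v \<noteq> 0\<^sub>v d"
  shows "Max {k. \<exists>n_as. jordan_nf R n_as \<and> (k, ev) \<in> set n_as} = m"
proof -
  have le: "k \<le> m" if "jordan_nf R n_as" "(k, ev) \<in> set n_as" for k n_as
  proof (cases "k \<le> m")
    case False
    then show ?thesis using jordan_nf_block_le[OF R that] stab[of k] by (meson nat_le_linear)
  qed
  obtain as where "char_poly R = (\<Prod>a\<leftarrow>as. [:- a, 1:])" using char_poly_factorized[OF R] by auto
  then obtain n_as where nf: "jordan_nf R n_as" using jordan_nf_exists[OF R] by blast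
  have "\<exists>n. (n, ev) \<in> set n_as \<and> \<not> n \<le> m - 1"
    using jordan_nf_kernel_power[OF R nf _ v(1,2)] v(3) by blast
  then obtain n where n: "(n, ev) \<in> set n_as" "\<not> n \<le> m - 1" by blast
  then have "n = m" using le[OF nf n(1)] by linarith
  show ?thesis
  proof (rule Max_eqI)
    show "finite {k. \<exists>n_as. jordan_nf R n_as \<and> (k, ev) \<in> set n_as}"
      by (rule finite_subset[of _ "{..m}"]) (use le in auto)
  qed (use le nf n(1) \<open>n = m\<close> in auto)
qed

text \<open>The basis is arbitrary because \<open>restr_mat\<close> picks one by choice.
  \<open>coords\<close> takes a real vector of the subspace to its coordinates, \<open>comb\<close>
  takes complex coordinates back to a vector, so the restriction matrix can be compared with the
  complexified \<open>A\<close>.\<close>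

locale restriction_basis =
  fixes A :: "real^'n^'n" and V bs
  assumes V: "Real_Vector_Spaces.subspace V" and inv: "\<And>x. x \<in> V \<Longrightarrow> A *v x \<in> V"
    and bs: "ordered_basis bs V"
begin

definition R :: "complex mat" where
  "R = Matrix.mat (length bs) (length bs)
       (\<lambda>(i, j). complex_of_real (representation (set bs) (A *v (bs ! j)) (bs ! i)))"

definition comb :: "complex Matrix.vec \<Rightarrow> complex^'n" where
  "comb v = (\<Sum>i<length bs. Matrix.vec_index v i *s cvec (bs ! i))"

definition coords :: "real^'n \<Rightarrow> complex Matrix.vec" where
  "coords u = Matrix.vec (length bs) (\<lambda>i. complex_of_real (representation (set bs) u (bs ! i)))"

lemma bsD: "distinct bs" "independent (set bs)" "span (set bs) = V"
  using bs by (auto simp: ordered_basis_def)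

lemma R_carrier: "R \<in> carrier_mat (length bs) (length bs)"
  by (simp add: R_def)

lemma coords_carrier: "coords u \<in> carrier_vec (length bs)"
  by (simp add: coords_def)

lemma sum_nth: "(\<Sum>i<length bs. g (bs ! i)) = (\<Sum>b\<in>set bs. g b)"
  by (rule sum.reindex_bij_betw[OF bij_betw_nth[OF bsD(1) refl refl]])

lemma representation_sum:
  assumes "u \<in> V"
  shows "(\<Sum>i<length bs. representation (set bs) u (bs ! i) *\<^sub>R bs ! i) = u"
  unfolding sum_nth[of "\<lambda>b. representation (set bs) u b *\<^sub>R b"]
  by (rule real_vector.sum_representation_eq) (use bsD assms in auto)

lemma cvec_sum: "cvec (sum g S) = (\<Sum>i\<in>S. cvec (g i))"
  by (induction S rule: infinite_finite_induct) (simp_all add: cvec_add)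

lemma comb_coords: "u \<in> V \<Longrightarrow> comb (coords u) = cvec u"
  unfolding comb_def coords_def
  by (subst (2) representation_sum[symmetric]) (simp_all add: cvec_sum cvec_scaleR)

lemma nth_V: "i < length bs \<Longrightarrow> bs ! i \<in> V"
  using bsD(3) span_base nth_mem by blast

lemma comb_add: "v \<in> carrier_vec (length bs) \<Longrightarrow> w \<in> carrier_vec (length bs) \<Longrightarrow> comb (v + w) = comb v + comb w"
  by (simp add: comb_def vec.scale_left_distrib sum.distrib)

lemma comb_smult: "v \<in> carrier_vec (length bs) \<Longrightarrow> comb (c \<cdot>\<^sub>v v) = c *s comb v"
  by (simp add: comb_def vec.scale_sum_right vector_smult_assoc)

lemma comb_zero: "comb (0\<^sub>v (length bs)) = 0"
  by (simp add: comb_def)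

text \<open>Real and imaginary parts of the coordinates give two real relations among the basis
  vectors, so real independence suffices for complex independence.\<close>

lemma comb_inj:
  assumes v: "v \<in> carrier_vec (length bs)" and 0: "comb v = 0"
  shows "v = 0\<^sub>v (length bs)"
proof -
  define a b where "a i = Re (Matrix.vec_index v i)" and "b i = Im (Matrix.vec_index v i)" for i
  have "comb v = cvec (\<Sum>i<length bs. a i *\<^sub>R bs ! i) + \<i> *s cvec (\<Sum>i<length bs. b i *\<^sub>R bs ! i)"
    unfolding comb_def cvec_sum cvec_scaleR vec.scale_sum_right sum.distrib[symmetric]
  proof (intro sum.cong refl)
    fix i
    have v: "Matrix.vec_index v i = complex_of_real (a i) + \<i> * complex_of_real (b i)"
      unfolding a_def b_def by (rule complex_eq)
    show "Matrix.vec_index v i *s cvec (bs ! i)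
        = complex_of_real (a i) *s cvec (bs ! i) + \<i> *s (complex_of_real (b i) *s cvec (bs ! i))"
      unfolding v vector_smult_assoc by (rule vec.scale_left_distrib)
  qed
  moreover have "x = 0 \<and> y = 0" if h: "cvec x + \<i> *s cvec y = 0" for x y :: "real^'n"
  proof -
    have "x $ i = 0 \<and> y $ i = 0" for i
    proof -
      have "(cvec x + \<i> *s cvec y) $ i = (0 :: complex^'n) $ i" unfolding h by (rule refl)
      then have "complex_of_real (x $ i) + \<i> * complex_of_real (y $ i) = 0" by (simp add: cvec_def)
      then show ?thesis by (simp add: complex_eq_iff)
    qed
    then show ?thesis by (simp add: Finite_Cartesian_Product.vec_eq_iff)
  qed
  ultimately have s: "(\<Sum>i<length bs. a i *\<^sub>R bs ! i) = 0" "(\<Sum>i<length bs. b i *\<^sub>R bs ! i) = 0" using 0 by metis+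
  have ind: "g i = 0" if "(\<Sum>i<length bs. g i *\<^sub>R bs ! i) = 0" "i < length bs" for g i
  proof -
    define f where "f x = g (THE j. j < length bs \<and> bs ! j = x)" for x
    have f: "f (bs ! j) = g j" if "j < length bs" for j
      unfolding f_def using that bsD(1) by (intro arg_cong[of _ _ g] the_equality) (auto simp: nth_eq_iff_index_eq)
    have "(\<Sum>x\<in>set bs. f x *\<^sub>R x) = (\<Sum>i<length bs. f (bs ! i) *\<^sub>R bs ! i)" by (rule sum_nth[symmetric])
    also have "\<dots> = 0" using that(1) f by simp
    finally have "f (bs ! i) = 0"
      using independentD[OF bsD(2), of "set bs" f "bs ! i"] that(2) by simp
    then show ?thesis using f[OF that(2)] by simp
  qed
  show ?thesis
  proof (rule eq_vecI)
    fix i assume "i < dim_vec (0\<^sub>v (length bs) :: complex Matrix.vec)"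
    then have i: "i < length bs" by simp
    then show "Matrix.vec_index v i = Matrix.vec_index (0\<^sub>v (length bs)) i"
      using ind[OF s(1) i] ind[OF s(2) i] by (simp add: a_def b_def complex_eq_iff)
  qed (use v in simp)
qed

lemma comb_R:
  assumes v: "v \<in> carrier_vec (length bs)"
  shows "comb (R *\<^sub>v v) = cmat A *v comb v"
proof -
  let ?r = "\<lambda>i j. complex_of_real (representation (set bs) (A *v bs ! j) (bs ! i))"
  have idx: "Matrix.vec_index (R *\<^sub>v v) i = (\<Sum>j<length bs. ?r i j * Matrix.vec_index v j)" if "i < length bs" for i
    using that v by (simp add: R_def Matrix.scalar_prod_def atLeast0LessThan)
  have "comb (R *\<^sub>v v) = (\<Sum>i<length bs. \<Sum>j<length bs. (?r i j * Matrix.vec_index v j) *s cvec (bs ! i))"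
    unfolding comb_def using idx by (intro sum.cong refl) (simp add: vec.scale_sum_left)
  also have "\<dots> = (\<Sum>j<length bs. \<Sum>i<length bs. (?r i j * Matrix.vec_index v j) *s cvec (bs ! i))"
    by (rule sum.swap)
  also have "\<dots> = (\<Sum>j<length bs. Matrix.vec_index v j *s cvec (A *v bs ! j))"
  proof (intro sum.cong refl)
    fix j assume "j \<in> {..<length bs}"
    then have "A *v bs ! j \<in> V" using nth_V inv by simp
    from representation_sum[OF this]
    have "cvec (A *v bs ! j) = (\<Sum>i<length bs. ?r i j *s cvec (bs ! i))" by (metis (no_types, lifting) cvec_scaleR cvec_sum sum.cong)
    then show "(\<Sum>i<length bs. (?r i j * Matrix.vec_index v j) *s cvec (bs ! i)) = Matrix.vec_index v j *s cvec (A *v bs ! j)"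
      by (simp add: vec.scale_sum_right vector_smult_assoc mult.commute)
  qed
  also have "\<dots> = cmat A *v comb v"
    unfolding comb_def by (simp add: vec.linear_sum vec.scale cvec_matrix[symmetric])
  finally show ?thesis .
qed

lemma comb_char_matrix:
  assumes v: "v \<in> carrier_vec (length bs)"
  shows "comb ((char_matrix R \<mu> ^\<^sub>m k) *\<^sub>v v) = cpact A ([:-\<mu>, 1:] ^ k) (comb v)"
  using v
proof (induction k arbitrary: v)
  case 0
  then show ?case using R_carrier by (simp add: char_matrix_def)
next
  case (Suc k)
  let ?d = "length bs"
  have C: "char_matrix R \<mu> \<in> carrier_mat ?d ?d" using R_carrier by simp
  have Rv: "R *\<^sub>v v \<in> carrier_vec ?d" using R_carrier Suc.prems by simp
  have dr: "dim_row R = ?d" using R_carrier by simp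
  have one: "((-\<mu>) \<cdot>\<^sub>m 1\<^sub>m ?d) *\<^sub>v v = (-\<mu>) \<cdot>\<^sub>v v"
  proof (rule eq_vecI)
    fix i assume "i < dim_vec ((-\<mu>) \<cdot>\<^sub>v v)"
    then have i: "i < ?d" using Suc.prems by simp
    have "Matrix.vec_index (((-\<mu>) \<cdot>\<^sub>m 1\<^sub>m ?d) *\<^sub>v v) i
        = (\<Sum>j = 0..<?d. ((-\<mu>) * (if i = j then 1 else 0)) * Matrix.vec_index v j)"
      using i Suc.prems by (auto simp: Matrix.scalar_prod_def intro!: sum.cong)
    also have "\<dots> = (\<Sum>j = 0..<?d. if j = i then (-\<mu>) * Matrix.vec_index v j else 0)"
      by (intro sum.cong) auto
    also have "\<dots> = (-\<mu>) * Matrix.vec_index v i" using i by simp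
    finally show "Matrix.vec_index (((-\<mu>) \<cdot>\<^sub>m 1\<^sub>m ?d) *\<^sub>v v) i = Matrix.vec_index ((-\<mu>) \<cdot>\<^sub>v v) i"
      using i Suc.prems by simp
  qed (use Suc.prems in simp)
  have oc: "(-\<mu>) \<cdot>\<^sub>m 1\<^sub>m ?d \<in> carrier_mat ?d ?d" by simp
  have "char_matrix R \<mu> *\<^sub>v v = R *\<^sub>v v + ((-\<mu>) \<cdot>\<^sub>m 1\<^sub>m ?d) *\<^sub>v v"
    unfolding char_matrix_def dr by (rule add_mult_distrib_mat_vec[OF R_carrier oc Suc.prems])
  then have "char_matrix R \<mu> *\<^sub>v v = R *\<^sub>v v + (-\<mu>) \<cdot>\<^sub>v v" unfolding one .
  then have "comb (char_matrix R \<mu> *\<^sub>v v) = cpact A [:-\<mu>, 1:] (comb v)"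
    using comb_add[OF Rv, of "(-\<mu>) \<cdot>\<^sub>v v"] Suc.prems comb_R[OF Suc.prems] comb_smult[OF Suc.prems]
    by (simp add: C.pact_linear)
  moreover have "char_matrix R \<mu> *\<^sub>v v \<in> carrier_vec ?d" using C Suc.prems by simp
  moreover have "(char_matrix R \<mu> ^\<^sub>m Suc k) *\<^sub>v v = (char_matrix R \<mu> ^\<^sub>m k) *\<^sub>v (char_matrix R \<mu> *\<^sub>v v)"
    using assoc_mult_mat_vec[OF pow_carrier_mat[OF C] C Suc.prems] by simp
  ultimately show ?case using Suc.IH
    by (metis C.pact_mult power_Suc2)
qed

lemma comb_char_matrix_eq_0:
  assumes v: "v \<in> carrier_vec (length bs)"
  shows "(char_matrix R \<mu> ^\<^sub>m k) *\<^sub>v v = 0\<^sub>v (length bs) \<longleftrightarrow> cpact A ([:-\<mu>, 1:] ^ k) (comb v) = 0"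
proof -
  have c: "(char_matrix R \<mu> ^\<^sub>m k) *\<^sub>v v \<in> carrier_vec (length bs)"
    using pow_carrier_mat[OF char_matrix_closed[OF R_carrier]] v by (metis mult_mat_vec_carrier)
  show ?thesis
    unfolding comb_char_matrix[OF v, symmetric] using comb_inj[OF c] comb_zero by metis
qed

end

lemma ordered_basis_exists:
  assumes "Real_Vector_Spaces.subspace V"
  shows "\<exists>bs. ordered_basis bs (V :: (real^'n) set)"
proof -
  obtain B where B: "B \<subseteq> V" "independent B" "V \<subseteq> span B" using basis_exists[of V] by metis
  have fin: "finite B" using B(2) independent_bound by blast
  then obtain bs where bs: "set bs = B" "distinct bs" using finite_distinct_list by blast
  have "span B = V" using B(1,3) span_minimal[OF B(1) assms] by blast
  then show ?thesis using B bs unfolding ordered_basis_def by blast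
qed

lemma restriction_basis_some:
  assumes "Real_Vector_Spaces.subspace V" "\<And>x. x \<in> V \<Longrightarrow> A *v x \<in> V"
  obtains bs where "restriction_basis A V bs" "restr_mat A V = restriction_basis.R A bs"
proof -
  have b: "ordered_basis (SOME bs. ordered_basis bs V) V" using someI_ex[OF ordered_basis_exists[OF assms(1)]] .
  then have r: "restriction_basis A V (SOME bs. ordered_basis bs V)" using assms by unfold_locales
  show ?thesis by (rule that[OF r]) (simp add: restr_mat_def restriction_basis.R_def[OF r] Let_def)
qed

section \<open>Semi-distinguished and dominating faces\<close>

lemma adjoint_cone_exists:
  assumes "cone_map A F"
  obtains B where "adjoint_cone A B F"
proof -
  obtain B where "\<And>y. B *v y \<in> span F" "\<And>x y. x \<in> span F \<Longrightarrow> (B *v y) \<bullet> x = y \<bullet> (A *v x)"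
    using restricted_adjoint_exists[OF subspace_span cone_map_span[OF assms]] by metis
  then have "adjoint_cone A B F" using assms by unfold_locales
  then show ?thesis by (rule that)
qed

lemma invariant_face_iff: "invariant_face A K F \<longleftrightarrow> cone_face F K \<and> (\<forall>x\<in>F. A *v x \<in> F)"
  by (auto simp: invariant_face_def)

lemma cone_map_invariant_face:
  assumes "cone_map A K" "invariant_face A K F"
  shows "cone_map A F"
  using assms pointed_cone_face unfolding cone_map_def invariant_face_iff by blast

lemma face_spec_pair_mono:
  assumes "cone_map A K" "cone_face G K" "cone_face F K" "G \<subseteq> F"
  shows "pair_le (face_spec_pair A G) (face_spec_pair A F)"
proof -
  obtain g where g: "g \<in> rel_interior G" using rel_interior_face_nonempty[OF assms(2)] by blast
  then have "g \<in> F" using rel_interior_subset assms(4) by blast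
  then show ?thesis using face_spec_pair_ge[OF assms(1,3)] face_spec_pair_eq[OF assms(1,2) g] by simp
qed

text \<open>A face \<open>F\<close> around \<open>S\<close> makes the family intersected in
  \<open>face_gen\<close> nonempty, so that the intersection stays inside \<open>K\<close>.\<close>

lemma cone_face_gen:
  assumes F: "cone_face F K" "S \<subseteq> F"
  shows "cone_face (face_gen K S) K" "S \<subseteq> face_gen K S" "face_gen K S \<subseteq> F"
proof -
  show "S \<subseteq> face_gen K S" by (auto simp: face_gen_def)
  show sub: "face_gen K S \<subseteq> F" using F by (auto simp: face_gen_def)
  have "convex_cone (face_gen K S)" unfolding face_gen_def
    by (rule convex_cone_Inter) (auto dest: cone_faceD(1))
  moreover have "face_gen K S \<subseteq> K" using sub cone_faceD(2)[OF F(1)] by blast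
  moreover have "x \<in> face_gen K S \<and> y \<in> face_gen K S"
    if "x \<in> K" "y \<in> K" "x + y \<in> face_gen K S" for x y
    using that unfolding face_gen_def by (auto dest: cone_faceD(3,4))
  ultimately show "cone_face (face_gen K S) K" unfolding cone_face_def by blast
qed

text \<open>\<open>G\<close> and \<open>H\<close> both lie in the face generated by g + h, so every
  member of the join is dominated by a multiple of g + h. This estimate is the form in which the
  join is used later.\<close>

lemma face_join_props:
  assumes K: "pointed_cone K" and G: "cone_face G K" and H: "cone_face H K"
    and g: "g \<in> rel_interior G" and h: "h \<in> rel_interior H"
  shows "cone_face (face_join K G H) K" "G \<subseteq> face_join K G H" "H \<subseteq> face_join K G H" "g + h \<in> face_join K G H"
    and "\<And>f. f \<in> face_join K G H \<Longrightarrow> f \<in> K \<and> (\<exists>e>0. g + h - e *\<^sub>R f \<in> K)"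
proof -
  note cK = pointed_coneD(1)[OF K]
  have gG: "g \<in> G" and hH: "h \<in> H" using g h rel_interior_subset by blast+
  have gK: "g \<in> K" and hK: "h \<in> K" using gG hH cone_faceD(2)[OF G] cone_faceD(2)[OF H] by blast+
  note pf = point_face[OF cK pointed_coneD(7)[OF K gK hK]]
  have sub: "G \<subseteq> point_face K (g + h)" "H \<subseteq> point_face K (g + h)"
  proof -
    show "G \<subseteq> point_face K (g + h)"
      by (rule cone_face_rel_interior_subset[OF G cK pf(1) g]) (use cone_faceD(3)[OF pf(1) gK hK pf(2)] in blast)
    show "H \<subseteq> point_face K (g + h)"
      by (rule cone_face_rel_interior_subset[OF H cK pf(1) h]) (use cone_faceD(4)[OF pf(1) gK hK pf(2)] in blast)
  qed
  then have S: "G \<union> H \<subseteq> point_face K (g + h)" by blast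
  note J = cone_face_gen[OF pf(1) S]
  show "cone_face (face_join K G H) K" "G \<subseteq> face_join K G H" "H \<subseteq> face_join K G H"
    using J unfolding face_join_def by auto
  then show "g + h \<in> face_join K G H" using convex_cone_add cone_faceD(1) gG hH by blast
  show "f \<in> K \<and> (\<exists>e>0. g + h - e *\<^sub>R f \<in> K)" if "f \<in> face_join K G H" for f
    using that J(3) unfolding face_join_def point_face_def by blast
qed

text \<open>If \<open>f\<close> is dominated by a multiple of g + h, then A f is dominated by the
  same multiple of A g + A h, which lies in the join.\<close>

lemma face_join_invariant:
  assumes A: "cone_map A K" and G: "invariant_face A K G" and H: "invariant_face A K H"
  shows "invariant_face A K (face_join K G H)"
proof -
  have K: "pointed_cone K" using cone_mapD(1)[OF A] .
  have Gf: "cone_face G K" and Hf: "cone_face H K" using G H by (auto simp: invariant_face_iff)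
  obtain g h where g: "g \<in> rel_interior G" and h: "h \<in> rel_interior H"
    using rel_interior_face_nonempty[OF Gf] rel_interior_face_nonempty[OF Hf] by blast
  note J = face_join_props[OF K Gf Hf g h]
  have gG: "g \<in> G" and hH: "h \<in> H" using g h rel_interior_subset by blast+
  have "A *v g \<in> face_join K G H" "A *v h \<in> face_join K G H"
    using G H gG hH J(2,3) by (auto simp: invariant_face_iff)
  then have Agh: "A *v (g + h) \<in> face_join K G H"
    using convex_cone_add[OF cone_faceD(1)[OF J(1)]] by (simp add: matrix_vector_right_distrib)
  have "A *v f \<in> face_join K G H" if f: "f \<in> face_join K G H" for f
  proof -
    obtain e where e: "f \<in> K" "e > 0" "g + h - e *\<^sub>R f \<in> K" using J(5)[OF f] by blast
    have "A *v (g + h) - e *\<^sub>R (A *v f) \<in> K"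
      using cone_mapD(2)[OF A e(3)] by (simp add: matrix_vector_mult_diff_distrib matrix_vector_mult_scaleR)
    then show ?thesis
      using cone_face_diffD[OF J(1) pointed_coneD(1)[OF K] Agh e(2)] cone_mapD(2)[OF A e(1)] by blast
  qed
  then show ?thesis using J(1) by (simp add: invariant_face_iff)
qed

text \<open>Join-irreducibility is argued apart from the generalized eigenvector: the pair of a join
  is at most that of g + h, hence at most the pair of one of the two faces, which by domination is
  smaller than that of \<open>F\<close>.\<close>

lemma dominates_imp_semi_distinguished:
  assumes A: "cone_map A K" and F: "invariant_face A K F" "F \<noteq> {0}" and E: "dual_exposing F"
    and dom: "dominates_subfaces A K F"
  shows "semi_distinguished A K F"
proof -
  have K: "pointed_cone K" using cone_mapD(1)[OF A] .
  have Ff: "cone_face F K" using F(1) by (simp add: invariant_face_iff)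
  have AF: "cone_map A F" using cone_map_invariant_face[OF A F(1)] .
  obtain B where "adjoint_cone A B F" using adjoint_cone_exists[OF AF] by metis
  then interpret adj: adjoint_cone A B F .
  have "\<exists>x\<in>rel_interior F. \<exists>\<mu>. gen_eigvec A \<mu> (cvec x)"
  proof (rule adj.dominating_imp_gen_eigvec[OF F(2) E])
    fix G assume G: "cone_face G F" "\<And>x. x \<in> G \<Longrightarrow> A *v x \<in> G" "G \<noteq> F"
    then have "invariant_face A K G" using cone_face_trans[OF Ff G(1)] by (simp add: invariant_face_iff)
    moreover have "G \<subset> F" using G(3) cone_faceD(2)[OF G(1)] by blast
    ultimately show "pair_less (face_spec_pair A G) (face_spec_pair A F)"
      using dom unfolding dominates_subfaces_def by blast
  qed
  moreover have "join_irreducible_face A K F"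
    unfolding join_irreducible_face_def
  proof (intro conjI notI F(1))
    assume "\<exists>G H. invariant_face A K G \<and> G \<subset> F \<and> invariant_face A K H \<and> H \<subset> F \<and> F = face_join K G H"
    then obtain G H where G: "invariant_face A K G" "G \<subset> F" and H: "invariant_face A K H" "H \<subset> F"
      and FJ: "F = face_join K G H" by blast
    have Gf: "cone_face G K" and Hf: "cone_face H K" using G(1) H(1) by (auto simp: invariant_face_iff)
    obtain g h where g: "g \<in> rel_interior G" and h: "h \<in> rel_interior H"
      using rel_interior_face_nonempty[OF Gf] rel_interior_face_nonempty[OF Hf] by blast
    note J = face_join_props[OF K Gf Hf g h]
    have gK: "g \<in> K" and hK: "h \<in> K"
      using g h rel_interior_subset cone_faceD(2)[OF Gf] cone_faceD(2)[OF Hf] by blast+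
    obtain f where f: "f \<in> rel_interior F" using rel_interior_face_nonempty[OF Ff] by blast
    then have "f \<in> face_join K G H" using FJ rel_interior_subset by blast
    then obtain e where e: "f \<in> K" "e > 0" "g + h - e *\<^sub>R f \<in> K" using J(5) by blast
    have "pair_le (spec_pair A f) (spec_pair A (g + h))"
      by (rule spec_pair_mono[OF A pointed_coneD(7)[OF K gK hK] e])
    moreover have "spec_pair A (g + h) = face_spec_pair A G \<or> spec_pair A (g + h) = face_spec_pair A H"
      using spec_pair_add_cases[OF A gK hK] face_spec_pair_eq[OF A Gf g] face_spec_pair_eq[OF A Hf h] by simp
    ultimately have "pair_le (face_spec_pair A F) (face_spec_pair A G) \<or> pair_le (face_spec_pair A F) (face_spec_pair A H)"
      using face_spec_pair_eq[OF A Ff f] by auto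
    then show False using dom G H unfolding dominates_subfaces_def not_pair_le_iff[symmetric] by blast
  qed
  ultimately show ?thesis by (simp add: semi_distinguished_def)
qed

lemma semi_distinguished_imp_dominates:
  assumes A: "cone_map A K" and F: "invariant_face A K F" and E: "dual_exposing F"
    and semi: "semi_distinguished A K F"
  shows "dominates_subfaces A K F"
  unfolding dominates_subfaces_def
proof (intro allI impI)
  fix G assume G: "invariant_face A K G \<and> G \<subset> F"
  have K: "pointed_cone K" using cone_mapD(1)[OF A] .
  have Ff: "cone_face F K" using F by (simp add: invariant_face_iff)
  have AF: "cone_map A F" using cone_map_invariant_face[OF A F] .
  obtain B where "adjoint_cone A B F" using adjoint_cone_exists[OF AF] by metis
  then interpret adj: adjoint_cone A B F .
  obtain x \<mu> where x: "x \<in> rel_interior F" "gen_eigvec A \<mu> (cvec x)" using semi by (auto simp: semi_distinguished_def)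
  have inv: "invariant_face A K G \<and> G \<subset> F"
    if "cone_face G F" "\<And>x. x \<in> G \<Longrightarrow> A *v x \<in> G" "G \<noteq> F" for G
    using that cone_face_trans[OF Ff that(1)] cone_faceD(2)[OF that(1)] by (auto simp: invariant_face_iff)
  show "pair_less (face_spec_pair A G) (face_spec_pair A F)"
  proof (rule adj.gen_eigvec_irreducible_imp_dominating[OF E x])
    show "cone_face G F" using G cone_face_subset[OF _ Ff] by (auto simp: invariant_face_iff)
    show "A *v y \<in> G" if "y \<in> G" for y using G that by (auto simp: invariant_face_iff)
    show "G \<noteq> F" using G by blast
    fix G H assume GH: "cone_face G F" "\<And>x. x \<in> G \<Longrightarrow> A *v x \<in> G" "G \<noteq> F"
      "cone_face H F" "\<And>x. x \<in> H \<Longrightarrow> A *v x \<in> H" "H \<noteq> F"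
    have iG: "invariant_face A K G" "G \<subset> F" using inv[OF GH(1-3)] by blast+
    have iH: "invariant_face A K H" "H \<subset> F" using inv[OF GH(4-6)] by blast+
    let ?J = "face_join K G H"
    have J: "invariant_face A K ?J" by (rule face_join_invariant[OF A iG(1) iH(1)])
    have "G \<union> H \<subseteq> F" using iG iH by blast
    note JF = cone_face_gen[OF Ff this, folded face_join_def]
    have "?J \<noteq> F" using semi iG iH unfolding semi_distinguished_def join_irreducible_face_def by blast
    moreover have "cone_face ?J F" by (rule cone_face_subset[OF JF(1) Ff JF(3)])
    ultimately show "\<exists>J. cone_face J F \<and> (\<forall>x\<in>J. A *v x \<in> J) \<and> J \<noteq> F \<and> G \<subseteq> J \<and> H \<subseteq> J"
      using J JF(2) by (intro exI[of _ ?J]) (auto simp: invariant_face_iff)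
  qed
qed

text \<open>Among the invariant subfaces with the spectral pair of \<open>F\<close> take one of
  least dimension. A smaller invariant face has at most this pair, and by minimality not the same
  one, so the chosen face dominates its subfaces.\<close>

lemma semi_distinguished_subface_exists:
  assumes A: "cone_map A K" and F: "invariant_face A K F" "F \<noteq> {0}"
    and E: "\<And>G. cone_face G K \<Longrightarrow> dual_exposing G"
  obtains G where "G \<subseteq> F" "semi_distinguished A K G" "face_spec_pair A G = face_spec_pair A F"
proof -
  have K: "pointed_cone K" using cone_mapD(1)[OF A] .
  let ?P = "\<lambda>G. invariant_face A K G \<and> G \<subseteq> F \<and> face_spec_pair A G = face_spec_pair A F"
  have "?P F" using F(1) by simp
  then obtain G where G: "?P G" "\<And>H. ?P H \<Longrightarrow> dim G \<le> dim H"
    using ex_has_least_nat[of ?P F dim] by blast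
  have Ff: "cone_face F K" and Gf: "cone_face G K" using F(1) G(1) by (auto simp: invariant_face_iff)
  have "G \<noteq> {0}"
  proof
    assume G0: "G = {0}"
    obtain x where x: "x \<in> rel_interior F" using rel_interior_face_nonempty[OF Ff] by blast
    have "x \<noteq> 0" by (rule rel_interior_pointed_cone_nonzero[OF pointed_cone_face[OF K Ff] F(2) x])
    moreover have "x \<in> K" using x rel_interior_subset cone_faceD(2)[OF Ff] by blast
    ultimately have "1 \<le> snd (face_spec_pair A F)"
      using spec_pair_snd_pos(1)[OF A] face_spec_pair_eq[OF A Ff x] by simp
    moreover have "face_spec_pair A G = (0, 0)" using face_spec_pair_eq[OF A Gf, of 0] G0 by simp
    ultimately show False using G(1) by simp
  qed
  moreover have "dominates_subfaces A K G"
    unfolding dominates_subfaces_def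
  proof (intro allI impI)
    fix H assume H: "invariant_face A K H \<and> H \<subset> G"
    have Hf: "cone_face H K" using H by (simp add: invariant_face_iff)
    have le: "pair_le (face_spec_pair A H) (face_spec_pair A G)" by (rule face_spec_pair_mono[OF A Hf Gf]) (use H in blast)
    moreover have "face_spec_pair A H \<noteq> face_spec_pair A G"
    proof
      assume "face_spec_pair A H = face_spec_pair A G"
      then have "?P H" using H G(1) by auto
      then have "H = G" using cone_face_dim_eq[OF Hf Gf] G(2) H by blast
      then show False using H by blast
    qed
    ultimately show "pair_less (face_spec_pair A H) (face_spec_pair A G)" by (simp add: pair_less_def)
  qed
  ultimately have "semi_distinguished A K G"
    using dominates_imp_semi_distinguished[OF A _ _ E[OF Gf]] G(1) by blast
  then show ?thesis using that G(1) by blast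
qed

text \<open>The span consists of differences of members of \<open>F\<close>, whose pairs are bounded
  by (r, m); so (A - r)^m kills the spectral component at \<open>r\<close> of every vector of the
  complexified span, and no eigenvalue there exceeds \<open>r\<close> in modulus. A relative
  interior point attains both bounds.\<close>

lemma face_spec_pair_restriction:
  assumes A: "cone_map A F" and F: "F \<noteq> {0}"
  obtains r m where "face_spec_pair A F = (r, m)" "1 \<le> m" "0 \<le> r"
    "restr_radius A (span F) = r" "restr_index A (span F) (complex_of_real r) = m"
proof -
  have K: "pointed_cone F" using cone_mapD(1)[OF A] .
  have fF: "cone_face F F" by (rule cone_face_refl[OF pointed_coneD(1)[OF K]])
  obtain x0 where x0: "x0 \<in> rel_interior F" using rel_interior_face_nonempty[OF fF] by blast
  then have x0F: "x0 \<in> F" using rel_interior_subset by blast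
  have x0n: "x0 \<noteq> 0" by (rule rel_interior_pointed_cone_nonzero[OF K F x0])
  obtain r m where rm: "spec_pair A x0 = (r, m)" "0 \<le> r" "1 \<le> m"
    "peak A r m x0 \<in> F" "peak A r m x0 \<noteq> 0" "rpact A ([:-r, 1:] ^ m) (rpact A (spectral_poly A r) x0) = 0"
    using spec_pair_props[OF A x0F x0n] by metis
  have sp: "face_spec_pair A F = (r, m)" using face_spec_pair_eq[OF A fF x0] rm(1) by simp
  have le: "pair_le (spec_pair A f) (r, m)" if "f \<in> F" for f using face_spec_pair_ge[OF A fF that] sp by simp
  obtain bs where bs: "restriction_basis A (span F) bs" "restr_mat A (span F) = restriction_basis.R A bs"
    using restriction_basis_some[OF subspace_span cone_map_span[OF A]] by metis
  interpret B: restriction_basis A "span F" bs by (rule bs(1))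
  let ?d = "length bs" and ?L = "[:- complex_of_real r, 1:]" and ?e = "spectral_poly A r"
  let ?E = "cpoly ?e"
  have span_diff: "\<exists>a b. a \<in> F \<and> b \<in> F \<and> u = a - b" if "u \<in> span F" for u
    using span_convex_cone[OF pointed_coneD(1)[OF K] that] by metis
  have top: "cpact A (?L ^ m) (cpact A ?E (cvec u)) = 0" if u: "u \<in> span F" for u
  proof -
    obtain a b where ab: "a \<in> F" "b \<in> F" "u = a - b" using span_diff[OF u] by blast
    have "rpact A ([:-r, 1:] ^ m) (rpact A ?e u) = 0"
      unfolding ab(3) R.pact_vdiff using peak_le_mem(2)[OF A ab(1) rm(3) le[OF ab(1)]]
        peak_le_mem(2)[OF A ab(2) rm(3) le[OF ab(2)]] by simp
    then show ?thesis unfolding cpoly_linear_power[symmetric] cpact_cvec by simp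
  qed
  have topc: "cpact A (?L ^ m) (cpact A ?E (B.comb v)) = 0" for v
    unfolding B.comb_def C.pact_vsum C.pact_vscale using top[OF B.nth_V] by simp
  have idem: "cpact A ?E (cpact A ?E (B.comb v)) = cpact A ?E (B.comb v)" for v
    unfolding B.comb_def C.pact_vsum C.pact_vscale cpact_cvec spectral_poly_idem by (rule refl)
  \<comment> \<open>A vector killed by a power of A - r is fixed by the spectral polynomial: the
    difference \<open>?w\<close> lies in the same generalized eigenspace and is killed by that
    polynomial. Then \<open>topc\<close> applies.\<close>
  have stab: "cpact A (?L ^ m) (B.comb v) = 0" if k: "cpact A (?L ^ k) (B.comb v) = 0" for v k
  proof -
    let ?w = "B.comb v + - cpact A ?E (B.comb v)"
    have g: "cgen A (of_real r) (B.comb v)" using k by (auto simp: C.gen_comp_def)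
    have "cgen A (of_real r) ?w" by (intro C.gen_comp_add C.gen_comp_minus C.gen_comp_pact g)
    moreover have "cpact A ?E ?w = 0" by (simp only: C.pact_vadd C.pact_vminus idem) simp
    moreover have "poly ?E (of_real r) \<noteq> 0" by (simp add: poly_cpoly spectral_poly_at)
    ultimately have "?w = 0" by (rule C.gen_comp_coprime)
    then have "cpact A ?E (B.comb v) = B.comb v" by simp
    then show ?thesis using topc[of v] by simp
  qed
  have eS: "rpact A ?e x0 \<in> span F" by (rule rpact_subspace[OF subspace_span cone_map_span[OF A] span_base[OF x0F]])
  let ?v = "B.coords (rpact A ?e x0)"
  have cv: "B.comb ?v = cvec (rpact A ?e x0)" by (rule B.comb_coords[OF eS])
  have v1: "cpact A (?L ^ m) (B.comb ?v) = 0"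
    unfolding cv cpoly_linear_power[symmetric] cpact_cvec using rm(6) by simp
  have v2: "cpact A (?L ^ (m - 1)) (B.comb ?v) \<noteq> 0"
    unfolding cv cpoly_linear_power[symmetric] cpact_cvec using rm(5) by (simp add: peak_def)
  have "restr_index A (span F) (complex_of_real r) = m"
    unfolding restr_index_def bs(2)
  proof (rule jordan_nf_index_eq[OF B.R_carrier rm(3) _ B.coords_carrier])
    fix v k assume "v \<in> carrier_vec ?d" "(char_matrix B.R (of_real r) ^\<^sub>m k) *\<^sub>v v = 0\<^sub>v ?d"
    then show "(char_matrix B.R (of_real r) ^\<^sub>m m) *\<^sub>v v = 0\<^sub>v ?d"
      using stab B.comb_char_matrix_eq_0 by blast
  next
    show "(char_matrix B.R (of_real r) ^\<^sub>m m) *\<^sub>v ?v = 0\<^sub>v ?d"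
      using v1 B.comb_char_matrix_eq_0[OF B.coords_carrier] by blast
    show "(char_matrix B.R (of_real r) ^\<^sub>m (m - 1)) *\<^sub>v ?v \<noteq> 0\<^sub>v ?d"
      using v2 B.comb_char_matrix_eq_0[OF B.coords_carrier] by blast
  qed
  moreover have "restr_radius A (span F) = r"
  proof -
    have d: "?d > 0"
    proof (rule ccontr)
      assume "\<not> ?thesis"
      then have "{..<?d} = {}" by simp
      then have "B.comb ?v = 0" unfolding B.comb_def by (simp only: sum.empty)
      then show False using v2 by simp
    qed
    have spec: "\<mu> \<in> spectrum B.R \<longleftrightarrow> (\<exists>v\<in>carrier_vec ?d. v \<noteq> 0\<^sub>v ?d \<and> cmat A *v B.comb v = \<mu> *s B.comb v)" for \<mu>
    proof -
      have C: "char_matrix B.R \<mu> \<in> carrier_mat ?d ?d" by (rule char_matrix_closed[OF B.R_carrier])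
      have C1: "char_matrix B.R \<mu> ^\<^sub>m 1 = char_matrix B.R \<mu>" using C by (simp add: left_mult_one_mat[of _ ?d ?d])
      have "char_matrix B.R \<mu> *\<^sub>v v = 0\<^sub>v ?d \<longleftrightarrow> cmat A *v B.comb v = \<mu> *s B.comb v" if v: "v \<in> carrier_vec ?d" for v
        using B.comb_char_matrix_eq_0[OF v, of \<mu> 1] unfolding C1 by (simp add: C.pact_linear)
      then show ?thesis unfolding spectrum_def eigenvalue_def eigenvector_char_matrix[OF B.R_carrier] mem_Collect_eq by blast
    qed
    have roots: "\<exists>p. p \<noteq> 0 \<and> cpact A p (cvec u) = 0 \<and> (\<forall>\<nu>. poly p \<nu> = 0 \<longrightarrow> cmod \<nu> \<le> r)" if u: "u \<in> span F" for u
    proof -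
      have f: "\<exists>p. p \<noteq> 0 \<and> cpact A p (cvec f) = 0 \<and> (\<forall>\<nu>. poly p \<nu> = 0 \<longrightarrow> cmod \<nu> \<le> r)" if f: "f \<in> F" for f
      proof (cases "f = 0")
        case True
        then show ?thesis by (intro exI[of _ 1]) simp
      next
        case False
        obtain r' m' where r': "spec_pair A f = (r', m')" "\<And>\<nu>. poly (cmin A (cvec f)) \<nu> = 0 \<Longrightarrow> cmod \<nu> \<le> r'"
          using spec_pair_props[OF A f False] by metis
        have "r' \<le> r" using le[OF f] r'(1) by (auto simp: pair_le_def)
        then show ?thesis using r'(2) cmin(1)[of A "cvec f"] cmin_kill[of A "cvec f"]
          by (intro exI[of _ "cmin A (cvec f)"]) fastforce
      qed
      obtain a b where ab: "a \<in> F" "b \<in> F" "u = a - b" using span_diff[OF u] by blast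
      obtain p where p: "p \<noteq> 0" "cpact A p (cvec a) = 0" "\<forall>\<nu>. poly p \<nu> = 0 \<longrightarrow> cmod \<nu> \<le> r" using f[OF ab(1)] by blast
      obtain q where q: "q \<noteq> 0" "cpact A q (cvec b) = 0" "\<forall>\<nu>. poly q \<nu> = 0 \<longrightarrow> cmod \<nu> \<le> r" using f[OF ab(2)] by blast
      have "cpact A (p * q) (cvec u) = 0"
        unfolding ab(3) cvec_diff C.pact_vdiff using p(2) q(2) C.pact_dvd[of p "p * q" A] C.pact_dvd[of q "p * q" A] by simp
      then show ?thesis using p q by (intro exI[of _ "p * q"]) auto
    qed
    have upper: "cmod \<mu> \<le> r" if \<mu>: "\<mu> \<in> spectrum B.R" for \<mu>
    proof -
      obtain v where v: "v \<in> carrier_vec ?d" "v \<noteq> 0\<^sub>v ?d" "cmat A *v B.comb v = \<mu> *s B.comb v" using \<mu> spec by blast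
      have y0: "B.comb v \<noteq> 0" using B.comb_inj[OF v(1)] v(2) by blast
      obtain p where p: "\<And>i. i < ?d \<Longrightarrow> p i \<noteq> 0 \<and> cpact A (p i) (cvec (bs ! i)) = 0 \<and> (\<forall>\<nu>. poly (p i) \<nu> = 0 \<longrightarrow> cmod \<nu> \<le> r)"
        using roots[OF B.nth_V] by metis
      define P where "P = (\<Prod>i<?d. p i)"
      have "cpact A P (cvec (bs ! i)) = 0" if "i < ?d" for i
      proof -
        have "p i dvd P" unfolding P_def using that by (intro dvd_prodI) auto
        then show ?thesis using C.pact_dvd p[OF that] by blast
      qed
      then have "cpact A P (B.comb v) = 0" unfolding B.comb_def C.pact_vsum C.pact_vscale by simp
      moreover have "cpact A P (B.comb v) = poly P \<mu> *s B.comb v" by (rule C.pact_eigen[OF v(3)])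
      ultimately have "poly P \<mu> = 0" using y0 by simp
      then obtain i where "i < ?d" "poly (p i) \<mu> = 0" unfolding P_def poly_prod by auto
      then show ?thesis using p by blast
    qed
    have "complex_of_real r \<in> spectrum B.R"
    proof -
      let ?u = "peak A r m x0"
      have uS: "?u \<in> span F" using rm(4) by (rule span_base)
      have cu: "B.comb (B.coords ?u) = cvec ?u" by (rule B.comb_coords[OF uS])
      have "A *v ?u = r *\<^sub>R ?u" by (rule peak_eigen[OF rm(3,6)])
      then have "cmat A *v cvec ?u = of_real r *s cvec ?u" by (simp only: cvec_matrix cvec_scaleR)
      moreover have "B.coords ?u \<noteq> 0\<^sub>v ?d"
      proof
        assume "B.coords ?u = 0\<^sub>v ?d"
        then have "cvec ?u = 0" using cu B.comb_zero by metis
        then show False using rm(5) by simp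
      qed
      ultimately show ?thesis unfolding spec using B.coords_carrier cu by (intro bexI[of _ "B.coords ?u"]) auto
    qed
    then have "r \<in> norm ` spectrum B.R" using rm(2) by (metis abs_of_nonneg image_eqI norm_of_real)
    then have "r \<le> spectral_radius B.R" by (rule spectral_radius_mem_max(2)[OF B.R_carrier d])
    moreover have "spectral_radius B.R \<le> r" using spectral_radius_mem_max(1)[OF B.R_carrier d] upper by auto
    ultimately show ?thesis unfolding restr_radius_def bs(2) by simp
  qed
  ultimately show ?thesis using that[OF sp rm(3,2)] by blast
qed

text \<open>For \<open>cond_index\<close>, a semi-distinguished subface with the pair (\<mu>, m) of
  \<open>F\<close> has a generalized eigenvector in its relative interior. In a cone this must
  belong to \<mu> and have order m, and m is the index by
  \<open>face_spec_pair_restriction\<close>.\<close>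

lemma semi_distinguished_conditions:
  assumes A: "cone_map A K" and E: "\<And>G. cone_face G K \<Longrightarrow> dual_exposing G"
  shows "cond_subface A K \<mu>" "cond_index A K \<mu>" "cond_dominating A K \<mu>" "cond_relint A K \<mu>"
proof -
  have sub: "has_semi_distinguished_subface A K F" if F: "invariant_face A K F" "F \<noteq> {0}" for F
  proof -
    obtain G where "G \<subseteq> F" "semi_distinguished A K G" "face_spec_pair A G = face_spec_pair A F"
      using semi_distinguished_subface_exists[OF A F E] by blast
    then show ?thesis unfolding has_semi_distinguished_subface_def by blast
  qed
  show "cond_subface A K \<mu>" using sub by (simp add: cond_subface_def associated_face_def)
  show "cond_dominating A K \<mu>"
    unfolding cond_dominating_def associated_face_def
    using dominates_imp_semi_distinguished[OF A _ _ E] by (auto simp: invariant_face_iff)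
  show "cond_relint A K \<mu>"
    unfolding cond_relint_def
  proof (intro allI impI)
    fix F assume F: "invariant_face A K F \<and> (\<exists>x\<in>rel_interior F. gen_eigvec A (complex_of_real \<mu>) (cvec x))"
    then have "F \<noteq> {0}" by (auto simp: gen_eigvec_iff)
    then show "has_semi_distinguished_subface A K F" using sub F by blast
  qed
  show "cond_index A K \<mu>"
    unfolding cond_index_def
  proof (intro allI impI)
    fix F assume "associated_face A K \<mu> F"
    then have F: "invariant_face A K F" "F \<noteq> {0}" "restr_radius A (span F) = \<mu>" by (auto simp: associated_face_def)
    have Ff: "cone_face F K" using F(1) by (simp add: invariant_face_iff)
    obtain r m where rm: "face_spec_pair A F = (r, m)" "0 \<le> r" "restr_radius A (span F) = r"
      "restr_index A (span F) (complex_of_real r) = m"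
      using face_spec_pair_restriction[OF cone_map_invariant_face[OF A F(1)] F(2)] by metis
    have r: "r = \<mu>" using rm(3) F(3) by simp
    obtain G where G: "G \<subseteq> F" "semi_distinguished A K G" "face_spec_pair A G = face_spec_pair A F"
      using semi_distinguished_subface_exists[OF A F(1,2) E] by blast
    obtain x \<nu> where x: "x \<in> rel_interior G" "gen_eigvec A \<nu> (cvec x)" using G(2) by (auto simp: semi_distinguished_def)
    have Gf: "cone_face G K" using G(2) by (auto simp: semi_distinguished_def join_irreducible_face_def invariant_face_iff)
    have xG: "x \<in> G" using x(1) rel_interior_subset by blast
    have sx: "spec_pair A x = (\<mu>, m)" using face_spec_pair_eq[OF A Gf x(1)] G(3) rm(1) r by simp
    have xK: "x \<in> K" using xG cone_faceD(2)[OF Gf] by blast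
    have nu: "\<nu> = complex_of_real \<mu>" using gen_eigvec_in_cone(1)[OF A xK x(2)] sx by simp
    have "eigvec_order A (complex_of_real \<mu>) (cvec x) = m" using spec_pair_gen_eigvec[OF x(2)] sx nu by simp
    then show "\<exists>x\<in>F. gen_eigvec A (complex_of_real \<mu>) (cvec x) \<and>
        eigvec_order A (complex_of_real \<mu>) (cvec x) = restr_index A (span F) (complex_of_real \<mu>)"
      using x(2) nu rm(4) r xG G(1) by (intro bexI[of _ x]) auto
  qed
qed

section \<open>Polyhedral, smooth and perfect cones\<close>

text \<open>Each constraint is either slack, and then tolerates some positive multiple of
  \<open>z\<close>, or tight, and then subtracting \<open>z\<close> does no harm; finiteness allows
  one common multiple.\<close>

lemma interior_dual_finite:
  assumes "finite R" "\<And>x. x \<in> R \<Longrightarrow> 0 \<le> v \<bullet> x" "\<And>x. x \<in> R \<Longrightarrow> v \<bullet> x = 0 \<Longrightarrow> z \<bullet> x \<le> 0"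
  obtains e where "e > 0" "\<And>x. x \<in> R \<Longrightarrow> 0 \<le> (v - e *\<^sub>R z) \<bullet> x"
proof -
  have "\<exists>e>0. \<forall>x\<in>R. 0 \<le> (v - e *\<^sub>R z) \<bullet> x"
    using assms
  proof (induction R rule: finite_induct)
    case empty
    then show ?case by (intro exI[of _ 1]) simp
  next
    case (insert x R)
    then obtain e where e: "e > 0" "\<forall>x\<in>R. 0 \<le> (v - e *\<^sub>R z) \<bullet> x" by auto
    have vx: "0 \<le> v \<bullet> x" using insert.prems by simp
    have "\<exists>d>0. 0 \<le> (v - d *\<^sub>R z) \<bullet> x"
    proof (cases "z \<bullet> x \<le> 0")
      case True
      then show ?thesis using vx by (intro exI[of _ 1]) (simp add: inner_diff_left)
    next
      case False
      then have "0 < v \<bullet> x" using insert.prems(2)[of x] vx by fastforce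
      then show ?thesis using False by (intro exI[of _ "(v \<bullet> x) / (z \<bullet> x)"]) (simp add: inner_diff_left)
    qed
    then obtain d where d: "d > 0" "0 \<le> (v - d *\<^sub>R z) \<bullet> x" by blast
    have shrink: "0 \<le> (v - min d e *\<^sub>R z) \<bullet> y" if y: "0 \<le> v \<bullet> y" "0 \<le> (v - c *\<^sub>R z) \<bullet> y" "min d e \<le> c" for y c
    proof (cases "z \<bullet> y \<le> 0")
      case True
      then have "min d e * (z \<bullet> y) \<le> 0" using d(1) e(1) by (intro mult_nonneg_nonpos) auto
      then show ?thesis using y(1) by (simp add: inner_diff_left)
    next
      case False
      then have "min d e * (z \<bullet> y) \<le> c * (z \<bullet> y)" using y(3) by (intro mult_right_mono) auto
      then show ?thesis using y(2) by (simp add: inner_diff_left)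
    qed
    have "0 \<le> (v - min d e *\<^sub>R z) \<bullet> y" if "y \<in> insert x R" for y
    proof (cases "y = x")
      case True
      then show ?thesis using shrink[OF vx d(2)] by simp
    next
      case False
      then have "y \<in> R" using that by simp
      then show ?thesis using shrink[of y e] e(2) insert.prems(1) by simp
    qed
    then show ?case using d(1) e(1) by (intro exI[of _ "min d e"]) auto
  qed
  then show ?thesis using that by blast
qed

lemma convex_cone_hull_nonneg:
  assumes "x \<in> convex_cone hull R" "\<And>y. y \<in> R \<Longrightarrow> 0 \<le> z \<bullet> y"
  shows "0 \<le> z \<bullet> x"
proof -
  have "convex_cone hull R \<subseteq> {x. z \<bullet> x \<ge> 0}"
  proof (rule hull_minimal)
    show "R \<subseteq> {x. z \<bullet> x \<ge> 0}" using assms(2) by blast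
  qed (rule convex_cone_halfspace_ge)
  then show ?thesis using assms(1) by blast
qed

text \<open>Membership in the dual is tested on finitely many generators; those at which
  \<open>v\<close> vanishes are also zeros of \<open>z\<close>, so
  \<open>interior_dual_finite\<close> applies.\<close>

lemma dual_exposing_finitely_generated:
  assumes "finite R" "R \<subseteq> F" "F \<subseteq> convex_cone hull R"
  shows "dual_exposing F"
  unfolding dual_exposing_def
proof (intro ballI impI)
  fix v z assume v: "v \<in> dual_cone F" and z: "z \<in> dual_cone F" and vz: "\<forall>x\<in>F. v \<bullet> x = 0 \<longrightarrow> z \<bullet> x = 0"
  obtain e where e: "e > 0" "\<And>x. x \<in> R \<Longrightarrow> 0 \<le> (v - e *\<^sub>R z) \<bullet> x"
    by (rule interior_dual_finite[OF assms(1), of v z]) (use v vz assms(2) in \<open>auto simp: dual_cone_def\<close>)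
  have "0 \<le> (v - e *\<^sub>R z) \<bullet> x" if "x \<in> F" for x
    by (rule convex_cone_hull_nonneg[OF _ e(2)]) (use that assms(3) in blast)+
  moreover have "v - e *\<^sub>R z \<in> span F" using v z by (auto simp: dual_cone_def intro: span_diff span_scale)
  ultimately show "\<exists>e>0. v - e *\<^sub>R z \<in> dual_cone F" using e(1) by (intro exI[of _ e]) (simp add: dual_cone_def)
qed

lemma dual_exposing_if_pos:
  assumes F: "pointed_cone F" and v: "v \<in> dual_cone F" and z: "z \<in> dual_cone F"
    and pos: "\<And>x. x \<in> F \<Longrightarrow> x \<noteq> 0 \<Longrightarrow> v \<bullet> x \<noteq> 0"
  shows "\<exists>e>0. v - e *\<^sub>R z \<in> dual_cone F"
proof -
  have "0 < v \<bullet> x" if "x \<in> F" "x \<noteq> 0" for x using pos[OF that] v that(1) by (force simp: dual_cone_def)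
  then obtain e where e: "e > 0" "\<And>x. x \<in> F \<Longrightarrow> 0 \<le> (v - e *\<^sub>R z) \<bullet> x"
    using interior_dual[OF pointed_coneD(1,2)[OF F], of v z] by metis
  moreover have "v - e *\<^sub>R z \<in> span F" using v z by (auto simp: dual_cone_def intro: span_diff span_scale)
  ultimately show ?thesis by (intro exI[of _ e]) (simp add: dual_cone_def)
qed

section \<open>Generators of polyhedral cones\<close>

lemma extreme_ray_trans: "cone_face F K \<Longrightarrow> extreme_ray R F \<Longrightarrow> extreme_ray R K"
  unfolding extreme_ray_def using cone_face_trans by blast

lemma polyhedral_cone_face:
  assumes "cone_face F K" "polyhedral_cone K"
  shows "polyhedral_cone F"
  using assms(2) finite_subset[of "{R. extreme_ray R F}" "{R. extreme_ray R K}"] extreme_ray_trans[OF assms(1)]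
  unfolding polyhedral_cone_def by blast

lemma pointed_cone_base:
  fixes F :: "'a::euclidean_space set"
  assumes F: "pointed_cone F" and z: "\<And>x. x \<in> F \<Longrightarrow> x \<noteq> 0 \<Longrightarrow> 0 < z \<bullet> x"
  shows "compact {x \<in> F. z \<bullet> x = 1}" "convex {x \<in> F. z \<bullet> x = 1}"
proof -
  let ?S = "{x \<in> F. z \<bullet> x = 1}"
  have S: "?S = F \<inter> {x. z \<bullet> x = 1}" by blast
  show "convex ?S" unfolding S using pointed_coneD(4)[OF F] convex_hyperplane by (rule convex_Int)
  have cl: "closed ?S" unfolding S using pointed_coneD(2)[OF F] closed_hyperplane by (rule closed_Int)
  have "bounded ?S"
  proof -
    obtain c where c: "c > 0" "\<And>x. x \<in> F \<Longrightarrow> c * norm x \<le> z \<bullet> x"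
      using positive_functional_coercive[OF pointed_coneD(1,2)[OF F] z] by metis
    have "norm x \<le> 1 / c" if x: "x \<in> ?S" for x using c(2)[of x] x c(1) by (simp add: field_simps)
    then show ?thesis by (intro boundedI)
  qed
  then show "compact ?S" using cl by (simp add: compact_eq_bounded_closed)
qed

text \<open>If a + b lies on the ray of \<open>x\<close>, rescaling \<open>a\<close> and
  \<open>b\<close> into the slice exhibits \<open>x\<close> as a convex combination of the two with
  weights s/(s + t) and t/(s + t); extremality makes both equal to \<open>x\<close>.\<close>

lemma extreme_ray_of_base_point:
  fixes F :: "'a::euclidean_space set"
  assumes F: "pointed_cone F" and z: "\<And>x. x \<in> F \<Longrightarrow> x \<noteq> 0 \<Longrightarrow> 0 < z \<bullet> x"
    and x: "x extreme_point_of {x \<in> F. z \<bullet> x = 1}"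
  shows "extreme_ray {c *\<^sub>R x | c. 0 \<le> c} F"
proof -
  let ?R = "{c *\<^sub>R x | c. 0 \<le> c}"
  have xF: "x \<in> F" "z \<bullet> x = 1" using x by (auto simp: extreme_point_of_def)
  then have x0: "x \<noteq> 0" by auto
  have key: "a \<in> ?R" if a: "a \<in> F" and b: "b \<in> F" and ab: "a + b \<in> ?R" for a b
  proof (cases "a = 0 \<or> b = 0")
    case True
    then show ?thesis
    proof
      assume "a = 0" then show ?thesis by (auto intro!: exI[of _ 0])
    next
      assume "b = 0" then show ?thesis using ab by simp
    qed
  next
    case False
    define s t where "s = z \<bullet> a" and "t = z \<bullet> b"
    have st: "s > 0" "t > 0" using z a b False by (auto simp: s_def t_def)
    obtain c where c: "0 \<le> c" "a + b = c *\<^sub>R x" using ab by blast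
    have cst: "c = s + t" using arg_cong[OF c(2), of "\<lambda>y. z \<bullet> y"] xF(2) by (simp add: s_def t_def inner_add_right)
    let ?a = "(1/s) *\<^sub>R a" and ?b = "(1/t) *\<^sub>R b"
    have aS: "?a \<in> {x \<in> F. z \<bullet> x = 1}" using st(1) pointed_coneD(8)[OF F, of "1/s" a] a by (simp add: s_def)
    have bS: "?b \<in> {x \<in> F. z \<bullet> x = 1}" using st(2) pointed_coneD(8)[OF F, of "1/t" b] b by (simp add: t_def)
    have "?a = x"
    proof (cases "?a = ?b")
      case True
      have sa: "a = s *\<^sub>R ?a" using st by simp
      have tb: "b = t *\<^sub>R ?a" unfolding True using st by simp
      have "c *\<^sub>R x = s *\<^sub>R ?a + t *\<^sub>R ?a"
        using arg_cong2[OF sa tb, of "(+)"] c(2) by simp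
      then have "c *\<^sub>R x = c *\<^sub>R ?a" unfolding cst scaleR_add_left .
      moreover have "c \<noteq> 0" using cst st by simp
      ultimately show ?thesis by (simp only: scaleR_cancel_left) simp
    next
      case False
      have "x = (1/c) *\<^sub>R (a + b)" using c(2) cst st by simp
      also have "\<dots> = (1 - t/c) *\<^sub>R ?a + (t/c) *\<^sub>R ?b"
      proof -
        have "(1 - t/c) * (1/s) = 1/c" "(t/c) * (1/t) = 1/c" using cst st by (simp_all add: field_simps)
        then show ?thesis by (simp only: scaleR_scaleR scaleR_add_right)
      qed
      finally have "x = (1 - t/c) *\<^sub>R ?a + (t/c) *\<^sub>R ?b" .
      moreover have "0 < t/c" "t/c < 1" using cst st by auto
      ultimately have "x \<in> open_segment ?a ?b" using False unfolding in_segment by blast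
      then show ?thesis using x aS bS unfolding extreme_point_of_def by blast
    qed
    then have "a = s *\<^sub>R x" using st(1) by auto
    then show ?thesis using st(1) by (auto intro!: exI[of _ s])
  qed
  have "cone_face ?R F"
    unfolding cone_face_def convex_cone_iff
  proof (intro conjI ballI impI allI)
    show "0 \<in> ?R" by (auto intro!: exI[of _ 0])
    show "?R \<subseteq> F" using xF(1) pointed_coneD(8)[OF F] by auto
    show "y + w \<in> ?R" if "y \<in> ?R" "w \<in> ?R" for y w
    proof -
      obtain c d where "y = c *\<^sub>R x" "w = d *\<^sub>R x" "0 \<le> c" "0 \<le> d" using \<open>y \<in> ?R\<close> \<open>w \<in> ?R\<close> by blast
      then show ?thesis by (auto intro!: exI[of _ "c + d"] simp: scaleR_add_left)
    qed
    show "c *\<^sub>R y \<in> ?R" if "y \<in> ?R" "0 \<le> c" for y and c :: real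
    proof -
      obtain d where "y = d *\<^sub>R x" "0 \<le> d" using \<open>y \<in> ?R\<close> by blast
      then show ?thesis using \<open>0 \<le> c\<close> by (auto intro!: exI[of _ "c * d"])
    qed
    show "a \<in> ?R" if "a \<in> F" "b \<in> F" "a + b \<in> ?R" for a b using key that .
    show "b \<in> ?R" if "a \<in> F" "b \<in> F" "a + b \<in> ?R" for a b using key[of b a] that by (simp add: add.commute)
  qed
  then show ?thesis using x0 unfolding extreme_ray_def by blast
qed

text \<open>By Minkowski's theorem a compact base is the convex hull of its extreme points. Distinct
  extreme points generate distinct extreme rays, so there are only finitely many.\<close>

lemma polyhedral_cone_generators:
  fixes F :: "'a::euclidean_space set"
  assumes F: "pointed_cone F" and P: "polyhedral_cone F"
  obtains R where "finite R" "R \<subseteq> F" "F \<subseteq> convex_cone hull R"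
proof -
  obtain z where z: "\<And>x. x \<in> F \<Longrightarrow> x \<noteq> 0 \<Longrightarrow> 0 < z \<bullet> x" using dual_cone_strictly_positive[OF F] by metis
  let ?S = "{x \<in> F. z \<bullet> x = 1}"
  let ?R = "{x. x extreme_point_of ?S}"
  let ?f = "\<lambda>x. {c *\<^sub>R x | c. 0 \<le> c}"
  have S: "?S = convex hull ?R" by (rule Krein_Milman_Minkowski[OF pointed_cone_base[OF F z]])
  have RS: "?R \<subseteq> ?S" by (auto simp: extreme_point_of_def)
  have inj: "inj_on ?f ?R"
  proof (rule inj_onI)
    fix x y assume x: "x \<in> ?R" and y: "y \<in> ?R" and eq: "?f x = ?f y"
    have "x \<in> ?f x" by (auto intro!: exI[of _ 1])
    then obtain c where c: "x = c *\<^sub>R y" using eq by blast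
    have "z \<bullet> x = 1" "z \<bullet> y = 1" using x y RS by auto
    then have "c = 1" using c by simp
    then show "x = y" using c by simp
  qed
  have "?f ` ?R \<subseteq> {R. extreme_ray R F}" using extreme_ray_of_base_point[OF F z] by blast
  then have "finite (?f ` ?R)" using P finite_subset unfolding polyhedral_cone_def by blast
  then have fin: "finite ?R" using finite_imageD[OF _ inj] by blast
  have "F \<subseteq> convex_cone hull ?R"
  proof
    fix x assume x: "x \<in> F"
    show "x \<in> convex_cone hull ?R"
    proof (cases "x = 0")
      case True
      then show ?thesis by (simp add: convex_cone_hull_contains_0)
    next
      case False
      then have p: "0 < z \<bullet> x" using z x by blast
      then have "(1 / (z \<bullet> x)) *\<^sub>R x \<in> ?S" using x pointed_coneD(8)[OF F, of "1 / (z \<bullet> x)" x] by simp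
      then have "(1 / (z \<bullet> x)) *\<^sub>R x \<in> convex hull ?R" using S by blast
      then have "(1 / (z \<bullet> x)) *\<^sub>R x \<in> convex_cone hull ?R" using convex_hull_subset_convex_cone_hull by blast
      from convex_cone_scaleR[OF convex_cone_convex_cone_hull less_imp_le[OF p] this]
      show ?thesis using p by simp
    qed
  qed
  then show ?thesis using that[OF fin] RS by blast
qed

lemma polyhedral_dual_exposing:
  assumes "pointed_cone F" "polyhedral_cone F"
  shows "dual_exposing F"
  using polyhedral_cone_generators[OF assms] dual_exposing_finitely_generated by metis

lemma dual_exposing_zero: "dual_exposing {0 :: 'a::euclidean_space}"
  unfolding dual_exposing_def
proof (intro ballI impI)
  fix v z :: 'a assume "v \<in> dual_cone {0}" "z \<in> dual_cone {0}"
  then have "v - 1 *\<^sub>R z \<in> dual_cone {0}" by (auto simp: dual_cone_def)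
  then show "\<exists>e>0. v - e *\<^sub>R z \<in> dual_cone {0}" by (intro exI[of _ 1]) simp
qed

lemma dual_faces_exposed_if_faces_polyhedral:
  assumes K: "pointed_cone K" and E: "facially_exposed (dual_cone K)"
    and P: "\<And>F. nontrivial_face F K \<Longrightarrow> polyhedral_cone F"
  shows "dual_faces_exposed K"
  unfolding dual_faces_exposed_iff[OF K]
proof (intro allI impI)
  fix F assume F: "cone_face F K"
  consider "F = {0}" | "F = K" | "nontrivial_face F K" using F by (auto simp: nontrivial_face_def)
  then show "dual_exposing F"
  proof cases
    case 1 then show ?thesis using dual_exposing_zero by simp
  next
    case 2 then show ?thesis using E facially_exposed_dual_iff[OF K] by simp
  next
    case 3 then show ?thesis using polyhedral_dual_exposing[OF pointed_cone_face[OF K F] P] by blast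
  qed
qed

lemma polyhedral_imp_hypotheses:
  assumes K: "pointed_cone K" and P: "polyhedral_cone K"
  shows "facially_exposed (dual_cone K)" "\<And>F. nontrivial_face F K \<Longrightarrow> polyhedral_cone F"
  using polyhedral_dual_exposing[OF K P] facially_exposed_dual_iff[OF K] polyhedral_cone_face[OF _ P]
  by (auto simp: nontrivial_face_def)

lemma one_dim_span:
  fixes S :: "'a::euclidean_space set"
  assumes "dim S = 1" "v \<in> S" "v \<noteq> 0" "z \<in> S"
  obtains c where "z = c *\<^sub>R v"
proof -
  have "span {v} = span S"
    by (rule dim_eq_span) (use assms in auto)
  then have "z \<in> span {v}" using assms(4) span_base by blast
  then show ?thesis using that by (auto simp: span_singleton)
qed

lemma one_dim_cone_polyhedral:
  fixes F :: "'a::euclidean_space set"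
  assumes F: "pointed_cone F" and d: "dim F = 1"
  shows "polyhedral_cone F"
proof -
  have "R = F" if R: "extreme_ray R F" for R
  proof -
    have Rf: "cone_face R F" using R by (simp add: extreme_ray_def)
    obtain x where x: "x \<noteq> 0" "R = {c *\<^sub>R x | c. 0 \<le> c}" using R by (auto simp: extreme_ray_def)
    then have xR: "x \<in> R" by (auto intro!: exI[of _ 1])
    have "dim {x} \<le> dim R" using xR by (intro dim_subset) auto
    moreover have "dim {x} = 1" using x(1) by simp
    ultimately have "dim F \<le> dim R" using d by simp
    then show "R = F" by (rule cone_face_dim_eq[OF Rf cone_face_refl[OF pointed_coneD(1)[OF F]] cone_faceD(2)[OF Rf]])
  qed
  then have "{R. extreme_ray R F} \<subseteq> {F}" by blast
  then show ?thesis unfolding polyhedral_cone_def using finite_subset by blast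
qed

text \<open>A nonzero \<open>v\<close> that vanishes at some nonzero \<open>x\<close> lies in the
  dual face of the face of \<open>x\<close>, which smoothness makes one-dimensional;
  \<open>z\<close> lies there too, so it is a multiple of \<open>v\<close>. If \<open>v\<close> is
  strictly positive instead, it is interior to the dual.\<close>

lemma smooth_imp_dual_exposing:
  fixes K :: "'a::euclidean_space set"
  assumes K: "pointed_cone K" and S: "smooth_cone K"
  shows "dual_exposing K"
  unfolding dual_exposing_def
proof (intro ballI impI)
  fix v z assume v: "v \<in> dual_cone K" and z: "z \<in> dual_cone K" and vz: "\<forall>x\<in>K. v \<bullet> x = 0 \<longrightarrow> z \<bullet> x = 0"
  show "\<exists>e>0. v - e *\<^sub>R z \<in> dual_cone K"
  proof (cases "\<exists>x\<in>K. x \<noteq> 0 \<and> v \<bullet> x = 0")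
    case False
    then show ?thesis using dual_exposing_if_pos[OF K v z] by blast
  next
    case True
    then obtain x where x: "x \<in> K" "x \<noteq> 0" "v \<bullet> x = 0" by blast
    show ?thesis
    proof (cases "v = 0")
      case True
      then have "\<And>x. x \<in> K \<Longrightarrow> z \<bullet> x = 0" using vz by simp
      then have "span K \<subseteq> {x. z \<bullet> x = 0}" by (intro span_minimal subspace_hyperplane) auto
      then have "z = 0" using z by (auto simp: dual_cone_def)
      then show ?thesis using v by (intro exI[of _ 1]) simp
    next
      case False
      have "x \<notin> interior K"
      proof
        assume "x \<in> interior K"
        then have "x \<in> rel_interior K" using interior_subset_rel_interior by blast
        from dual_cone_rel_interior_pos[OF pointed_coneD(1)[OF K] v False this] show False using x(3) by simp
      qed
      then have "x \<in> frontier K" using x(1) pointed_coneD(2)[OF K] by (simp add: frontier_def)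
      then have d: "dim (dual_face K (face_gen K {x})) = 1" using S x(2) unfolding smooth_cone_def by blast
      have pf: "cone_face (point_face K x) K" "x \<in> point_face K x" by (rule point_face[OF pointed_coneD(1)[OF K] x(1)])+
      have sub: "face_gen K {x} \<subseteq> point_face K x" unfolding face_gen_def using pf by blast
      have zero: "u \<bullet> y = 0" if u: "u \<in> dual_cone K" "u \<bullet> x = 0" and y: "y \<in> face_gen K {x}" for u y
      proof -
        obtain e where e: "y \<in> K" "e > 0" "x - e *\<^sub>R y \<in> K" using y sub by (auto simp: point_face_def)
        have "0 \<le> u \<bullet> (x - e *\<^sub>R y)" "0 \<le> u \<bullet> y" using u(1) e by (auto simp: dual_cone_def)
        then have "e * (u \<bullet> y) \<le> 0" using u(2) by (simp add: inner_diff_right)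
        then show ?thesis using e(2) \<open>0 \<le> u \<bullet> y\<close> by (simp add: mult_le_0_iff)
      qed
      have GK: "face_gen K {x} \<subseteq> K" using sub cone_faceD(2)[OF pf(1)] by blast
      have "v \<in> dual_face K (face_gen K {x})" unfolding mem_dual_face_iff[OF GK] using v zero[OF v x(3)] by blast
      moreover have "z \<bullet> x = 0" using vz x by blast
      then have "z \<in> dual_face K (face_gen K {x})" unfolding mem_dual_face_iff[OF GK] using z zero[OF z] by blast
      ultimately obtain c where c: "z = c *\<^sub>R v" using one_dim_span[OF d _ False] by metis
      \<comment> \<open>Keeps 1 - e c nonnegative whatever the sign and size of
        \<open>c\<close>.\<close>
      define e where "e = 1 / (\<bar>c\<bar> + 1)"
      have e: "e > 0" by (simp add: e_def)
      have "e * c \<le> 1" unfolding e_def by (simp add: field_simps)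
      then have "(1 - e * c) *\<^sub>R v \<in> dual_cone K" using v dual_cone_convex_cone by (intro convex_cone_scaleR) auto
      also have "(1 - e * c) *\<^sub>R v = v - e *\<^sub>R z" by (simp add: c scaleR_diff_left)
      finally show ?thesis using e by blast
    qed
  qed
qed

lemma strictly_convex_smooth_imp_hypotheses:
  assumes K: "pointed_cone K" and S: "smooth_cone K" and C: "strictly_convex_cone K"
  shows "facially_exposed (dual_cone K)" "\<And>F. nontrivial_face F K \<Longrightarrow> polyhedral_cone F"
proof -
  show "facially_exposed (dual_cone K)" using smooth_imp_dual_exposing[OF K S] facially_exposed_dual_iff[OF K] by blast
  fix F assume F: "nontrivial_face F K"
  then have "pointed_cone F" using pointed_cone_face[OF K] by (auto simp: nontrivial_face_def)
  then show "polyhedral_cone F" using one_dim_cone_polyhedral C F by (auto simp: strictly_convex_cone_def)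
qed

text \<open>Let \<open>?G\<close> be the zero set of \<open>v\<close> in \<open>F\<close> and
  \<open>H\<close> the vectors of \<open>F\<close> orthogonal to \<open>?G\<close>; \<open>H\<close>
  is a face because \<open>F\<close> is self-dual. Were the face of \<open>v\<close> a proper face
  of \<open>H\<close>, a supporting \<open>u\<close> in the dual of \<open>H\<close>, which is
  \<open>H\<close> itself, would be orthogonal to \<open>v\<close>, hence in \<open>?G\<close> as
  well as in \<open>H\<close>, and so orthogonal to itself.\<close>

lemma perfect_imp_dual_faces_exposed:
  fixes K :: "'a::euclidean_space set"
  assumes K: "pointed_cone K" and P: "perfect_cone K"
  shows "dual_faces_exposed K"
  unfolding dual_faces_exposed_iff[OF K] dual_exposing_def
proof (intro allI ballI impI)
  fix F v z assume F: "cone_face F K" and v: "v \<in> dual_cone F" and z: "z \<in> dual_cone F"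
    and vz: "\<forall>x\<in>F. v \<bullet> x = 0 \<longrightarrow> z \<bullet> x = 0"
  have self: "dual_cone G = G" if "cone_face G F" for G
    using P cone_face_trans[OF F that] by (simp add: perfect_cone_def)
  have pF: "pointed_cone F" by (rule pointed_cone_face[OF K F])
  have cF: "convex_cone F" by (rule pointed_coneD(1)[OF pF])
  have dF: "dual_cone F = F" using self[OF cone_face_refl[OF cF]] .
  have vF: "v \<in> F" and zF: "z \<in> F" using v z dF by auto
  have nn: "0 \<le> x \<bullet> y" if "x \<in> F" "y \<in> F" for x y using that dF by (auto simp: dual_cone_def)
  let ?G = "{x \<in> F. v \<bullet> x = 0}"
  define H where "H = {y \<in> F. \<forall>x\<in>?G. x \<bullet> y = 0}"
  note pf = point_face[OF cF vF]
  have Hface: "cone_face H F"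
    unfolding cone_face_def convex_cone_iff
  proof (intro conjI ballI impI allI)
    show "0 \<in> H" using pointed_coneD(5)[OF pF] by (simp add: H_def)
    show "H \<subseteq> F" by (auto simp: H_def)
    show "x + y \<in> H" if "x \<in> H" "y \<in> H" for x y
      using that pointed_coneD(7)[OF pF] by (auto simp: H_def inner_add_right)
    show "c *\<^sub>R x \<in> H" if "x \<in> H" "0 \<le> c" for x and c :: real
      using that pointed_coneD(8)[OF pF] by (auto simp: H_def)
    have sp: "w \<bullet> x = 0 \<and> w \<bullet> y = 0" if "w \<in> ?G" "x \<in> F" "y \<in> F" "x + y \<in> H" for w x y
    proof -
      have "w \<bullet> (x + y) = 0" using that(1,4) unfolding H_def by blast
      then have "w \<bullet> x + w \<bullet> y = 0" by (simp add: inner_add_right)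
      moreover have "0 \<le> w \<bullet> x" "0 \<le> w \<bullet> y" using nn that(1-3) by blast+
      ultimately show ?thesis by simp
    qed
    show "x \<in> H" if h: "x \<in> F" "y \<in> F" "x + y \<in> H" for x y
      using sp[OF _ h] h(1) unfolding H_def by blast
    show "y \<in> H" if h: "x \<in> F" "y \<in> F" "x + y \<in> H" for x y
      using sp[OF _ h] h(2) unfolding H_def by blast
  qed
  have vH: "v \<in> H" using vF by (auto simp: H_def inner_commute)
  have zH: "z \<in> H" using zF vz by (auto simp: H_def inner_commute)
  have sub: "point_face F v \<subseteq> H"
  proof
    fix y assume "y \<in> point_face F v"
    then obtain e where e: "y \<in> F" "e > 0" "v - e *\<^sub>R y \<in> F" by (auto simp: point_face_def)
    then show "y \<in> H" using cone_face_diffD[OF Hface cF vH] by blast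
  qed
  have pfH: "cone_face (point_face F v) H" by (rule cone_face_subset[OF pf(1) Hface sub])
  have pH: "pointed_cone H" by (rule pointed_cone_face[OF pF Hface])
  have "point_face F v = H"
  proof (rule ccontr)
    assume "point_face F v \<noteq> H"
    then obtain u where u: "u \<in> dual_cone H" "u \<noteq> 0" "\<And>y. y \<in> point_face F v \<Longrightarrow> u \<bullet> y = 0"
      using proper_face_supporting[OF pH pfH] by metis
    have uH: "u \<in> H" using u(1) self[OF Hface] by simp
    then have "u \<in> ?G" using u(3)[OF pf(2)] by (auto simp: H_def inner_commute)
    then have "u \<bullet> u = 0" using uH by (auto simp: H_def)
    then show False using u(2) by simp
  qed
  then have "z \<in> point_face F v" using zH by simp
  then show "\<exists>e>0. v - e *\<^sub>R z \<in> dual_cone F" unfolding dF by (auto simp: point_face_def)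
qed

section \<open>Cones of nonnegative polynomials\<close>

text \<open>Dividing values is impossible at zeros of \<open>d\<close>, but if \<open>q\<close> were
  negative at \<open>t\<close> it would be negative nearby, and \<open>d\<close> would have to
  vanish on a whole interval.\<close>

lemma poly_quotient_nonneg:
  fixes d q :: "real poly"
  assumes d: "d \<noteq> 0" "\<And>u. u \<in> {0..1} \<Longrightarrow> 0 \<le> poly d u"
    and dq: "\<And>u. u \<in> {0..1} \<Longrightarrow> 0 \<le> poly (d * q) u" and t: "t \<in> {0..1}"
  shows "0 \<le> poly q t"
proof (rule ccontr)
  assume "\<not> 0 \<le> poly q t"
  then have "poly q t < 0" by simp
  moreover have "isCont (poly q) t" by simp
  ultimately have "\<forall>\<^sub>F u in at t. poly q u < 0" unfolding isCont_def by (rule order_tendstoD(2)[rotated])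
  then obtain e where e: "e > 0" "\<And>u. u \<noteq> t \<Longrightarrow> dist u t < e \<Longrightarrow> poly q u < 0" unfolding eventually_at by blast
  let ?I = "{max 0 (t - e)<..<min 1 (t + e)}"
  have "poly d u = 0" if u: "u \<in> ?I - {t}" for u
  proof -
    have u01: "u \<in> {0..1}" using u by auto
    have "dist u t < e" "u \<noteq> t" using u by (auto simp: dist_real_def)
    then have "poly q u < 0" using e(2) by blast
    moreover have "0 \<le> poly d u * poly q u" using dq[OF u01] by simp
    ultimately show ?thesis using d(2)[OF u01] by (simp add: zero_le_mult_iff)
  qed
  then have "?I - {t} \<subseteq> {u. poly d u = 0}" by blast
  then have "finite (?I - {t})" using poly_roots_finite[OF d(1)] finite_subset by blast
  then have "finite ?I" by simp
  moreover have "max 0 (t - e) < min 1 (t + e)" using t e(1) by auto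
  ultimately show False using infinite_Ioo by blast
qed

text \<open>For \<open>t\<close> in the unit interval, the factor of least degree that is
  nonnegative there and vanishes there only at \<open>t\<close>: simple at the ends, a square
  inside. The sign at t = 1 is chosen so that 1 - X is nonnegative.\<close>

definition root_factor :: "real \<Rightarrow> real poly" where
  "root_factor t = (if t = 0 then [:0, 1:] else if t = 1 then [:1, -1:] else [:-t, 1:] ^ 2)"

lemma root_factor:
  assumes "u \<in> {0..1}"
  shows "0 \<le> poly (root_factor t) u" "poly (root_factor t) u = 0 \<longleftrightarrow> u = t"
  using assms by (auto simp: root_factor_def)

lemma root_factor_nonzero: "root_factor t \<noteq> 0" "0 < degree (root_factor t)"
  by (simp_all add: root_factor_def degree_power_eq)

text \<open>If the quotient by X - t were nonzero at an interior root \<open>t\<close>, then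
  \<open>p\<close> would change sign there; so the root is at least double.\<close>

lemma root_factor_dvd:
  assumes p: "\<And>u. u \<in> {0..1} \<Longrightarrow> 0 \<le> poly p u" and t: "t \<in> {0..1}" "poly p t = 0"
  shows "root_factor t dvd p"
proof -
  have L: "[:-t, 1:] dvd p" using t(2) by (simp add: poly_eq_0_iff_dvd)
  consider "t = 0" | "t = 1" | "0 < t" "t < 1" using t(1) by fastforce
  then show ?thesis
  proof cases
    case 1 then show ?thesis using L by (simp add: root_factor_def)
  next
    case 2
    have "[:1, -1:] = - [:-1, 1 :: real:]" by simp
    then show ?thesis using L 2 unfolding root_factor_def by (metis minus_dvd_iff zero_neq_one)
  next
    case 3
    obtain q where q: "p = [:-t, 1:] * q" using L by (metis dvdE)
    have "poly q t = 0"
    proof (rule ccontr)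
      assume nz: "poly q t \<noteq> 0"
      have c: "(poly q \<longlongrightarrow> poly q t) (at t)"
      proof -
        have "isCont (poly q) t" by simp
        then show ?thesis by (simp add: isCont_def)
      qed
      show False
      proof (cases "poly q t > 0")
        case True
        then have "\<forall>\<^sub>F u in at t. 0 < poly q u" using c by (rule order_tendstoD(1)[rotated])
        then obtain e where e: "e > 0" "\<And>u. u \<noteq> t \<Longrightarrow> dist u t < e \<Longrightarrow> 0 < poly q u" unfolding eventually_at by blast
        define u where "u = max 0 (t - e/2)"
        have u: "u \<in> {0..1}" "u < t" "dist u t < e" using 3 e(1) by (auto simp: u_def dist_real_def)
        then have "0 < poly q u" using e(2)[of u] by simp
        then have "poly p u < 0" using u(2) by (simp add: q mult_neg_pos)
        then show False using p[OF u(1)] by simp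
      next
        case False
        then have "poly q t < 0" using nz by simp
        then have "\<forall>\<^sub>F u in at t. poly q u < 0" using c by (rule order_tendstoD(2)[rotated])
        then obtain e where e: "e > 0" "\<And>u. u \<noteq> t \<Longrightarrow> dist u t < e \<Longrightarrow> poly q u < 0" unfolding eventually_at by blast
        define u where "u = min 1 (t + e/2)"
        have u: "u \<in> {0..1}" "t < u" "dist u t < e" using 3 e(1) by (auto simp: u_def dist_real_def)
        then have "poly q u < 0" using e(2)[of u] by simp
        then have "poly p u < 0" using u(2) by (simp add: q mult_pos_neg)
        then show False using p[OF u(1)] by simp
      qed
    qed
    then have "[:-t, 1:] dvd q" by (simp add: poly_eq_0_iff_dvd)
    then have "[:-t, 1:] * [:-t, 1:] dvd p" unfolding q by (rule mult_dvd_mono[OF dvd_refl])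
    then show ?thesis using 3 by (simp add: root_factor_def power2_eq_square del: mult_pCons_left)
  qed
qed

text \<open>Dividing by the factors already found keeps the polynomial nonnegative and does not
  remove the root \<open>t\<close>, since in the interval those factors vanish only at their own
  points.\<close>

lemma root_factor_prod_dvd:
  assumes "finite T" "T \<subseteq> {0..1}" "\<And>u. u \<in> {0..1} \<Longrightarrow> 0 \<le> poly p u" "\<And>t. t \<in> T \<Longrightarrow> poly p t = 0"
  shows "(\<Prod>t\<in>T. root_factor t) dvd p"
  using assms
proof (induction T rule: finite_induct)
  case (insert t T)
  let ?d = "\<Prod>t\<in>T. root_factor t"
  have "?d dvd p" using insert by simp
  then obtain q where q: "p = ?d * q" by (metis dvdE)
  have d0: "?d \<noteq> 0" using insert.hyps(1) root_factor_nonzero(1) by simp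
  have dn: "0 \<le> poly ?d u" if "u \<in> {0..1}" for u unfolding poly_prod using root_factor(1)[OF that] by (intro prod_nonneg) auto
  have qn: "0 \<le> poly q u" if "u \<in> {0..1}" for u
    by (rule poly_quotient_nonneg[OF d0 dn _ that]) (use insert.prems(2) q in auto)
  have t: "t \<in> {0..1}" using insert.prems(1) by simp
  have "poly ?d t \<noteq> 0" unfolding poly_prod using insert.hyps root_factor(2)[OF t] by auto
  then have "poly q t = 0" using insert.prems(3)[of t] q by simp
  then have "root_factor t dvd q" using root_factor_dvd[OF qn t] by blast
  then have "?d * root_factor t dvd p" unfolding q by (rule mult_dvd_mono[OF dvd_refl])
  then show ?case using insert.hyps by (simp add: mult.commute)
qed simp

text \<open>\<open>d\<close> collects the root factors of \<open>p\<close>, one per step. The last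
  clause serves to identify the face generated by \<open>p\<close>: a polynomial between 0 and a
  multiple of \<open>p\<close> shares each root, and after division by the root factor the same
  comparison holds for the quotients.\<close>

lemma nonneg_poly_factorization:
  fixes p :: "real poly"
  assumes "p \<noteq> 0" "\<And>u. u \<in> {0..1} \<Longrightarrow> 0 \<le> poly p u"
  shows "\<exists>d q. p = d * q \<and> (\<forall>u\<in>{0..1}. 0 \<le> poly d u) \<and> (\<forall>u\<in>{0..1}. 0 < poly q u) \<and>
    (\<forall>f c. (\<forall>u\<in>{0..1}. 0 \<le> poly f u \<and> poly f u \<le> c * poly p u) \<longrightarrow> d dvd f)"
  using assms
proof (induction "degree p" arbitrary: p rule: less_induct)
  case less
  show ?case
  proof (cases "\<forall>u\<in>{0..1}. 0 < poly p u")
    case True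
    show ?thesis
      by (rule exI[of _ 1], rule exI[of _ p]) (use True in simp)
  next
    case False
    then obtain t where t: "t \<in> {0..1}" "poly p t = 0" using less.prems(2) by fastforce
    let ?s = "root_factor t"
    obtain p1 where p1: "p = ?s * p1" using root_factor_dvd[OF less.prems(2) t] by (metis dvdE)
    have p10: "p1 \<noteq> 0" using p1 less.prems(1) by auto
    have p1n: "0 \<le> poly p1 u" if "u \<in> {0..1}" for u
      by (rule poly_quotient_nonneg[OF root_factor_nonzero(1)[of t] root_factor(1) _ that]) (use less.prems(2) p1 in auto)
    have "degree p1 < degree p" unfolding p1 using root_factor_nonzero[of t] p10 by (simp add: degree_mult_eq)
    from less.hyps[OF this p10 p1n] obtain d q where dq: "p1 = d * q" "\<forall>u\<in>{0..1}. 0 \<le> poly d u" "\<forall>u\<in>{0..1}. 0 < poly q u"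
      and dvd: "\<And>f c. (\<forall>u\<in>{0..1}. 0 \<le> poly f u \<and> poly f u \<le> c * poly p1 u) \<Longrightarrow> d dvd f" by blast
    have "p = (?s * d) * q" using p1 dq(1) by (simp add: mult.assoc)
    moreover have "\<forall>u\<in>{0..1}. 0 \<le> poly (?s * d) u" using root_factor(1) dq(2) by simp
    moreover have "?s * d dvd f" if f: "\<forall>u\<in>{0..1}. 0 \<le> poly f u \<and> poly f u \<le> c * poly p u" for f c
    proof -
      have "poly f t = 0" using f t by fastforce
      then have "?s dvd f" using root_factor_dvd[of f t] f t(1) by blast
      then obtain g where g: "f = ?s * g" by (metis dvdE)
      have "0 \<le> poly g u" if "u \<in> {0..1}" for u
        by (rule poly_quotient_nonneg[OF root_factor_nonzero(1)[of t] root_factor(1) _ that]) (use f g in auto)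
      moreover have "0 \<le> poly (smult c p1 - g) u" if "u \<in> {0..1}" for u
      proof (rule poly_quotient_nonneg[OF root_factor_nonzero(1)[of t] root_factor(1) _ that])
        fix u :: real assume "u \<in> {0..1}"
        then have "poly f u \<le> c * poly p u" using f by blast
        then show "0 \<le> poly (?s * (smult c p1 - g)) u" unfolding g p1 by (simp add: algebra_simps)
      qed
      ultimately have "d dvd g" by (intro dvd[of g c]) simp
      then show ?thesis unfolding g by (rule mult_dvd_mono[OF dvd_refl])
    qed
    ultimately show ?thesis using dq(3) by blast
  qed
qed

text \<open>Finite sums with nonnegative coefficients already form a convex cone; zero coefficients
  are dropped at the end, so that vanishing of a sum of nonnegative terms can be passed on to each
  \<open>g t\<close>.\<close>

lemma convex_cone_hull_image_representation:
  assumes "h \<in> convex_cone hull (g ` I)"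
  obtains T c where "finite T" "T \<subseteq> I" "\<And>t. t \<in> T \<Longrightarrow> 0 < c t" "h = (\<Sum>t\<in>T. c t *\<^sub>R g t)"
proof -
  let ?Q = "{\<Sum>t\<in>T. c t *\<^sub>R g t | T c. finite T \<and> T \<subseteq> I \<and> (\<forall>t. (0 :: real) \<le> c t)}"
  have "convex_cone hull (g ` I) \<subseteq> ?Q"
  proof (rule hull_minimal)
    show "g ` I \<subseteq> ?Q"
    proof
      fix y assume "y \<in> g ` I"
      then obtain t where t: "t \<in> I" "y = g t" by blast
      then show "y \<in> ?Q" by (intro CollectI exI[of _ "{t}"] exI[of _ "\<lambda>_. 1"]) simp
    qed
    show "convex_cone ?Q"
      unfolding convex_cone_iff
    proof (intro conjI ballI allI impI)
      show "0 \<in> ?Q" by (intro CollectI exI[of _ "{}"] exI[of _ "\<lambda>_. 0"]) simp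
      fix x y assume "x \<in> ?Q" "y \<in> ?Q"
      then obtain S b T c where x: "x = (\<Sum>t\<in>S. b t *\<^sub>R g t)" "finite S" "S \<subseteq> I" "\<forall>t. 0 \<le> b t"
        and y: "y = (\<Sum>t\<in>T. c t *\<^sub>R g t)" "finite T" "T \<subseteq> I" "\<forall>t. 0 \<le> c t" by blast
      define a where "a t = (if t \<in> S then b t else 0) + (if t \<in> T then c t else 0)" for t
      have "x = (\<Sum>t\<in>S \<union> T. (if t \<in> S then b t else 0) *\<^sub>R g t)" unfolding x(1)
        by (rule sum.mono_neutral_cong_left) (use x(2) y(2) in auto)
      moreover have "y = (\<Sum>t\<in>S \<union> T. (if t \<in> T then c t else 0) *\<^sub>R g t)" unfolding y(1)
        by (rule sum.mono_neutral_cong_left) (use x(2) y(2) in auto)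
      ultimately have "x + y = (\<Sum>t\<in>S \<union> T. a t *\<^sub>R g t)" by (simp only: a_def scaleR_add_left sum.distrib)
      then show "x + y \<in> ?Q" using x y by (intro CollectI exI[of _ "S \<union> T"] exI[of _ a]) (auto simp: a_def)
    next
      fix x and k :: real assume "x \<in> ?Q" "0 \<le> k"
      then obtain S b where x: "x = (\<Sum>t\<in>S. b t *\<^sub>R g t)" "finite S" "S \<subseteq> I" "\<forall>t. 0 \<le> b t" by blast
      then show "k *\<^sub>R x \<in> ?Q" using \<open>0 \<le> k\<close>
        by (intro CollectI exI[of _ S] exI[of _ "\<lambda>t. k * b t"]) (simp add: scaleR_sum_right)
    qed
  qed
  then obtain T c where T: "h = (\<Sum>t\<in>T. c t *\<^sub>R g t)" "finite T" "T \<subseteq> I" "\<forall>t. 0 \<le> c t" using assms by blast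
  have "(\<Sum>t\<in>T. c t *\<^sub>R g t) = (\<Sum>t\<in>{t \<in> T. 0 < c t}. c t *\<^sub>R g t)"
  proof (rule sum.mono_neutral_right[OF T(2)])
    show "\<forall>t\<in>T - {t \<in> T. 0 < c t}. c t *\<^sub>R g t = 0"
    proof
      fix t assume "t \<in> T - {t \<in> T. 0 < c t}"
      then have "\<not> 0 < c t" by blast
      moreover have "0 \<le> c t" using T(4) by blast
      ultimately have "c t = 0" by linarith
      then show "c t *\<^sub>R g t = 0" by simp
    qed
  qed blast
  then have "h = (\<Sum>t\<in>{t \<in> T. 0 < c t}. c t *\<^sub>R g t)" using T(1) by (rule trans[rotated])
  then show ?thesis
  proof (rule that[rotated 3])
    show "finite {t \<in> T. 0 < c t}" using T(2) by simp
    show "{t \<in> T. 0 < c t} \<subseteq> I" using T(3) by blast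
  qed blast
qed

text \<open>
  The dual cone is generated by the evaluations \<open>e t\<close> at points of the unit interval. If \<open>v\<close> is
  carried by \<open>T\<close> and vanishes on a nonzero element, then the product of the root factors of \<open>T\<close>
  belongs to the cone, and \<open>z\<close> annihilates it only if \<open>z\<close> is carried by a subset of \<open>T\<close>.
\<close>

lemma dual_exposing_poly_cone_image:
  fixes \<psi> :: "real poly \<Rightarrow> 'a::euclidean_space"
  assumes add: "\<And>p q. \<psi> (p + q) = \<psi> p + \<psi> q" and scale: "\<And>c p. \<psi> (smult c p) = c *\<^sub>R \<psi> p"
    and inj: "inj_on \<psi> {p. degree p \<le> n}" and pc: "pointed_cone (\<psi> ` poly_cone n)"
  shows "dual_exposing (\<psi> ` poly_cone n)"
proof -
  let ?C = "\<psi> ` poly_cone n" and ?P = "{p :: real poly. degree p \<le> n}"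
  define W where "W = \<psi> ` ?P"
  define \<pi> where "\<pi> = inv_into ?P \<psi>"
  have \<psi>0: "\<psi> 0 = 0" using scale[of 0 0] by simp
  have \<psi>sum: "\<psi> (sum f S) = (\<Sum>i\<in>S. \<psi> (f i))" for f :: "'a \<Rightarrow> real poly" and S
    by (induction S rule: infinite_finite_induct) (simp_all add: \<psi>0 add)
  have subW: "Real_Vector_Spaces.subspace W"
  proof (rule subspaceI)
    show "0 \<in> W" unfolding W_def using \<psi>0 by (intro image_eqI[of _ _ 0]) auto
    fix x y assume "x \<in> W" "y \<in> W"
    then obtain p q where "x = \<psi> p" "y = \<psi> q" "degree p \<le> n" "degree q \<le> n" by (auto simp: W_def)
    then show "x + y \<in> W" unfolding W_def using add[of p q] degree_add_le[of p n q] by (intro image_eqI[of _ _ "p + q"]) auto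
  next
    fix c :: real and x assume "x \<in> W"
    then obtain p where "x = \<psi> p" "degree p \<le> n" by (auto simp: W_def)
    then show "c *\<^sub>R x \<in> W" unfolding W_def using scale[of c p] degree_smult_le[of c p]
      by (intro image_eqI[of _ _ "smult c p"]) auto
  qed
  have \<pi>W: "degree (\<pi> w) \<le> n" "\<psi> (\<pi> w) = w" if "w \<in> W" for w
    using inv_into_into[of w \<psi> ?P] f_inv_into_f[of w \<psi> ?P] that unfolding W_def \<pi>_def by auto
  have \<pi>\<psi>: "\<pi> (\<psi> p) = p" if "degree p \<le> n" for p unfolding \<pi>_def using inj that by (simp add: inv_into_f_f)
  obtain R where R: "linear R" "\<And>x. R x \<in> W" "\<And>x. x \<in> W \<Longrightarrow> R x = x" "\<And>x y. R x \<bullet> y = x \<bullet> R y"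
    using orthogonal_projection_exists[OF subW] by metis
  \<comment> \<open>The representative in \<open>W\<close> of evaluation at \<open>t\<close>,
    expanded in the projected basis vectors.\<close>
  define e where "e t = (\<Sum>b\<in>Basis. poly (\<pi> (R b)) t *\<^sub>R R b)" for t
  have eW: "e t \<in> W" for t unfolding e_def using R(2) subW by (intro subspace_sum subspace_scale) auto
  have ev: "e t \<bullet> w = poly (\<pi> w) t" if w: "w \<in> W" for t w
  proof -
    define f where "f = (\<Sum>b\<in>Basis. smult (b \<bullet> w) (\<pi> (R b)))"
    have "degree f \<le> n" unfolding f_def
      by (rule degree_sum_le) (auto intro: order_trans[OF degree_smult_le] \<pi>W(1)[OF R(2)])
    moreover have "\<psi> f = w"
    proof -
      have "\<psi> f = (\<Sum>b\<in>Basis. (b \<bullet> w) *\<^sub>R R b)" unfolding f_def \<psi>sum scale using \<pi>W(2)[OF R(2)] by simp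
      also have "\<dots> = R (\<Sum>b\<in>Basis. (w \<bullet> b) *\<^sub>R b)"
        using R(1) by (simp add: linear_sum linear_scale inner_commute)
      also have "\<dots> = w" using R(3)[OF w] by (simp add: euclidean_representation)
      finally show ?thesis .
    qed
    ultimately have "\<pi> w = f" using \<pi>\<psi> by metis
    then have "poly (\<pi> w) t = (\<Sum>b\<in>Basis. (b \<bullet> w) * poly (\<pi> (R b)) t)" by (simp add: f_def poly_sum)
    also have "\<dots> = e t \<bullet> w" unfolding e_def inner_sum_left
      using R(3)[OF w] by (intro sum.cong) (simp_all add: R(4) mult.commute)
    finally show ?thesis by simp
  qed
  have C_iff: "w \<in> ?C \<longleftrightarrow> w \<in> W \<and> (\<forall>t\<in>{0..1}. 0 \<le> e t \<bullet> w)" for w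
  proof
    assume "w \<in> ?C"
    then obtain p where p: "p \<in> poly_cone n" "w = \<psi> p" by blast
    then have wW: "w \<in> W" by (auto simp: W_def poly_cone_def)
    show "w \<in> W \<and> (\<forall>t\<in>{0..1}. 0 \<le> e t \<bullet> w)"
      using p wW \<pi>\<psi>[of p] ev[OF wW] by (auto simp: poly_cone_def)
  next
    assume w: "w \<in> W \<and> (\<forall>t\<in>{0..1}. 0 \<le> e t \<bullet> w)"
    then have "\<pi> w \<in> poly_cone n" using \<pi>W(1) ev by (auto simp: poly_cone_def)
    then show "w \<in> ?C" using \<pi>W(2) w by (metis image_eqI)
  qed
  have spanC: "span ?C \<subseteq> W" by (rule span_minimal[OF _ subW]) (use C_iff in blast)
  let ?D = "convex_cone hull (e ` {0..1})"
  have "continuous_on {0..1} e" unfolding e_def by (intro continuous_intros)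
  then have "compact (e ` {0..1})" by (rule compact_continuous_image) simp
  then have comp: "compact (convex hull (e ` {0..1}))" by (rule compact_convex_hull)
  \<comment> \<open>Needed for the generated cone to be closed: all evaluations take the value 1 at
    the constant polynomial 1, so their hull avoids 0.\<close>
  have "0 \<notin> convex hull (e ` {0..1})"
  proof
    assume z: "0 \<in> convex hull (e ` {0..1})"
    have w1: "\<psi> 1 \<in> W" by (auto simp: W_def)
    have "e t \<bullet> \<psi> 1 = 1" for t using ev[OF w1] \<pi>\<psi>[of 1] by simp
    then have "e ` {0..1} \<subseteq> {x. \<psi> 1 \<bullet> x = 1}" by (auto simp: inner_commute)
    then have "convex hull (e ` {0..1}) \<subseteq> {x. \<psi> 1 \<bullet> x = 1}" by (rule hull_minimal) (rule convex_hyperplane)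
    then show False using z by auto
  qed
  then have "closed (conic hull (convex hull (e ` {0..1})))" using comp by (intro closed_conic_hull) blast
  then have Dcl: "closed ?D" by (subst convex_cone_hull_separate_nonempty) auto
  \<comment> \<open>Otherwise \<open>l\<close> is separated from the cone of evaluations by a vector
    whose projection to \<open>W\<close> is nonnegative at all points of the interval, hence lies in
    \<open>?C\<close>, although \<open>l\<close> is negative on it.\<close>
  have dualD: "l \<in> ?D" if l: "l \<in> dual_cone ?C" for l
  proof (rule ccontr)
    assume "l \<notin> ?D"
    then obtain z where z: "\<And>y. y \<in> ?D \<Longrightarrow> 0 \<le> z \<bullet> y" "z \<bullet> l < 0"
      using separate_closed_cone[OF convex_cone_convex_cone_hull Dcl] by metis
    have lW: "l \<in> W" using l spanC by (auto simp: dual_cone_def)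
    have Rz: "R z \<bullet> w = z \<bullet> w" if "w \<in> W" for w using R(3)[OF that] by (simp add: R(4))
    have "0 \<le> e t \<bullet> R z" if "t \<in> {0..1}" for t
      using z(1)[of "e t"] hull_subset[of "e ` {0..1}" convex_cone] that Rz[OF eW] by (force simp: inner_commute)
    then have "R z \<in> ?C" using C_iff R(2) by blast
    then have "0 \<le> l \<bullet> R z" using l by (auto simp: dual_cone_def)
    then show False using Rz[OF lW] z(2) by (simp add: inner_commute)
  qed
  show ?thesis
    unfolding dual_exposing_def
  proof (intro ballI impI)
    fix v z assume v: "v \<in> dual_cone ?C" and z: "z \<in> dual_cone ?C" and vz: "\<forall>x\<in>?C. v \<bullet> x = 0 \<longrightarrow> z \<bullet> x = 0"
    show "\<exists>e>0. v - e *\<^sub>R z \<in> dual_cone ?C"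
    proof (cases "\<exists>x\<in>?C. x \<noteq> 0 \<and> v \<bullet> x = 0")
      case False
      then show ?thesis using dual_exposing_if_pos[OF pc v z] by blast
    next
      case True
      then obtain w where w: "w \<in> ?C" "w \<noteq> 0" "v \<bullet> w = 0" by blast
      obtain T c where T: "finite T" "T \<subseteq> {0..1}" "\<And>t. t \<in> T \<Longrightarrow> 0 < c t" "v = (\<Sum>t\<in>T. c t *\<^sub>R e t)"
        using convex_cone_hull_image_representation[OF dualD[OF v]] by metis
      obtain S b where S: "finite S" "S \<subseteq> {0..1}" "\<And>t. t \<in> S \<Longrightarrow> 0 < b t" "z = (\<Sum>t\<in>S. b t *\<^sub>R e t)"
        using convex_cone_hull_image_representation[OF dualD[OF z]] by metis
      have zero: "e t \<bullet> y = 0"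
        if y: "y \<in> ?C" and U: "finite U" "U \<subseteq> {0..1}" "\<And>t. t \<in> U \<Longrightarrow> 0 < a t" "(\<Sum>t\<in>U. a t *\<^sub>R e t) \<bullet> y = 0" "t \<in> U"
        for y U a t
      proof -
        have n: "0 \<le> a t * (e t \<bullet> y)" if "t \<in> U" for t
        proof -
          have "0 \<le> e t \<bullet> y" using y C_iff U(2) that by blast
          then show ?thesis using U(3)[OF that] by simp
        qed
        have "(\<Sum>t\<in>U. a t * (e t \<bullet> y)) = 0" using U(4) by (simp add: inner_sum_left)
        then have "a t * (e t \<bullet> y) = 0" using sum_nonneg_eq_0_iff[OF U(1), of "\<lambda>t. a t * (e t \<bullet> y)"] n U(5) by blast
        then show ?thesis using U(3)[OF U(5)] by simp
      qed
      have wW: "w \<in> W" using w(1) C_iff by blast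
      let ?p = "\<pi> w"
      have p0: "?p \<noteq> 0" using \<pi>W(2)[OF wW] w(2) \<psi>0 by metis
      have pn: "0 \<le> poly ?p u" if "u \<in> {0..1}" for u
      proof -
        have "0 \<le> e u \<bullet> w" using w(1) C_iff that by blast
        then show ?thesis using ev[OF wW, of u] by simp
      qed
      have pT: "poly ?p t = 0" if "t \<in> T" for t
      proof -
        have "(\<Sum>t\<in>T. c t *\<^sub>R e t) \<bullet> w = 0" using w(3) T(4) by simp
        from zero[OF w(1) T(1-3) this that] show ?thesis using ev[OF wW, of t] by simp
      qed
      \<comment> \<open>As a divisor of \<open>?p\<close> this polynomial has degree at most
        \<open>n\<close>; in the interval it vanishes exactly on \<open>T\<close>.\<close>
      define d where "d = (\<Prod>t\<in>T. root_factor t)"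
      have "d dvd ?p" unfolding d_def by (rule root_factor_prod_dvd[OF T(1,2) pn pT])
      then have dn: "degree d \<le> n" using dvd_imp_degree_le[OF _ p0] \<pi>W(1)[OF wW] by (meson order_trans)
      have dpos: "0 \<le> poly d u" if "u \<in> {0..1}" for u
        unfolding d_def poly_prod using root_factor(1)[OF that] by (intro prod_nonneg) auto
      have droot: "poly d u = 0 \<longleftrightarrow> u \<in> T" if "u \<in> {0..1}" for u
        unfolding d_def poly_prod using root_factor(2)[OF that] T(1) by auto
      have dC: "\<psi> d \<in> ?C" using dn dpos by (auto simp: poly_cone_def)
      then have dW: "\<psi> d \<in> W" using C_iff by blast
      have ed: "e t \<bullet> \<psi> d = poly d t" for t using ev[OF dW] \<pi>\<psi>[OF dn] by simp
      have "v \<bullet> \<psi> d = (\<Sum>t\<in>T. c t * poly d t)" unfolding T(4) by (simp add: inner_sum_left ed)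
      also have "\<dots> = 0" using droot T(2) by (intro sum.neutral) auto
      finally have "z \<bullet> \<psi> d = 0" using vz dC by blast
      then have "e t \<bullet> \<psi> d = 0" if "t \<in> S" for t
      proof -
        have "(\<Sum>t\<in>S. b t *\<^sub>R e t) \<bullet> \<psi> d = 0" using \<open>z \<bullet> \<psi> d = 0\<close> S(4) by simp
        from zero[OF dC S(1-3) this that] show ?thesis .
      qed
      then have ST: "S \<subseteq> T" unfolding ed using droot S(2) by blast
      define m where "m = Min (insert 1 (c ` T))"
      have m: "0 < m" "\<And>t. t \<in> T \<Longrightarrow> m \<le> c t" using T(1,3) by (auto simp: m_def)
      define k where "k = m / (sum b S + 1)"
      have bS: "0 \<le> sum b S" using S(3) by (intro sum_nonneg) (auto intro: less_imp_le)
      then have k: "0 < k" using m(1) by (simp add: k_def)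
      have kb: "k * b t \<le> c t" if "t \<in> S" for t
      proof -
        have "b t \<le> sum b S" using that S(1,3) by (intro member_le_sum) (auto intro: less_imp_le)
        then have "k * b t \<le> k * (sum b S + 1)" using k by (intro mult_left_mono) auto
        also have "\<dots> = m" using bS by (simp add: k_def)
        finally show ?thesis using m(2) ST that by force
      qed
      have "0 \<le> (v - k *\<^sub>R z) \<bullet> y" if y: "y \<in> ?C" for y
      proof -
        have nn: "0 \<le> e t \<bullet> y" if "t \<in> T" for t using y C_iff T(2) that by blast
        have "k * (z \<bullet> y) = (\<Sum>t\<in>S. (k * b t) * (e t \<bullet> y))"
          unfolding S(4) by (simp add: inner_sum_left sum_distrib_left mult.assoc)
        also have "\<dots> \<le> (\<Sum>t\<in>S. c t * (e t \<bullet> y))"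
          using kb nn ST by (intro sum_mono mult_right_mono) auto
        also have "\<dots> \<le> (\<Sum>t\<in>T. c t * (e t \<bullet> y))"
          using T(1,3) nn ST by (intro sum_mono2) (auto intro: less_imp_le mult_nonneg_nonneg)
        also have "\<dots> = v \<bullet> y" unfolding T(4) by (simp add: inner_sum_left)
        finally show ?thesis by (simp add: inner_diff_left)
      qed
      moreover have "v - k *\<^sub>R z \<in> span ?C" using v z by (auto simp: dual_cone_def intro: span_diff span_scale)
      ultimately show ?thesis using k by (intro exI[of _ k]) (simp add: dual_cone_def)
    qed
  qed
qed

text \<open>
  The faces of \<open>P(n)\<close> are the cones \<open>d * P(n - degree d)\<close>, where \<open>d\<close> collects the roots in the
  unit interval of a polynomial in the relative interior.
\<close>

lemma poly_cone_dual_faces_exposed: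
  fixes K :: "'a::euclidean_space set"
  assumes K: "pointed_cone K" and P: "is_poly_cone n K"
  shows "dual_faces_exposed K"
  unfolding dual_faces_exposed_iff[OF K]
proof (intro allI impI)
  fix F assume F: "cone_face F K"
  obtain \<phi> where lin: "Vector_Spaces.linear smult (\<lambda>c x. c *\<^sub>R x) \<phi>"
    and bij: "bij_betw \<phi> {p. degree p \<le> n} UNIV" and KP: "K = \<phi> ` poly_cone n"
    using P unfolding is_poly_cone_def by blast
  have hom: "Modules.module_hom smult (\<lambda>c x. c *\<^sub>R x) \<phi>" using lin by (rule Vector_Spaces.linear.axioms(3))
  have inj: "inj_on \<phi> {p. degree p \<le> n}" using bij by (rule bij_betw_imp_inj_on)
  have cK: "convex_cone K" by (rule pointed_coneD(1)[OF K])
  have pF: "pointed_cone F" by (rule pointed_cone_face[OF K F])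
  show "dual_exposing F"
  proof (cases "F = {0}")
    case True
    then show ?thesis using dual_exposing_zero by simp
  next
    case False
    obtain x0 where x0: "x0 \<in> rel_interior F" using rel_interior_face_nonempty[OF F] by blast
    then have x0F: "x0 \<in> F" using rel_interior_subset by blast
    then have "x0 \<in> K" using cone_faceD(2)[OF F] by blast
    then obtain p where p: "p \<in> poly_cone n" "x0 = \<phi> p" using KP by blast
    have x0n: "x0 \<noteq> 0" by (rule rel_interior_pointed_cone_nonzero[OF pF False x0])
    have p0: "p \<noteq> 0" using x0n p(2) Modules.module_hom.zero[OF hom] by auto
    obtain d q where dq: "p = d * q" "\<forall>u\<in>{0..1}. 0 \<le> poly d u" "\<forall>u\<in>{0..1}. 0 < poly q u"
      and dvd: "\<And>f c. (\<forall>u\<in>{0..1}. 0 \<le> poly f u \<and> poly f u \<le> c * poly p u) \<Longrightarrow> d dvd f"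
      using nonneg_poly_factorization[OF p0] p(1) unfolding poly_cone_def by blast
    have d0: "d \<noteq> 0" using dq(1) p0 by auto
    have dp: "degree d \<le> n"
      using dvd_imp_degree_le[of d p] p0 dq(1) p(1) by (simp add: poly_cone_def)
    define k where "k = n - degree d"
    define \<psi> where "\<psi> g = \<phi> (d * g)" for g
    have deg: "degree (d * g) \<le> n" if "degree g \<le> k" for g
      using degree_mult_le[of d g] that dp by (simp add: k_def)
    have FE: "F = \<psi> ` poly_cone k"
    proof (rule subset_antisym; rule subsetI)
      fix y assume y: "y \<in> F"
      then obtain f where f: "f \<in> poly_cone n" "y = \<phi> f" using cone_faceD(2)[OF F] KP by blast
      obtain e where e: "e > 0" "x0 - e *\<^sub>R y \<in> F" using x0 y rel_interior_cone_iff[OF cone_faceD(1)[OF F]] by blast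
      then obtain h where h: "h \<in> poly_cone n" "x0 - e *\<^sub>R y = \<phi> h" using cone_faceD(2)[OF F] KP by blast
      \<comment> \<open>Injectivity turns domination in \<open>K\<close> into h + e f = p for
        polynomials. Hence 0 <= f <= p/e on the interval, and the last clause of the factorization
        shows that \<open>d\<close> divides \<open>f\<close>.\<close>
      have "\<phi> (h + smult e f) = \<phi> p" using h(2) f(2) p(2) by (simp add: Modules.module_hom.add[OF hom] Modules.module_hom.scale[OF hom] algebra_simps)
      moreover have "degree (h + smult e f) \<le> n" "degree p \<le> n"
        using h(1) f(1) p(1) degree_smult_le[of e f] by (auto simp: poly_cone_def intro!: degree_add_le)
      ultimately have hp: "h + smult e f = p" using inj_onD[OF inj] by blast
      have "poly f u \<le> (1/e) * poly p u" if "u \<in> {0..1}" for u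
      proof -
        have "0 \<le> poly h u" using h(1) that by (simp add: poly_cone_def)
        moreover have "poly p u = poly h u + e * poly f u" unfolding hp[symmetric] by simp
        ultimately show ?thesis using e(1) by (simp add: field_simps)
      qed
      then have "d dvd f" using dvd[of f "1/e"] f(1) by (auto simp: poly_cone_def)
      then obtain g where g: "f = d * g" by (metis dvdE)
      have "0 \<le> poly g u" if "u \<in> {0..1}" for u
        by (rule poly_quotient_nonneg[OF d0 _ _ that]) (use dq(2) f(1) g in \<open>auto simp: poly_cone_def\<close>)
      moreover have "degree g \<le> k"
      proof (cases "g = 0")
        case False
        then show ?thesis using f(1) d0 unfolding g by (auto simp: poly_cone_def degree_mult_eq k_def)
      qed simp
      ultimately have "g \<in> poly_cone k" by (simp add: poly_cone_def)
      then show "y \<in> \<psi> ` poly_cone k" using f(2) g by (auto simp: \<psi>_def)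
    next
      fix y assume "y \<in> \<psi> ` poly_cone k"
      then obtain g where g: "g \<in> poly_cone k" "y = \<phi> (d * g)" by (auto simp: \<psi>_def)
      have dg: "d * g \<in> poly_cone n" using g(1) dq(2) deg by (auto simp: poly_cone_def)
      \<comment> \<open>\<open>q\<close> is positive on the compact interval, so \<open>g\<close> is
        bounded there by a multiple of \<open>q\<close>; hence d g is dominated by a multiple of
        \<open>p\<close>.\<close>
      have "continuous_on {0..1} (\<lambda>u. poly g u / poly q u)"
        using dq(3) by (intro continuous_intros) auto
      then obtain m where m: "m \<in> {0..1}" "\<And>u. u \<in> {0..1} \<Longrightarrow> poly g u / poly q u \<le> poly g m / poly q m"
        using continuous_attains_sup[of "{0..1::real}" "\<lambda>u. poly g u / poly q u"] by auto
      define c where "c = poly g m / poly q m + 1"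
      have "0 \<le> poly g m / poly q m" using g(1) dq(3) m(1) by (auto simp: poly_cone_def intro!: divide_nonneg_pos)
      then have c: "c > 0" by (simp add: c_def)
      have gq: "poly g u \<le> c * poly q u" if u: "u \<in> {0..1}" for u
      proof -
        have "poly g u / poly q u \<le> c" using m(2)[OF u] by (simp add: c_def)
        then show ?thesis using dq(3) u by (simp add: pos_divide_le_eq)
      qed
      have "p - smult (1/c) (d * g) \<in> poly_cone n"
        unfolding poly_cone_def
      proof (intro CollectI conjI ballI)
        show "degree (p - smult (1/c) (d * g)) \<le> n"
          using p(1) dg degree_smult_le[of "1/c" "d * g"] by (auto simp: poly_cone_def intro!: degree_diff_le)
        fix u :: real assume u: "u \<in> {0..1}"
        have "poly g u / c \<le> poly q u" using gq[OF u] c by (simp add: field_simps)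
        then have "poly d u * (poly g u / c) \<le> poly d u * poly q u" using dq(2) u by (intro mult_left_mono) auto
        then show "0 \<le> poly (p - smult (1/c) (d * g)) u" unfolding dq(1) by simp
      qed
      then have "\<phi> (p - smult (1/c) (d * g)) \<in> K" using KP by blast
      moreover have "\<phi> (p - smult (1/c) (d * g)) = x0 - (1/c) *\<^sub>R y" unfolding Modules.module_hom.diff[OF hom] Modules.module_hom.scale[OF hom] p(2) g(2) ..
      moreover have "y \<in> K" using dg g(2) KP by blast
      ultimately show "y \<in> F" using cone_face_diffD[OF F cK x0F, of "1/c" y] c by simp
    qed
    \<comment> \<open>Multiplication by \<open>d\<close> identifies P(k) with the face, so the
      result on a full polynomial cone applies to it.\<close>
    have "dual_exposing (\<psi> ` poly_cone k)"
    proof (rule dual_exposing_poly_cone_image)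
      show "\<psi> (f + g) = \<psi> f + \<psi> g" for f g by (simp add: \<psi>_def distrib_left Modules.module_hom.add[OF hom])
      show "\<psi> (smult c f) = c *\<^sub>R \<psi> f" for c f unfolding \<psi>_def mult_smult_right by (rule Modules.module_hom.scale[OF hom])
      show "inj_on \<psi> {p. degree p \<le> k}"
      proof (rule inj_onI)
        fix f g assume fg: "f \<in> {p. degree p \<le> k}" "g \<in> {p. degree p \<le> k}" "\<psi> f = \<psi> g"
        then have "d * f = d * g" using inj_onD[OF inj, of "d * f" "d * g"] deg by (simp add: \<psi>_def)
        then show "f = g" using d0 by simp
      qed
      show "pointed_cone (\<psi> ` poly_cone k)" using pF FE by simp
    qed
    then show ?thesis using FE by simp
  qed
qed

theorem theorem6p6:
  fixes K :: "(real^'n) set"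
  assumes "proper_cone K"
  shows
    "(dual_faces_exposed K \<longrightarrow>
        (\<forall>A \<in> cone_preserving K.
           (\<forall>F. invariant_face A K F \<and> F \<noteq> {0} \<longrightarrow>
              (semi_distinguished A K F \<longleftrightarrow> dominates_subfaces A K F)) \<and>
           (\<forall>\<mu>. distinguished_eigenvalue A K \<mu> \<longrightarrow>
              (cond_subface A K \<mu> \<longleftrightarrow> cond_index A K \<mu>) \<and>
              (cond_index A K \<mu> \<longleftrightarrow> cond_dominating A K \<mu>) \<and>
              cond_subface A K \<mu> \<and> cond_index A K \<mu> \<and> cond_dominating A K \<mu> \<and>
              cond_relint A K \<mu>)))
     \<and> (facially_exposed (dual_cone K) \<and>
           (\<forall>F. nontrivial_face F K \<longrightarrow> polyhedral_cone F) \<longrightarrow> dual_faces_exposed K)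
     \<and> (polyhedral_cone K \<or> strictly_convex_cone K \<and> smooth_cone K \<longrightarrow>
           facially_exposed (dual_cone K) \<and>
           (\<forall>F. nontrivial_face F K \<longrightarrow> polyhedral_cone F))
     \<and> (perfect_cone K \<longrightarrow> dual_faces_exposed K)
     \<and> ((\<exists>n. is_poly_cone n K) \<longrightarrow> dual_faces_exposed K)"
proof (intro conjI)
  have K: "pointed_cone K" using assms by (rule proper_cone_imp_pointed)
  show "dual_faces_exposed K \<longrightarrow>
        (\<forall>A \<in> cone_preserving K.
           (\<forall>F. invariant_face A K F \<and> F \<noteq> {0} \<longrightarrow>
              (semi_distinguished A K F \<longleftrightarrow> dominates_subfaces A K F)) \<and>
           (\<forall>\<mu>. distinguished_eigenvalue A K \<mu> \<longrightarrow>
              (cond_subface A K \<mu> \<longleftrightarrow> cond_index A K \<mu>) \<and>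
              (cond_index A K \<mu> \<longleftrightarrow> cond_dominating A K \<mu>) \<and>
              cond_subface A K \<mu> \<and> cond_index A K \<mu> \<and> cond_dominating A K \<mu> \<and>
              cond_relint A K \<mu>))"
  proof (intro impI ballI)
    fix A assume D: "dual_faces_exposed K" and "A \<in> cone_preserving K"
    then have A: "cone_map A K" using K by (auto simp: cone_map_def cone_preserving_def)
    have E: "dual_exposing G" if "cone_face G K" for G using D that dual_faces_exposed_iff[OF K] by blast
    have "semi_distinguished A K F \<longleftrightarrow> dominates_subfaces A K F" if F: "invariant_face A K F" "F \<noteq> {0}" for F
    proof -
      have "dual_exposing F" using E F(1) by (simp add: invariant_face_iff)
      then show ?thesis
        using semi_distinguished_imp_dominates[OF A F(1)] dominates_imp_semi_distinguished[OF A F] by blast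
    qed
    then show "(\<forall>F. invariant_face A K F \<and> F \<noteq> {0} \<longrightarrow>
              (semi_distinguished A K F \<longleftrightarrow> dominates_subfaces A K F)) \<and>
           (\<forall>\<mu>. distinguished_eigenvalue A K \<mu> \<longrightarrow>
              (cond_subface A K \<mu> \<longleftrightarrow> cond_index A K \<mu>) \<and>
              (cond_index A K \<mu> \<longleftrightarrow> cond_dominating A K \<mu>) \<and>
              cond_subface A K \<mu> \<and> cond_index A K \<mu> \<and> cond_dominating A K \<mu> \<and>
              cond_relint A K \<mu>)"
      using semi_distinguished_conditions[OF A E] by blast
  qed
  show "facially_exposed (dual_cone K) \<and>
           (\<forall>F. nontrivial_face F K \<longrightarrow> polyhedral_cone F) \<longrightarrow> dual_faces_exposed K"
    using dual_faces_exposed_if_faces_polyhedral[OF K] by blast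
  show "polyhedral_cone K \<or> strictly_convex_cone K \<and> smooth_cone K \<longrightarrow>
           facially_exposed (dual_cone K) \<and>
           (\<forall>F. nontrivial_face F K \<longrightarrow> polyhedral_cone F)"
    using polyhedral_imp_hypotheses[OF K] strictly_convex_smooth_imp_hypotheses[OF K] by blast
  show "perfect_cone K \<longrightarrow> dual_faces_exposed K"
    using perfect_imp_dual_faces_exposed[OF K] by blast
  show "(\<exists>n. is_poly_cone n K) \<longrightarrow> dual_faces_exposed K"
    using poly_cone_dual_faces_exposed[OF K] by blast
qed

end
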